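(* If $(M^{4n-1}=G/H,g,\xi_i,\eta_i,\varphi_i)$ is a simply-connected homogeneous 3-Sasakian space then, for each $i\in\{1,2,3\}$, the Sasakian structure $(\xi_i,\eta_i,\varphi_i)$ arises from the Killing spinors $\Psi_i:=\Psi_{\mathcal E_i,0}$ and $\Psi_i':=-\xi_i\cdot\Psi_{\mathcal E_i,0}$ (or $\Psi_i:=\Psi_{\mathcal E_i,1}$ and $\Psi_i':=-\xi_i\cdot\Psi_{\mathcal E_i,1}$) in the following sense: with $\ell:=\|\xi_{\Psi_i,\Psi_i'}\|$, one has $\xi_i=\frac1\ell\xi_{\Psi_i,\Psi_i'}$, $\eta_i=\frac1\ell\eta_{\Psi_i,\Psi_i'}$ and $\varphi_i=\frac1\ell\varphi_{\Psi_i,\Psi_i'}$.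
   Context: A Sasakian structure on $(M,g)$ is a unit Killing field $\xi$ such that, with $\eta=\xi^\flat$, $\varphi=-\nabla^g\xi$, one has $(\nabla^g_X\varphi)Y=g(X,Y)\xi-\eta(Y)X$. A 3-Sasakian structure consists of three Sasakian structures $(g,\xi_i,\eta_i,\varphi_i)$ with orthogonal Reeb fields and $[\xi_i,\xi_j]=2\xi_k$ for even permutations $(i,j,k)$ of $(1,2,3)$. Put $\mathcal V=\mathrm{span}_{\mathbb R}\{\xi_1,\xi_2,\xi_3\}$, $\mathcal H=\bigcap_i\ker\eta_i$. Homogeneous 3-Sasakian: $M=G/H$ with $G$ acting transitively and preserving $g,\xi_i,\eta_i,\varphi_i$. By the known classification the simply-connected ones (dimension $4n-1$) are: $\mathrm{Sp}(n)/\mathrm{Sp}(n-1)$ ($n\ge1$, round $S^{4n-1}$), $\mathrm{SU}(n+1)/\mathrm{S}(\mathrm U(n-1)\times\mathrm U(1))$ ($n\ge2$), $\mathrm{SO}(n+3)/(\mathrm{SO}(n-1)\times\mathrm{Sp}(1))$ ($n\ge4$), $\mathrm G_2/\mathrm{Sp}(1)$, $\mathrm F_4/\mathrm{Sp}(3)$, $\mathrm E_6/\mathrm{SU}(6)$, $\mathrm E_7/\mathrm{Spin}(12)$, $\mathrm E_8/\mathrm E_7$. The structure comes from a $\mathbb Z_2$-grading $\mathfrak g=\mathfrak g_0\oplus\mathfrak g_1$ with $\mathfrak g_0=\mathfrak{sp}(1)\oplus\mathfrak h$, $\mathfrak g_1^{\mathbb C}\cong\mathbb C^2\otimes U$ ($U$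 an $\mathfrak h^{\mathbb C}$-module of dimension $2(n-1)$, $\mathbb C^2$ standard for $\mathfrak{sp}(1)^{\mathbb C}$), $T_oM\cong\mathfrak m=\mathfrak{sp}(1)\oplus\mathfrak g_1$ ($\mathcal V\leftrightarrow\mathfrak{sp}(1)$, $\mathcal H\leftrightarrow\mathfrak g_1$), with $\xi_i$ the basis of $\mathfrak{sp}(1)$ satisfying $[\xi_i,\xi_j]=2\xi_k$, $\varphi_i=\frac12\mathrm{ad}(\xi_i)$ on $\mathfrak{sp}(1)$ and $\mathrm{ad}(\xi_i)$ on $\mathfrak g_1$, and $g=-\frac1{4(n+1)}\kappa$ on $\mathfrak{sp}(1)$, $-\frac1{8(n+1)}\kappa$ on $\mathfrak g_1$ ($\kappa$ the Killing form, the two summands being orthogonal). Spin module: an adapted basis of $\mathfrak m$ is an orthonormal basis $e_1,\dots,e_{4n-1}$ with $e_i=\xi_i$ and $e_{4p+i}=\varphi_i(e_{4p})$ for $i=1,2,3$, $p=1,\dots,n-1$; fix one. Set $x_j=\frac1{\sqrt2}(e_{2j}-ie_{2j+1})$, $y_j=\frac1{\sqrt2}(e_{2j}+ie_{2j+1})$, $1\le j\le 2n-1$, $L'=\mathrm{span}_{\mathbb C}\{y_j\}$, $\Sigma=\Lambda^\bullet L'$ with its usual Hermitian product $\langle\cdot,\cdot\rangle$ (Clifford multiplication by real vectors is skew), and Clifford multiplication: $e_1=i\,\mathrm{Id}$ on even forms and $-i\,\mathrm{Id}$ on odd forms, $e_{2j}\cdot\eta=i(x_j\lrcorner\eta+y_j\wedge\eta)$,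 $e_{2j+1}\cdot\eta=y_j\wedge\eta-x_j\lrcorner\eta$ (where $x_j\lrcorner y_k=\delta_{jk}$). Isotropy takes values in $\{1\}\times\mathrm{Sp}(n-1)\subset\mathrm{SO}(4n-1)$, hence lifts to $\mathrm{Spin}(\mathfrak m)$ and defines a unique $G$-invariant spin structure, which is the one used; $\Sigma M=G\times_H\Sigma$, and $G$-invariant spinors are the $H$-fixed vectors of $\Sigma$. Put $\omega:=\sum_{p=1}^{n-1}y_{2p}\wedge y_{2p+1}$. Killing spinors: $\nabla^g_X\psi=\lambda X\cdot\psi$, $\lambda\in\{\frac12,-\frac12\}$. Set $\psi_k:=\omega^{k+1}-i(k+1)y_1\wedge\omega^k$ for $-1\le k\le n-1$ (with $\omega^{-1}=0,\ \omega^0=1$) if $n\ge2$, and $\psi_{-1}=1,\psi_0=y_1$ if $n=1$. Define $$\Psi_{\mathcal E_1,0}=\psi_{-1},\quad \Psi_{\mathcal E_1,1}=\tfrac in\psi_{n-1},\quad \Psi_{\mathcal E_2,0}=\sum_{k=0}^{\lfloor\frac{n-1}2\rfloor}\tfrac{(-1)^k}{(2k+1)!}\psi_{2k},\quad \Psi_{\mathcal E_2,1}=\sum_{k=0}^{\lfloor\frac n2\rfloor}\tfrac{(-1)^k}{(2k)!}\psi_{2k-1},$$ $$\Psi_{\mathcal E_3,0}=\sum_{k=0}^{\lfloor\frac{n-1}2\rfloor}\tfrac1{(2k+1)!}\psi_{2k},\quad \Psi_{\mathcal E_3,1}=\sum_{k=0}^{\lfloor\frac n2\rfloor}\tfrac1{(2k)!}\psi_{2k-1}.$$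 Associated tensors of a pair of spinors: $\eta_{\psi,\psi'}(X):=\Re\langle\psi,X\cdot\psi'\rangle$, $\xi_{\psi,\psi'}:=\eta_{\psi,\psi'}^\sharp$, $\varphi_{\psi,\psi'}(X):=-\frac12(X\lrcorner d\eta_{\psi,\psi'})^\sharp$. *)

theory Defs
  imports "HOL-Analysis.Analysis"
begin

section \<open>Compact homogeneous spaces\<close>

text \<open>
  A compact Lie group is taken as a compact group of invertible real matrices (no loss of
  generality: every compact Lie group has a faithful matrix representation).  A homogeneous space
  is recorded as the group \<open>grp\<close>, the isotropy group \<open>stab\<close>, an \<open>Ad(stab)\<close>-invariant complement
  \<open>tng\<close> of the isotropy algebra, identified with the tangent space at the base point, and the
  \<open>Ad(stab)\<close>-invariant inner product \<open>met\<close> on it, i.e. an invariant Riemannian metric.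

  A section of a bundle associated with \<open>grp \<rightarrow> grp/stab\<close> is an equivariant function on
  \<open>grp\<close>.  Thus a vector field is a function \<open>V\<close> from \<open>grp\<close> to \<open>tng\<close> with
  \<open>V (a h) = Ad(h\<inverse>) (V a)\<close>, and it is invariant under the action of the group iff it is constant.
\<close>

type_synonym 'n mat = "real^'n^'n"

record ('n::finite) hspace =
  grp  :: "(real^'n^'n) set"
  stab :: "(real^'n^'n) set"
  tng  :: "(real^'n^'n) set"
  met  :: "(real^'n^'n) \<Rightarrow> (real^'n^'n) \<Rightarrow> real"

definition compact_matrix_group :: "('n::finite) mat set \<Rightarrow> bool" where
  "compact_matrix_group G \<longleftrightarrow>
     compact G \<and> mat 1 \<in> G \<and> (\<forall>a\<in>G. \<forall>b\<in>G. a ** b \<in> G) \<and>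
     (\<forall>a\<in>G. invertible a \<and> matrix_inv a \<in> G)"

definition tangent_curve :: "('n::finite) mat set \<Rightarrow> 'n mat \<Rightarrow> (real \<Rightarrow> 'n mat) \<Rightarrow> bool" where
  "tangent_curve G X c \<longleftrightarrow>
     (\<forall>t. c t \<in> G) \<and> c 0 = mat 1 \<and> (c has_vector_derivative X) (at 0)"

definition lie_algebra :: "('n::finite) mat set \<Rightarrow> 'n mat set" where
  "lie_algebra G = {X. \<exists>c. tangent_curve G X c}"

definition lie_bracket :: "('n::finite) mat \<Rightarrow> 'n mat \<Rightarrow> 'n mat" where
  "lie_bracket X Y = X ** Y - Y ** X"

definition Ad :: "('n::finite) mat \<Rightarrow> 'n mat \<Rightarrow> 'n mat" where
  "Ad a X = a ** X ** matrix_inv a"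

definition bilinear_on :: "'v::real_vector set \<Rightarrow> ('v \<Rightarrow> 'v \<Rightarrow> 'w::real_vector) \<Rightarrow> bool" where
  "bilinear_on m B \<longleftrightarrow>
     (\<forall>X\<in>m. \<forall>Y\<in>m. \<forall>Z\<in>m. \<forall>s t.
        B (s *\<^sub>R X + t *\<^sub>R Y) Z = s *\<^sub>R B X Z + t *\<^sub>R B Y Z \<and>
        B Z (s *\<^sub>R X + t *\<^sub>R Y) = s *\<^sub>R B Z X + t *\<^sub>R B Z Y)"

definition riemannian_hspace :: "('n::finite) hspace \<Rightarrow> bool" where
  "riemannian_hspace Q \<longleftrightarrow>
     compact_matrix_group (grp Q) \<and> connected (grp Q) \<and>
     compact_matrix_group (stab Q) \<and> stab Q \<subseteq> grp Q \<and>
     subspace (tng Q) \<and> tng Q \<subseteq> lie_algebra (grp Q) \<and>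
     lie_algebra (stab Q) \<inter> tng Q = {0} \<and>
     (\<forall>Z\<in>lie_algebra (grp Q). \<exists>A\<in>lie_algebra (stab Q). \<exists>X\<in>tng Q. Z = A + X) \<and>
     (\<forall>h\<in>stab Q. \<forall>X\<in>tng Q. Ad h X \<in> tng Q) \<and>
     bilinear_on (tng Q) (met Q) \<and>
     (\<forall>X\<in>tng Q. \<forall>Y\<in>tng Q. met Q X Y = met Q Y X) \<and>
     (\<forall>X\<in>tng Q. X \<noteq> 0 \<longrightarrow> met Q X X > 0) \<and>
     (\<forall>h\<in>stab Q. \<forall>X\<in>tng Q. \<forall>Y\<in>tng Q. met Q (Ad h X) (Ad h Y) = met Q X Y)"

text \<open>
  \<open>M\<close> is a simply-connected space on which \<open>grp\<close> acts continuously and transitively, with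
  isotropy group \<open>stab\<close> at \<open>p0\<close>; as \<open>grp\<close> is compact and \<open>M\<close> is Hausdorff, \<open>M\<close> is homeomorphic to
  \<open>grp/stab\<close>.  Connectedness of \<open>stab\<close> is no restriction: it follows from \<open>grp\<close> being connected
  and \<open>M\<close> simply-connected, by the homotopy sequence of \<open>grp \<rightarrow> M\<close>.
\<close>

definition simply_connected_quotient ::
  "('n::finite) hspace \<Rightarrow> ('n mat \<Rightarrow> 'p \<Rightarrow> 'p) \<Rightarrow> 'p::t2_space set \<Rightarrow> 'p \<Rightarrow> bool" where
  "simply_connected_quotient Q act M p0 \<longleftrightarrow>
     p0 \<in> M \<and> (\<forall>a\<in>grp Q. \<forall>p\<in>M. act a p \<in> M) \<and>
     (\<forall>p\<in>M. act (mat 1) p = p) \<and>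
     (\<forall>a\<in>grp Q. \<forall>b\<in>grp Q. \<forall>p\<in>M. act (a ** b) p = act a (act b p)) \<and>
     continuous_on (grp Q \<times> M) (\<lambda>(a, p). act a p) \<and>
     (\<forall>p\<in>M. \<exists>a\<in>grp Q. act a p0 = p) \<and>
     stab Q = {a \<in> grp Q. act a p0 = p0} \<and>
     simply_connected M \<and> connected (stab Q)"

section \<open>Calculus on a homogeneous space\<close>

text \<open>Derivative at \<open>a\<close> along the left-invariant vector field on the group given by \<open>X\<close>.\<close>

definition has_lderiv ::
  "('n::finite) hspace \<Rightarrow> 'n mat \<Rightarrow> ('n mat \<Rightarrow> 'b::real_normed_vector) \<Rightarrow> 'n mat \<Rightarrow> 'b \<Rightarrow> bool" where
  "has_lderiv Q X f a D \<longleftrightarrow>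
     (\<forall>c. tangent_curve (grp Q) X c \<longrightarrow>
        ((\<lambda>t. f (a ** c t)) has_vector_derivative D) (at 0))"

definition lderiv ::
  "('n::finite) hspace \<Rightarrow> 'n mat \<Rightarrow> ('n mat \<Rightarrow> 'b::real_normed_vector) \<Rightarrow> 'n mat \<Rightarrow> 'b" where
  "lderiv Q X f a = (THE D. has_lderiv Q X f a D)"

definition differentiable_fun :: "('n::finite) hspace \<Rightarrow> ('n mat \<Rightarrow> 'b::real_normed_vector) \<Rightarrow> bool" where
  "differentiable_fun Q f \<longleftrightarrow>
     (\<forall>a\<in>grp Q. \<forall>X\<in>lie_algebra (grp Q). \<exists>D. has_lderiv Q X f a D)"

text \<open>Projection of the Lie algebra of the group to \<open>tng\<close> along the isotropy algebra.\<close>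

definition proj_tng :: "('n::finite) hspace \<Rightarrow> 'n mat \<Rightarrow> 'n mat" where
  "proj_tng Q Z = (THE Y. Y \<in> tng Q \<and> Z - Y \<in> lie_algebra (stab Q))"

definition vector_field :: "('n::finite) hspace \<Rightarrow> ('n mat \<Rightarrow> 'n mat) \<Rightarrow> bool" where
  "vector_field Q V \<longleftrightarrow>
     (\<forall>a\<in>grp Q. V a \<in> tng Q) \<and>
     (\<forall>a\<in>grp Q. \<forall>h\<in>stab Q. V (a ** h) = Ad (matrix_inv h) (V a)) \<and>
     differentiable_fun Q V"

definition invariant_field :: "('n::finite) hspace \<Rightarrow> ('n mat \<Rightarrow> 'b) \<Rightarrow> bool" where
  "invariant_field Q V \<longleftrightarrow> (\<forall>a\<in>grp Q. \<forall>b\<in>grp Q. V (b ** a) = V a)"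

text \<open>
  The last summand below, and the corresponding one in \<open>ext_deriv\<close>, arise because the lifts to
  the group of vector fields on the quotient are combinations of left-invariant fields.
\<close>

definition vf_bracket ::
  "('n::finite) hspace \<Rightarrow> ('n mat \<Rightarrow> 'n mat) \<Rightarrow> ('n mat \<Rightarrow> 'n mat) \<Rightarrow> 'n mat \<Rightarrow> 'n mat" where
  "vf_bracket Q V W a =
     lderiv Q (V a) W a - lderiv Q (W a) V a + proj_tng Q (lie_bracket (V a) (W a))"

definition ext_deriv ::
  "('n::finite) hspace \<Rightarrow> ('n mat \<Rightarrow> 'n mat \<Rightarrow> real) \<Rightarrow> 'n mat \<Rightarrow> 'n mat \<Rightarrow> 'n mat \<Rightarrow> real" where
  "ext_deriv Q \<alpha> a X Y =
     lderiv Q X (\<lambda>b. \<alpha> b Y) a - lderiv Q Y (\<lambda>b. \<alpha> b X) a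
       - \<alpha> a (proj_tng Q (lie_bracket X Y))"

definition sharp :: "('n::finite) hspace \<Rightarrow> ('n mat \<Rightarrow> real) \<Rightarrow> 'n mat" where
  "sharp Q \<alpha> = (THE Z. Z \<in> tng Q \<and> (\<forall>X\<in>tng Q. met Q Z X = \<alpha> X))"

text \<open>
  An invariant connection on the tangent bundle is \<open>X(V) + \<Lambda> X V\<close> for a bilinear map \<open>\<Lambda>\<close> on \<open>tng\<close>
  (its Nomizu map).  The Levi-Civita connection is the one for which the metric is parallel
  (\<open>\<Lambda> X\<close> is skew) and the torsion \<open>\<Lambda> X Y - \<Lambda> Y X - [X, Y]\<^sub>t\<^sub>n\<^sub>g\<close> vanishes.
\<close>

definition levi_civita :: "('n::finite) hspace \<Rightarrow> ('n mat \<Rightarrow> 'n mat \<Rightarrow> 'n mat) \<Rightarrow> bool" where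
  "levi_civita Q \<Lambda> \<longleftrightarrow>
     bilinear_on (tng Q) \<Lambda> \<and>
     (\<forall>X\<in>tng Q. \<forall>Y\<in>tng Q. \<Lambda> X Y \<in> tng Q) \<and>
     (\<forall>X\<in>tng Q. \<forall>Y\<in>tng Q. \<forall>Z\<in>tng Q. met Q (\<Lambda> X Y) Z = - met Q Y (\<Lambda> X Z)) \<and>
     (\<forall>X\<in>tng Q. \<forall>Y\<in>tng Q. \<Lambda> X Y - \<Lambda> Y X = proj_tng Q (lie_bracket X Y))"

definition cov_vf ::
  "('n::finite) hspace \<Rightarrow> ('n mat \<Rightarrow> 'n mat \<Rightarrow> 'n mat) \<Rightarrow> 'n mat \<Rightarrow> ('n mat \<Rightarrow> 'n mat) \<Rightarrow> 'n mat \<Rightarrow> 'n mat" where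
  "cov_vf Q \<Lambda> X V a = lderiv Q X V a + \<Lambda> X (V a)"

text \<open>Covariant derivative of a field of endomorphisms.\<close>

definition cov_end ::
  "('n::finite) hspace \<Rightarrow> ('n mat \<Rightarrow> 'n mat \<Rightarrow> 'n mat) \<Rightarrow> 'n mat \<Rightarrow>
   ('n mat \<Rightarrow> 'n mat \<Rightarrow> 'n mat) \<Rightarrow> 'n mat \<Rightarrow> 'n mat \<Rightarrow> 'n mat" where
  "cov_end Q \<Lambda> X F a Y = lderiv Q X (\<lambda>b. F b Y) a + \<Lambda> X (F a Y) - F a (\<Lambda> X Y)"

section \<open>3-Sasakian structures\<close>

definition reeb_form :: "('n::finite) hspace \<Rightarrow> ('n mat \<Rightarrow> 'n mat) \<Rightarrow> 'n mat \<Rightarrow> 'n mat \<Rightarrow> real" where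
  "reeb_form Q \<xi> a X = met Q (\<xi> a) X"

definition reeb_end ::
  "('n::finite) hspace \<Rightarrow> ('n mat \<Rightarrow> 'n mat \<Rightarrow> 'n mat) \<Rightarrow> ('n mat \<Rightarrow> 'n mat) \<Rightarrow> 'n mat \<Rightarrow> 'n mat \<Rightarrow> 'n mat" where
  "reeb_end Q \<Lambda> \<xi> a X = - cov_vf Q \<Lambda> X \<xi> a"

definition killing_field ::
  "('n::finite) hspace \<Rightarrow> ('n mat \<Rightarrow> 'n mat \<Rightarrow> 'n mat) \<Rightarrow> ('n mat \<Rightarrow> 'n mat) \<Rightarrow> bool" where
  "killing_field Q \<Lambda> V \<longleftrightarrow> vector_field Q V \<and>
     (\<forall>a\<in>grp Q. \<forall>X\<in>tng Q. \<forall>Y\<in>tng Q.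
        met Q (cov_vf Q \<Lambda> X V a) Y + met Q X (cov_vf Q \<Lambda> Y V a) = 0)"

definition sasakian ::
  "('n::finite) hspace \<Rightarrow> ('n mat \<Rightarrow> 'n mat \<Rightarrow> 'n mat) \<Rightarrow> ('n mat \<Rightarrow> 'n mat) \<Rightarrow> bool" where
  "sasakian Q \<Lambda> \<xi> \<longleftrightarrow>
     killing_field Q \<Lambda> \<xi> \<and> (\<forall>a\<in>grp Q. met Q (\<xi> a) (\<xi> a) = 1) \<and>
     (\<forall>a\<in>grp Q. \<forall>X\<in>tng Q. \<forall>Y\<in>tng Q.
        cov_end Q \<Lambda> X (reeb_end Q \<Lambda> \<xi>) a Y
          = met Q X Y *\<^sub>R \<xi> a - reeb_form Q \<xi> a Y *\<^sub>R X)"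

definition three_sasakian ::
  "('n::finite) hspace \<Rightarrow> ('n mat \<Rightarrow> 'n mat \<Rightarrow> 'n mat) \<Rightarrow> (nat \<Rightarrow> 'n mat \<Rightarrow> 'n mat) \<Rightarrow> bool" where
  "three_sasakian Q \<Lambda> \<xi> \<longleftrightarrow>
     (\<forall>i\<in>{1,2,3}. sasakian Q \<Lambda> (\<xi> i)) \<and>
     (\<forall>i\<in>{1,2,3}. \<forall>j\<in>{1,2,3}. i \<noteq> j \<longrightarrow> (\<forall>a\<in>grp Q. met Q (\<xi> i a) (\<xi> j a) = 0)) \<and>
     (\<forall>(i,j,k)\<in>{(1,2,3),(2,3,1),(3,1,2)}. \<forall>a\<in>grp Q.
        vf_bracket Q (\<xi> i) (\<xi> j) a = 2 *\<^sub>R \<xi> k a)"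

text \<open>
  Invariance of the metric is part of \<open>riemannian_hspace\<close>; invariance of the forms and
  endomorphisms belonging to the \<open>\<xi> i\<close> follows from that of the \<open>\<xi> i\<close>.
\<close>

definition homogeneous_three_sasakian ::
  "('n::finite) hspace \<Rightarrow> ('n mat \<Rightarrow> 'n mat \<Rightarrow> 'n mat) \<Rightarrow> (nat \<Rightarrow> 'n mat \<Rightarrow> 'n mat) \<Rightarrow> bool" where
  "homogeneous_three_sasakian Q \<Lambda> \<xi> \<longleftrightarrow>
     riemannian_hspace Q \<and> levi_civita Q \<Lambda> \<and> three_sasakian Q \<Lambda> \<xi> \<and>
     (\<forall>i\<in>{1,2,3}. invariant_field Q (\<xi> i))"

text \<open>In particular the dimension of the space is \<open>4 n - 1\<close>.\<close>

definition adapted_basis ::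
  "('n::finite) hspace \<Rightarrow> ('n mat \<Rightarrow> 'n mat \<Rightarrow> 'n mat) \<Rightarrow> (nat \<Rightarrow> 'n mat \<Rightarrow> 'n mat) \<Rightarrow> nat \<Rightarrow>
   (nat \<Rightarrow> 'n mat) \<Rightarrow> bool" where
  "adapted_basis Q \<Lambda> \<xi> n e \<longleftrightarrow>
     n \<ge> 1 \<and> span (e ` {1..4*n-1}) = tng Q \<and>
     (\<forall>a\<in>{1..4*n-1}. \<forall>b\<in>{1..4*n-1}. met Q (e a) (e b) = (if a = b then 1 else 0)) \<and>
     (\<forall>i\<in>{1,2,3}. e i = \<xi> i (mat 1)) \<and>
     (\<forall>i\<in>{1,2,3}. \<forall>p\<in>{1..n-1}. e (4*p+i) = reeb_end Q \<Lambda> (\<xi> i) (mat 1) (e (4*p)))"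

section \<open>The spin module\<close>

text \<open>
  An element of the exterior algebra on \<open>y\<^sub>1, y\<^sub>2, \<dots>\<close> is given by its coefficients: the value at
  \<open>S = {j\<^sub>1 < \<dots> < j\<^sub>r}\<close> is the coefficient of \<open>y\<^sub>j\<^sub>1 \<and> \<dots> \<and> y\<^sub>j\<^sub>r\<close>.
\<close>

type_synonym spinor = "nat set \<Rightarrow> complex"

definition spinors :: "nat \<Rightarrow> spinor set" where
  "spinors n = {\<psi>. \<forall>S. \<not> S \<subseteq> {1..2*n-1} \<longrightarrow> \<psi> S = 0}"

definition unit_form :: spinor where
  "unit_form S = (if S = {} then 1 else 0)"

definition ygen :: "nat \<Rightarrow> spinor" where
  "ygen j S = (if S = {j} then 1 else 0)"

definition wedge :: "spinor \<Rightarrow> spinor \<Rightarrow> spinor" where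
  "wedge \<alpha> \<beta> S =
     (\<Sum>A\<in>Pow S. (-1) ^ card {(a, b). a \<in> A \<and> b \<in> S - A \<and> b < a} * \<alpha> A * \<beta> (S - A))"

primrec wedge_power :: "spinor \<Rightarrow> nat \<Rightarrow> spinor" where
  "wedge_power \<alpha> 0 = unit_form"
| "wedge_power \<alpha> (Suc k) = wedge \<alpha> (wedge_power \<alpha> k)"

text \<open>Contraction with \<open>x\<^sub>j\<close>, where \<open>x\<^sub>j\<close> pairs to \<open>\<delta>\<^sub>j\<^sub>k\<close> with \<open>y\<^sub>k\<close>.\<close>

definition contract :: "nat \<Rightarrow> spinor \<Rightarrow> spinor" where
  "contract j \<psi> S =
     (if j \<in> S then 0 else (-1) ^ card {k \<in> S. k < j} * \<psi> (insert j S))"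

definition hermitian :: "nat \<Rightarrow> spinor \<Rightarrow> spinor \<Rightarrow> complex" where
  "hermitian n \<psi> \<psi>' = (\<Sum>S\<in>Pow {1..2*n-1}. \<psi> S * cnj (\<psi>' S))"

definition cliff_basis :: "nat \<Rightarrow> spinor \<Rightarrow> spinor" where
  "cliff_basis a \<psi> =
     (if a = 1 then (\<lambda>S. (if even (card S) then \<i> else - \<i>) * \<psi> S)
      else if even a then
        (\<lambda>S. \<i> * (contract (a div 2) \<psi> S + wedge (ygen (a div 2)) \<psi> S))
      else (\<lambda>S. wedge (ygen (a div 2)) \<psi> S - contract (a div 2) \<psi> S))"

definition cliff ::
  "('n::finite) hspace \<Rightarrow> nat \<Rightarrow> (nat \<Rightarrow> 'n mat) \<Rightarrow> 'n mat \<Rightarrow> spinor \<Rightarrow> spinor" where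
  "cliff Q n e X \<psi> S = (\<Sum>a=1..4*n-1. of_real (met Q X (e a)) * cliff_basis a \<psi> S)"

text \<open>
  Spin group: products of an even number of unit vectors, acting on spinors (the spin
  representation is faithful).  \<open>spin_lift\<close>: a lift of the isotropy representation to the spin
  group; since the isotropy group is connected there is at most one.
\<close>

definition spin_action ::
  "('n::finite) hspace \<Rightarrow> nat \<Rightarrow> (nat \<Rightarrow> 'n mat) \<Rightarrow> 'n mat list \<Rightarrow> spinor \<Rightarrow> spinor" where
  "spin_action Q n e vs \<psi> = foldr (cliff Q n e) vs \<psi>"

definition spin_lift ::
  "('n::finite) hspace \<Rightarrow> nat \<Rightarrow> (nat \<Rightarrow> 'n mat) \<Rightarrow> ('n mat \<Rightarrow> spinor \<Rightarrow> spinor) \<Rightarrow> bool" where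
  "spin_lift Q n e \<rho> \<longleftrightarrow>
     (\<forall>h\<in>stab Q. \<exists>vs. even (length vs) \<and> (\<forall>v\<in>set vs. v \<in> tng Q \<and> met Q v v = 1) \<and>
        (\<forall>\<psi>\<in>spinors n. \<rho> h \<psi> = spin_action Q n e vs \<psi>)) \<and>
     (\<forall>h\<in>stab Q. \<forall>X\<in>tng Q. \<forall>\<psi>\<in>spinors n.
        \<rho> h (cliff Q n e X \<psi>) = cliff Q n e (Ad h X) (\<rho> h \<psi>)) \<and>
     (\<forall>h\<in>stab Q. \<forall>k\<in>stab Q. \<forall>\<psi>\<in>spinors n. \<rho> (h ** k) \<psi> = \<rho> h (\<rho> k \<psi>)) \<and>
     (\<forall>\<psi>\<in>spinors n. \<forall>S. continuous_on (stab Q) (\<lambda>h. \<rho> h \<psi> S))"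

text \<open>
  Sections of the spinor bundle associated with \<open>\<rho>\<close>: functions \<open>\<psi>\<close> on the group with
  \<open>\<psi> (a h) = \<rho>(h)\<inverse> (\<psi> a)\<close>.  Such a section is invariant iff it is constant.
\<close>

definition spinor_field ::
  "('n::finite) hspace \<Rightarrow> nat \<Rightarrow> ('n mat \<Rightarrow> spinor \<Rightarrow> spinor) \<Rightarrow> ('n mat \<Rightarrow> spinor) \<Rightarrow> bool" where
  "spinor_field Q n \<rho> \<psi> \<longleftrightarrow>
     (\<forall>a\<in>grp Q. \<psi> a \<in> spinors n) \<and>
     (\<forall>a\<in>grp Q. \<forall>h\<in>stab Q. \<rho> h (\<psi> (a ** h)) = \<psi> a) \<and>
     (\<forall>S. differentiable_fun Q (\<lambda>a. \<psi> a S))"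

text \<open>
  The isomorphism of Lie algebras from \<open>so(tng)\<close> to \<open>spin(tng)\<close>, composed with the spin
  representation.  With \<open>e\<^sub>a \<cdot> e\<^sub>a = -1\<close>, the commutator of \<open>\<onehalf> e\<^sub>a \<cdot> e\<^sub>b\<close> with a vector is the
  rotation taking \<open>e\<^sub>a\<close> to \<open>e\<^sub>b\<close> and \<open>e\<^sub>b\<close> to \<open>- e\<^sub>a\<close>.
\<close>

definition spin_rep ::
  "('n::finite) hspace \<Rightarrow> nat \<Rightarrow> (nat \<Rightarrow> 'n mat) \<Rightarrow> ('n mat \<Rightarrow> 'n mat) \<Rightarrow> spinor \<Rightarrow> spinor" where
  "spin_rep Q n e A \<psi> S =
     (\<Sum>(a, b) \<in> {(a, b). 1 \<le> a \<and> a < b \<and> b \<le> 4*n-1}.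
        of_real (met Q (A (e a)) (e b) / 2) * cliff Q n e (e a) (cliff Q n e (e b) \<psi>) S)"

definition cov_spinor ::
  "('n::finite) hspace \<Rightarrow> ('n mat \<Rightarrow> 'n mat \<Rightarrow> 'n mat) \<Rightarrow> nat \<Rightarrow> (nat \<Rightarrow> 'n mat) \<Rightarrow>
   'n mat \<Rightarrow> ('n mat \<Rightarrow> spinor) \<Rightarrow> 'n mat \<Rightarrow> spinor" where
  "cov_spinor Q \<Lambda> n e X \<psi> a S =
     lderiv Q X (\<lambda>b. \<psi> b S) a + spin_rep Q n e (\<Lambda> X) (\<psi> a) S"

definition killing_spinor ::
  "('n::finite) hspace \<Rightarrow> ('n mat \<Rightarrow> 'n mat \<Rightarrow> 'n mat) \<Rightarrow> nat \<Rightarrow> (nat \<Rightarrow> 'n mat) \<Rightarrow>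
   ('n mat \<Rightarrow> spinor \<Rightarrow> spinor) \<Rightarrow> ('n mat \<Rightarrow> spinor) \<Rightarrow> bool" where
  "killing_spinor Q \<Lambda> n e \<rho> \<psi> \<longleftrightarrow>
     spinor_field Q n \<rho> \<psi> \<and>
     (\<exists>lam\<in>{1/2, -1/2::real}. \<forall>a\<in>grp Q. \<forall>X\<in>tng Q. \<forall>S.
        cov_spinor Q \<Lambda> n e X \<psi> a S = of_real lam * cliff Q n e X (\<psi> a) S)"

section \<open>The distinguished spinors\<close>

definition \<omega> :: "nat \<Rightarrow> spinor" where
  "\<omega> n S = (\<Sum>p=1..n-1. wedge (ygen (2*p)) (ygen (2*p+1)) S)"

definition \<omega>_power :: "nat \<Rightarrow> int \<Rightarrow> spinor" where
  "\<omega>_power n k = (if k < 0 then (\<lambda>S. 0) else wedge_power (\<omega> n) (nat k))"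

text \<open>For \<open>n = 1\<close> only \<open>k = -1\<close> and \<open>k = 0\<close> occur.\<close>

definition psi :: "nat \<Rightarrow> int \<Rightarrow> spinor" where
  "psi n k =
     (if n = 1 then (if k = -1 then unit_form else ygen 1)
      else (\<lambda>S. \<omega>_power n (k + 1) S - \<i> * of_int (k + 1) * wedge (ygen 1) (\<omega>_power n k) S))"

definition Psi :: "nat \<Rightarrow> nat \<Rightarrow> nat \<Rightarrow> spinor" where
  "Psi n i j S =
     (if i = 1 then
        (if j = 0 then psi n (-1) S else \<i> / of_nat n * psi n (int n - 1) S)
      else if i = 2 then
        (if j = 0 then \<Sum>k=0..(n-1) div 2. (-1)^k / fact (2*k+1) * psi n (2 * int k) S
         else \<Sum>k=0..n div 2. (-1)^k / fact (2*k) * psi n (2 * int k - 1) S)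
      else
        (if j = 0 then \<Sum>k=0..(n-1) div 2. 1 / fact (2*k+1) * psi n (2 * int k) S
         else \<Sum>k=0..n div 2. 1 / fact (2*k) * psi n (2 * int k - 1) S))"

section \<open>Tensors associated with a pair of spinors\<close>

definition assoc_form ::
  "('n::finite) hspace \<Rightarrow> nat \<Rightarrow> (nat \<Rightarrow> 'n mat) \<Rightarrow> ('n mat \<Rightarrow> spinor) \<Rightarrow> ('n mat \<Rightarrow> spinor) \<Rightarrow>
   'n mat \<Rightarrow> 'n mat \<Rightarrow> real" where
  "assoc_form Q n e \<psi> \<psi>' a X = Re (hermitian n (\<psi> a) (cliff Q n e X (\<psi>' a)))"

definition assoc_field ::
  "('n::finite) hspace \<Rightarrow> nat \<Rightarrow> (nat \<Rightarrow> 'n mat) \<Rightarrow> ('n mat \<Rightarrow> spinor) \<Rightarrow> ('n mat \<Rightarrow> spinor) \<Rightarrow>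
   'n mat \<Rightarrow> 'n mat" where
  "assoc_field Q n e \<psi> \<psi>' a = sharp Q (assoc_form Q n e \<psi> \<psi>' a)"

definition assoc_end ::
  "('n::finite) hspace \<Rightarrow> nat \<Rightarrow> (nat \<Rightarrow> 'n mat) \<Rightarrow> ('n mat \<Rightarrow> spinor) \<Rightarrow> ('n mat \<Rightarrow> spinor) \<Rightarrow>
   'n mat \<Rightarrow> 'n mat \<Rightarrow> 'n mat" where
  "assoc_end Q n e \<psi> \<psi>' a X =
     (- 1/2) *\<^sub>R sharp Q (ext_deriv Q (assoc_form Q n e \<psi> \<psi>') a X)"

definition tnorm :: "('n::finite) hspace \<Rightarrow> 'n mat \<Rightarrow> real" where
  "tnorm Q X = sqrt (met Q X X)"

end

theory Submission
  imports Defs "HOL-Library.Function_Algebras"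
begin

text \<open>
Write \<open>\<phi>\<^sub>i X = - \<Lambda> X \<xi>\<^sub>i\<close>, and let \<open>E\<^sub>i\<close> be the space of spinors \<open>\<psi>\<close> with
\<open>\<phi>\<^sub>i Y \<cdot> \<psi> + Y \<cdot> \<xi>\<^sub>i \<cdot> \<psi> + \<eta>\<^sub>i(Y) \<psi> = 0\<close> for every tangent vector \<open>Y\<close>; below it is called
\<open>sasaki_spinors i\<close>.  Since \<open>\<xi>\<^sub>i \<cdot>\<close> maps \<open>E\<^sub>i\<close> to itself, it is enough to place the given spinor
in \<open>E\<^sub>i\<close> and to show that all elements of \<open>E\<^sub>i\<close> are invariant Killing spinors.

\<^item> Membership.  Every \<open>e\<^sub>a \<cdot>\<close> permutes the coefficients of a spinor up to phases, so the equations of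
  \<open>E\<^sub>i\<close> are relations between single coefficients.  \<open>E\<^sub>1\<close> consists of the combinations of \<open>1\<close> and
  the top form (\<open>sasaki_1_iff\<close>); \<open>E\<^sub>2\<close> and \<open>E\<^sub>3\<close> are given by a recursion that starts from the
  coefficients at the empty set and at \<open>{1}\<close> (\<open>sasaki_2_iff\<close>, \<open>sasaki_3_iff\<close>, \<open>pair_sector_eq_0\<close>).
  The coefficients of \<open>\<psi>\<^sub>k\<close> are \<open>(k+1)!\<close> or \<open>-\<i> (k+1)!\<close> on the index sets of weight \<open>k+1\<close>, so the
  factorials in the distinguished spinors cancel and the recursion can be read off (\<open>Psi_ladder\<close>).

\<^item> Rigidity.  Let \<open>T\<close> preserve the three spaces, commute on \<open>E\<^sub>i\<close> with \<open>\<xi>\<^sub>i \<cdot>\<close>, and let its adjoint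
  do the same and commute with charge conjugation, the antiunitary map that commutes with all
  Clifford products by real vectors.  The adjoint has \<open>1\<close> as an eigenvector, and its eigenvalue at
  the top form is the complex conjugate.  An element of \<open>E\<^sub>2\<close> is determined by its two lowest
  coefficients, hence \<open>T\<close> is a scalar on \<open>E\<^sub>2\<close>; an element with a non-zero top coefficient shows
  that this scalar is real.  So \<open>T\<close> is one real scalar on \<open>E\<^sub>1\<close>, \<open>E\<^sub>2\<close> and \<open>E\<^sub>3\<close> (\<open>rigidity\<close>).

\<^item> Killing equation.  The operator \<open>D\<^sub>X\<close>, Clifford action of \<open>\<Lambda> X\<close> minus \<open>\<onehalf> X \<cdot>\<close>, preserves \<open>E\<^sub>i\<close>
  by the Sasakian identity for \<open>\<nabla>\<phi>\<^sub>i\<close> (\<open>killing_defect_sasaki\<close>).  It is skew-Hermitian, so the real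
  scalar by which it acts is \<open>0\<close>.

\<^item> Invariance.  The isotropy group preserves the metric, \<open>\<xi>\<^sub>i\<close> and \<open>\<phi>\<^sub>i\<close>, so its spin lift preserves
  \<open>E\<^sub>i\<close>.  It is unitary, so the real scalar is \<open>1\<close> or \<open>-1\<close>, and \<open>1\<close> by connectedness
  (\<open>spin_lift_invariant\<close>).

The tensors come last.  Clifford products being skew, \<open>\<Re>\<langle>\<psi>, X \<cdot> (- \<xi>\<^sub>i \<cdot> \<psi>)\<rangle> = \<parallel>\<psi>\<parallel>\<^sup>2 \<eta>\<^sub>i(X)\<close>,
so that \<open>l = \<parallel>\<psi>\<parallel>\<^sup>2\<close>; and \<open>d\<eta>\<^sub>i(X, Y) = - 2 g(\<phi>\<^sub>i X, Y)\<close> because \<open>\<Lambda>\<close> has no torsion and \<open>\<xi>\<^sub>i\<close> is a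
Killing field.
\<close>

section \<open>Clifford multiplication on coefficients\<close>

definition smul :: "complex \<Rightarrow> spinor \<Rightarrow> spinor" where
  "smul c \<psi> = (\<lambda>S. c * \<psi> S)"

lemma smul_apply: "smul c \<psi> S = c * \<psi> S"
  by (simp add: smul_def)

text \<open>
Spinors form a vector space under pointwise operations.  Equations between spinors are kept as
equations in that space; coefficients are taken only on request, by \<open>pointwise\<close>.
\<close>

declare plus_fun_apply [simp del] zero_fun_apply [simp del] uminus_apply [simp del]
  minus_apply [simp del]

lemmas pointwise = smul_apply plus_fun_apply zero_fun_apply uminus_apply minus_apply

lemma smul_one [simp]: "smul 1 \<psi> = \<psi>"
  and smul_smul [simp]: "smul c (smul d \<psi>) = smul (c * d) \<psi>"
  by (simp_all add: smul_def mult.assoc)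

lemma sum_spinor_apply: "(\<Sum>a\<in>A. f a) S = (\<Sum>a\<in>A. (f a :: spinor) S)"
  by (induction A rule: infinite_finite_induct) (auto simp: pointwise)

text \<open>
Creation and annihilation of \<open>y\<^sub>j\<close> both toggle the membership of \<open>j\<close>, so that \<open>e\<^sub>a\<close> moves the
coefficient at \<open>target a S\<close> to \<open>S\<close> and multiplies it by \<open>phase a S\<close> (see \<open>cliff_basis_apply\<close>).
\<close>

definition toggle :: "nat \<Rightarrow> nat set \<Rightarrow> nat set" where
  "toggle j S = (if j \<in> S then S - {j} else insert j S)"

definition count_sign :: "nat \<Rightarrow> nat set \<Rightarrow> complex" where
  "count_sign j S = (-1) ^ card {k \<in> S. k < j}"

definition phase :: "nat \<Rightarrow> nat set \<Rightarrow> complex" where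
  "phase a S =
     (if a = 1 then \<i> * (-1) ^ card S
      else if even a then \<i> * count_sign (a div 2) S
      else (if a div 2 \<in> S then 1 else -1) * count_sign (a div 2) S)"

definition target :: "nat \<Rightarrow> nat set \<Rightarrow> nat set" where
  "target a S = (if a = 1 then S else toggle (a div 2) S)"

lemma finite_toggle [simp]: "finite (toggle j S) \<longleftrightarrow> finite S"
  by (simp add: toggle_def)

lemma toggle_toggle [simp]: "toggle j (toggle j S) = S"
  by (auto simp: toggle_def)

lemma toggle_commute: "toggle j (toggle k S) = toggle k (toggle j S)"
  by (auto simp: toggle_def)

lemma mem_toggle [simp]: "k \<in> toggle j S \<longleftrightarrow> (if k = j then k \<notin> S else k \<in> S)"
  by (auto simp: toggle_def)

lemma finite_target [simp]: "finite (target a S) \<longleftrightarrow> finite S"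
  by (simp add: target_def)

lemma target_target [simp]: "target a (target a S) = S"
  by (simp add: target_def)

lemma target_commute: "target a (target b S) = target b (target a S)"
  by (simp add: target_def toggle_commute)

lemma power_card_toggle:
  assumes "finite S"
  shows "(-1) ^ card (toggle j S) = - ((-1 :: complex) ^ card S)"
proof (cases "j \<in> S")
  case True
  then obtain m where "card S = Suc m" "card (S - {j}) = m"
    using assms by (metis card_Suc_Diff1)
  then show ?thesis using True by (simp add: toggle_def)
qed (use assms in \<open>simp add: toggle_def\<close>)

lemma count_sign_square [simp]: "count_sign j S * count_sign j S = 1"
  by (simp add: count_sign_def flip: power_mult_distrib)

lemma cnj_count_sign [simp]: "cnj (count_sign j S) = count_sign j S"
  by (simp add: count_sign_def)

lemma count_sign_toggle:
  "count_sign k (toggle j S) = (if j < k then - count_sign k S else count_sign k S)"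
proof (cases "j < k")
  case True
  have "{i \<in> toggle j S. i < k} = toggle j {i \<in> S. i < k}"
    using True by (auto simp: toggle_def)
  then show ?thesis using True
    by (simp add: count_sign_def power_card_toggle)
next
  case False
  then have "{i \<in> toggle j S. i < k} = {i \<in> S. i < k}"
    by (auto simp: toggle_def)
  then show ?thesis using False by (simp add: count_sign_def)
qed

text \<open>
Toggling \<open>j\<close> changes the sign at exactly those \<open>k\<close> with \<open>j < k\<close>; of two different indices only the
smaller one disturbs the other.  For \<open>e\<^sub>2\<^sub>j\<close> and \<open>e\<^sub>2\<^sub>j\<^sub>+\<^sub>1\<close> the change comes from the sign that tells
creation from annihilation, for \<open>e\<^sub>1\<close> from the parity of the set.
\<close>

lemma phase_anticommute:
  assumes "finite S" "a \<noteq> b" "1 \<le> a" "1 \<le> b"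
  shows "phase a S * phase b (target a S) = - (phase b S * phase a (target b S))"
proof -
  have ab: "a div 2 = b div 2 \<Longrightarrow> even a \<noteq> even b"
    using assms(2) by presburger
  consider "a = 1" "b \<noteq> 1" | "b = 1" "a \<noteq> 1" | "a \<noteq> 1" "b \<noteq> 1" using assms by auto
  then show ?thesis
  proof cases
    case 1
    then show ?thesis using assms(1)
      by (simp add: phase_def target_def count_sign_toggle power_card_toggle)
  next
    case 2
    then show ?thesis using assms(1)
      by (simp add: phase_def target_def count_sign_toggle power_card_toggle)
  next
    case 3
    consider "a div 2 < b div 2" | "b div 2 < a div 2" | "a div 2 = b div 2" by linarith
    then show ?thesis
      using 3 ab by cases (auto simp: phase_def target_def count_sign_toggle)
  qed
qed

lemma phase_square: "phase a S * phase a (target a S) = -1"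
proof -
  have i: "(\<i> * x) * (\<i> * x) = - (x * x)" for x :: complex
    by (simp add: complex_eq_iff algebra_simps)
  have m: "(-1 :: complex) ^ k * (-1) ^ k = 1" for k
    by (metis mult_1 mult_minus_left power_mult_distrib power_one minus_mult_minus)
  consider "a = 1" | "a \<noteq> 1" "even a" | "a \<noteq> 1" "odd a" by blast
  then show ?thesis
  proof cases
    case 1
    then show ?thesis by (simp only: phase_def target_def i m if_True simp_thms)
  next
    case 2
    then show ?thesis
      by (simp only: phase_def target_def i count_sign_square count_sign_toggle
          if_True if_False less_irrefl simp_thms)
  next
    case 3
    then show ?thesis
      by (cases "a div 2 \<in> S") (simp_all add: phase_def target_def count_sign_toggle)
  qed
qed

lemma phase_target_cnj:
  assumes "1 \<le> a" shows "cnj (phase a (target a S)) = - phase a S"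
  by (auto simp: phase_def target_def count_sign_toggle)

lemma cnj_phase: "cnj (phase a S) = (if a = 1 \<or> even a then - phase a S else phase a S)"
  by (auto simp: phase_def)

lemma wedge_ygen:
  "wedge (ygen j) \<psi> S = (if finite S \<and> j \<in> S then count_sign j S * \<psi> (S - {j}) else 0)"
proof (cases "finite S")
  case False
  then show ?thesis by (simp add: wedge_def)
next
  case True
  let ?f = "\<lambda>A. (-1) ^ card {(a, b). a \<in> A \<and> b \<in> S - A \<and> b < a} * ygen j A * \<psi> (S - A)"
  have zero: "?f A = 0" if "A \<noteq> {j}" for A
    using that by (simp add: ygen_def)
  show ?thesis
  proof (cases "j \<in> S")
    case True
    have "{(a, b). a \<in> {j} \<and> b \<in> S - {j} \<and> b < a} = {j} \<times> {k \<in> S. k < j}"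
      by auto
    then have "?f {j} = count_sign j S * \<psi> (S - {j})"
      by (simp add: ygen_def count_sign_def card_cartesian_product)
    moreover have "wedge (ygen j) \<psi> S = (\<Sum>A\<in>{{j}}. ?f A)"
      unfolding wedge_def using True zero \<open>finite S\<close>
      by (intro sum.mono_neutral_right) auto
    ultimately show ?thesis using True \<open>finite S\<close> by simp
  next
    case False
    then have "A \<noteq> {j}" if "A \<in> Pow S" for A using that by auto
    then have "wedge (ygen j) \<psi> S = 0"
      unfolding wedge_def using zero by (intro sum.neutral) auto
    then show ?thesis using False by simp
  qed
qed

lemma spinors_eq_0: "\<psi> \<in> spinors n \<Longrightarrow> \<not> S \<subseteq> {1..2*n-1} \<Longrightarrow> \<psi> S = 0"
  by (auto simp: spinors_def)

lemma spinors_infinite: "\<psi> \<in> spinors n \<Longrightarrow> infinite S \<Longrightarrow> \<psi> S = 0"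
  by (rule spinors_eq_0) (auto dest: finite_subset)

text \<open>
The restriction to \<open>spinors n\<close> takes care of infinite index sets, where \<open>wedge\<close> vanishes and
\<open>contract\<close> does not.
\<close>

lemma cliff_basis_apply:
  assumes "\<psi> \<in> spinors n" "1 \<le> a"
  shows "cliff_basis a \<psi> S = phase a S * \<psi> (target a S)"
proof (cases "finite S")
  case False
  then have "\<psi> S = 0" "\<psi> (insert (a div 2) S) = 0" "\<psi> (S - {a div 2}) = 0"
    using spinors_infinite[OF assms(1)] by auto
  then show ?thesis using False
    by (auto simp: cliff_basis_def contract_def wedge_ygen target_def toggle_def)
next
  case True
  then show ?thesis using assms(2)
    by (auto simp: cliff_basis_def contract_def wedge_ygen target_def toggle_def phase_def
        count_sign_def)
qed

lemma target_subset:
  assumes "1 \<le> a" "a \<le> 4*n-1"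
  shows "target a S \<subseteq> {1..2*n-1} \<longleftrightarrow> S \<subseteq> {1..2*n-1}"
proof (cases "a = 1")
  case False
  then have "a div 2 \<in> {1..2*n-1}" using assms by auto
  then show ?thesis using False by (auto simp: target_def toggle_def)
qed (simp add: target_def)

lemma cliff_basis_spinors:
  assumes "\<psi> \<in> spinors n" "1 \<le> a" "a \<le> 4*n-1"
  shows "cliff_basis a \<psi> \<in> spinors n"
proof -
  have "cliff_basis a \<psi> S = 0" if "\<not> S \<subseteq> {1..2*n-1}" for S
  proof -
    have "\<not> target a S \<subseteq> {1..2*n-1}" using that target_subset[OF assms(2,3)] by blast
    from spinors_eq_0[OF assms(1) this] show ?thesis by (simp add: cliff_basis_apply[OF assms(1,2)])
  qed
  then show ?thesis unfolding spinors_def by blast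
qed

lemma wedge_right_linear:
  "wedge \<alpha> (\<psi> + \<phi>) = wedge \<alpha> \<psi> + wedge \<alpha> \<phi>"
  "wedge \<alpha> (smul c \<psi>) = smul c (wedge \<alpha> \<psi>)"
  by (auto simp: pointwise fun_eq_iff wedge_def algebra_simps sum.distrib sum_distrib_left)

lemma contract_linear:
  "contract j (\<psi> + \<phi>) = contract j \<psi> + contract j \<phi>"
  "contract j (smul c \<psi>) = smul c (contract j \<psi>)"
  by (auto simp: pointwise fun_eq_iff contract_def algebra_simps)

lemma cliff_basis_add: "cliff_basis a (\<psi> + \<phi>) = cliff_basis a \<psi> + cliff_basis a \<phi>"
  by (auto simp: pointwise fun_eq_iff cliff_basis_def wedge_right_linear contract_linear algebra_simps)

lemma cliff_basis_smul: "cliff_basis a (smul c \<psi>) = smul c (cliff_basis a \<psi>)"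
  by (auto simp: pointwise fun_eq_iff cliff_basis_def wedge_right_linear contract_linear algebra_simps)

lemma cliff_basis_anticommute:
  assumes "\<psi> \<in> spinors n" "a \<in> {1..4*n-1}" "b \<in> {1..4*n-1}"
  shows "cliff_basis a (cliff_basis b \<psi>)
     = - cliff_basis b (cliff_basis a \<psi>) - smul (if a = b then 2 else 0) \<psi>"
proof
  fix S
  have c: "cliff_basis a (cliff_basis b \<psi>) S = (phase a S * phase b (target a S)) * \<psi> (target b (target a S))"
      "cliff_basis b (cliff_basis a \<psi>) S = (phase b S * phase a (target b S)) * \<psi> (target b (target a S))"
    using assms
    by (simp_all add: cliff_basis_apply[of _ n] cliff_basis_spinors target_commute[of a b])
  show "cliff_basis a (cliff_basis b \<psi>) S
     = (- cliff_basis b (cliff_basis a \<psi>) - smul (if a = b then 2 else 0) \<psi>) S"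
  proof (cases "finite S")
    case True
    show ?thesis
    proof (cases "a = b")
      case True
      then show ?thesis using c(1) by (simp add: pointwise phase_square)
    next
      case False
      then show ?thesis using c assms True phase_anticommute[of S a b] by (auto simp: pointwise)
    qed
  next
    case False
    then show ?thesis using c spinors_infinite[OF assms(1)] by (simp add: pointwise)
  qed
qed

lemma hermitian_add_left: "hermitian n (\<psi> + \<phi>) \<theta> = hermitian n \<psi> \<theta> + hermitian n \<phi> \<theta>"
  by (simp add: pointwise hermitian_def algebra_simps sum.distrib)
lemma hermitian_add_right: "hermitian n \<theta> (\<psi> + \<phi>) = hermitian n \<theta> \<psi> + hermitian n \<theta> \<phi>"
  by (simp add: pointwise hermitian_def algebra_simps sum.distrib)
lemma hermitian_smul_left: "hermitian n (smul c \<psi>) \<theta> = c * hermitian n \<psi> \<theta>"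
  by (simp add: pointwise hermitian_def algebra_simps sum_distrib_left)
lemma hermitian_smul_right: "hermitian n \<theta> (smul c \<psi>) = cnj c * hermitian n \<theta> \<psi>"
  by (simp add: pointwise hermitian_def algebra_simps sum_distrib_left)
lemma hermitian_sum_left: "hermitian n (\<Sum>a\<in>A. f a) \<theta> = (\<Sum>a\<in>A. hermitian n (f a) \<theta>)"
proof -
  have "hermitian n 0 \<theta> = 0" "hermitian n \<theta> 0 = 0" by (simp_all add: pointwise hermitian_def)
  then show ?thesis
    by (induction A rule: infinite_finite_induct) (simp_all only: sum.infinite sum.empty sum.insert hermitian_add_left not_False_eq_True)
qed
lemma hermitian_sum_right: "hermitian n \<theta> (\<Sum>a\<in>A. f a) = (\<Sum>a\<in>A. hermitian n \<theta> (f a))"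
proof -
  have "hermitian n 0 \<theta> = 0" "hermitian n \<theta> 0 = 0" by (simp_all add: pointwise hermitian_def)
  then show ?thesis
    by (induction A rule: infinite_finite_induct) (simp_all only: sum.infinite sum.empty sum.insert hermitian_add_right not_False_eq_True)
qed

lemma hermitian_cnj: "cnj (hermitian n \<psi> \<phi>) = hermitian n \<phi> \<psi>"
  by (simp add: pointwise hermitian_def mult.commute)

lemma hermitian_self: "hermitian n \<psi> \<psi> = of_real (\<Sum>S\<in>Pow {1..2*n-1}. (cmod (\<psi> S))\<^sup>2)"
  by (simp add: pointwise hermitian_def complex_norm_square flip: of_real_power)

lemma hermitian_self_pos:
  assumes "\<psi> S \<noteq> 0" "S \<subseteq> {1..2*n-1}"
  shows "0 < Re (hermitian n \<psi> \<psi>)"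
proof -
  have "0 < (\<Sum>S\<in>Pow {1..2*n-1}. (cmod (\<psi> S))\<^sup>2)"
    using assms by (intro sum_pos2[of _ S]) auto
  then show ?thesis by (simp add: hermitian_self)
qed

lemma cliff_basis_skew:
  assumes "\<psi> \<in> spinors n" "\<phi> \<in> spinors n" "a \<in> {1..4*n-1}"
  shows "hermitian n (cliff_basis a \<psi>) \<phi> = - hermitian n \<psi> (cliff_basis a \<phi>)"
proof -
  have "hermitian n (cliff_basis a \<psi>) \<phi>
     = (\<Sum>S\<in>Pow {1..2*n-1}. phase a S * \<psi> (target a S) * cnj (\<phi> S))"
    using assms by (simp add: pointwise hermitian_def cliff_basis_apply)
  also have "\<dots> = (\<Sum>S\<in>Pow {1..2*n-1}. phase a (target a S) * \<psi> S * cnj (\<phi> (target a S)))"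
    using target_subset[of a n] assms(3)
    by (intro sum.reindex_bij_witness[of _ "target a" "target a"]) (simp_all only: Pow_iff target_target atLeastAtMost_iff)
  also have "\<dots> = (\<Sum>S\<in>Pow {1..2*n-1}. - (\<psi> S * cnj (phase a S * \<phi> (target a S))))"
  proof (intro sum.cong refl)
    fix S
    have "cnj (phase a S) = - phase a (target a S)"
      using phase_target_cnj[of a "target a S"] assms(3) by simp
    then show "phase a (target a S) * \<psi> S * cnj (\<phi> (target a S))
        = - (\<psi> S * cnj (phase a S * \<phi> (target a S)))"
      by (simp add: algebra_simps)
  qed
  also have "\<dots> = - hermitian n \<psi> (cliff_basis a \<phi>)"
    using assms by (simp add: pointwise hermitian_def cliff_basis_apply sum_negf)
  finally show ?thesis .
qed

section \<open>Charge conjugation\<close>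

definition conj_spinor :: "spinor \<Rightarrow> spinor" where
  "conj_spinor \<psi> = (\<lambda>S. cnj (\<psi> S))"

text \<open>
Conjugation of coefficients commutes with \<open>e\<^sub>3, e\<^sub>5, \<dots>\<close>, which are real operators, and anticommutes
with \<open>e\<^sub>1\<close> and \<open>e\<^sub>2, e\<^sub>4, \<dots>\<close>, which are imaginary.  The product of the \<open>2 n - 1\<close> real operators,
an odd number, has the same commutation rules; the composite therefore commutes with every \<open>e\<^sub>a\<close>.
\<close>

definition real_product :: "nat list \<Rightarrow> spinor \<Rightarrow> spinor" where
  "real_product js \<psi> = foldr (\<lambda>j. cliff_basis (2 * j + 1)) js \<psi>"

definition charge :: "nat \<Rightarrow> spinor \<Rightarrow> spinor" where
  "charge n \<psi> = real_product [1..<2*n] (conj_spinor \<psi>)"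

lemma conj_spinor_spinors: "\<psi> \<in> spinors n \<Longrightarrow> conj_spinor \<psi> \<in> spinors n"
  by (auto simp: spinors_def conj_spinor_def)

lemma conj_spinor_cliff_basis:
  assumes "\<psi> \<in> spinors n" "1 \<le> a"
  shows "conj_spinor (cliff_basis a \<psi>) =
    smul (if a = 1 \<or> even a then -1 else 1) (cliff_basis a (conj_spinor \<psi>))"
  using assms by (auto simp: pointwise fun_eq_iff conj_spinor_def cliff_basis_apply cliff_basis_apply[OF conj_spinor_spinors[unfolded conj_spinor_def]] cnj_phase)

lemma real_product_spinors:
  assumes "\<psi> \<in> spinors n" "set js \<subseteq> {1..2*n-1}"
  shows "real_product js \<psi> \<in> spinors n"
  using assms(2) by (induction js) (auto simp: real_product_def assms(1) intro!: cliff_basis_spinors)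

lemma real_product_smul: "real_product js (smul c \<psi>) = smul c (real_product js \<psi>)"
  by (induction js) (simp_all add: real_product_def cliff_basis_smul)

lemma real_product_add: "real_product js (\<psi> + \<phi>) = real_product js \<psi> + real_product js \<phi>"
  by (induction js) (simp_all add: real_product_def cliff_basis_add)

lemma real_product_cliff_basis:
  assumes "\<psi> \<in> spinors n" "set js \<subseteq> {1..2*n-1}" "distinct js" "a \<in> {1..4*n-1}"
  shows "real_product js (cliff_basis a \<psi>) =
     smul ((-1) ^ (length js + (if a \<noteq> 1 \<and> odd a \<and> a div 2 \<in> set js then 1 else 0)))
       (cliff_basis a (real_product js \<psi>))"
  using assms(2,3)
proof (induction js)
  case (Cons j js)
  let ?P = "real_product js \<psi>"
  let ?s = "\<lambda>js. (-1 :: complex) ^ (length js + (if a \<noteq> 1 \<and> odd a \<and> a div 2 \<in> set js then 1 else 0))"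
  have P: "?P \<in> spinors n" using Cons.prems assms(1) by (intro real_product_spinors) auto
  have j: "2 * j + 1 \<in> {1..4*n-1}" "1 \<le> j" using Cons.prems by auto
  have "real_product (j # js) (cliff_basis a \<psi>) = smul (?s js) (cliff_basis (2*j+1) (cliff_basis a ?P))"
    using Cons by (simp add: real_product_def cliff_basis_smul)
  also have "\<dots> = smul (?s (j # js)) (cliff_basis a (cliff_basis (2*j+1) ?P))"
  proof (cases "a = 2*j+1")
    case True
    then have "a \<noteq> 1" "odd a" "a div 2 = j" "j \<notin> set js" using Cons.prems j by auto
    then show ?thesis using True by simp
  next
    case False
    then have "(a \<noteq> 1 \<and> odd a \<and> a div 2 \<in> set js) \<longleftrightarrow> (a \<noteq> 1 \<and> odd a \<and> a div 2 \<in> set (j # js))"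
      using Cons.prems by auto
    then show ?thesis
      using cliff_basis_anticommute[OF P j(1) assms(4)] False by (simp add: pointwise fun_eq_iff)
  qed
  finally show ?case by (simp add: real_product_def)
qed (simp add: real_product_def fun_eq_iff)

lemma charge_cliff_basis:
  assumes "\<psi> \<in> spinors n" "1 \<le> n" "a \<in> {1..4*n-1}"
  shows "charge n (cliff_basis a \<psi>) = cliff_basis a (charge n \<psi>)"
proof -
  let ?js = "[1..<2*n]"
  have js: "set ?js \<subseteq> {1..2*n-1}" "distinct ?js" by auto
  have mem: "a div 2 \<in> set ?js" if "a \<noteq> 1" using that assms(3) by auto
  have len: "(-1 :: complex) ^ length ?js = -1" using assms(2) by simp
  have "charge n (cliff_basis a \<psi>) =
    smul ((if a = 1 \<or> even a then -1 else 1) *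
      (-1) ^ (length ?js + (if a \<noteq> 1 \<and> odd a \<and> a div 2 \<in> set ?js then 1 else 0)))
      (cliff_basis a (charge n \<psi>))"
    using real_product_cliff_basis[OF conj_spinor_spinors[OF assms(1)] js assms(3)] assms
    by (simp only: charge_def conj_spinor_cliff_basis real_product_smul smul_smul atLeastAtMost_iff)
  also have "\<dots> = smul 1 (cliff_basis a (charge n \<psi>))"
    using mem len by (cases "a = 1 \<or> even a") (auto simp del: length_upt set_upt)
  finally show ?thesis by simp
qed

lemma charge_spinors: "\<psi> \<in> spinors n \<Longrightarrow> charge n \<psi> \<in> spinors n"
  unfolding charge_def by (intro real_product_spinors conj_spinor_spinors) auto

lemma charge_smul: "charge n (smul c \<psi>) = smul (cnj c) (charge n \<psi>)"
proof -
  have "conj_spinor (smul c \<psi>) = smul (cnj c) (conj_spinor \<psi>)"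
    by (simp add: pointwise fun_eq_iff conj_spinor_def)
  then show ?thesis by (simp add: charge_def real_product_smul)
qed

lemma charge_add: "charge n (\<psi> + \<phi>) = charge n \<psi> + charge n \<phi>"
proof -
  have "conj_spinor (\<psi> + \<phi>) = conj_spinor \<psi> + conj_spinor \<phi>"
    by (simp add: pointwise fun_eq_iff conj_spinor_def)
  then show ?thesis by (simp add: charge_def real_product_add)
qed

lemma hermitian_cliff_basis:
  assumes "\<psi> \<in> spinors n" "\<phi> \<in> spinors n" "a \<in> {1..4*n-1}"
  shows "hermitian n (cliff_basis a \<psi>) (cliff_basis a \<phi>) = hermitian n \<psi> \<phi>"
proof -
  have "cliff_basis a (cliff_basis a \<phi>) = smul (-1) \<phi>"
    using cliff_basis_anticommute[OF assms(2,3,3)] by (auto simp: pointwise fun_eq_iff)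
  then show ?thesis
    using cliff_basis_skew[OF assms(1) cliff_basis_spinors[OF assms(2)] assms(3), of a] assms(3)
    by (simp add: hermitian_smul_right)
qed

lemma hermitian_charge:
  assumes "\<psi> \<in> spinors n"
  shows "hermitian n (charge n \<psi>) (charge n \<psi>) = hermitian n \<psi> \<psi>"
proof -
  have "hermitian n (real_product js \<phi>) (real_product js \<phi>) = hermitian n \<phi> \<phi>"
    if "set js \<subseteq> {1..2*n-1}" "\<phi> \<in> spinors n" for js \<phi>
    using that
  proof (induction js)
    case (Cons j js)
    have *: "real_product js \<phi> \<in> spinors n"
      using Cons.prems by (intro real_product_spinors) auto
    have "real_product (j # js) \<phi> = cliff_basis (2 * j + 1) (real_product js \<phi>)"
      by (simp add: real_product_def)
    then show ?case
      using Cons hermitian_cliff_basis[OF * *, of "2 * j + 1"] by auto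
  qed (simp add: real_product_def)
  then have "hermitian n (charge n \<psi>) (charge n \<psi>) = hermitian n (conj_spinor \<psi>) (conj_spinor \<psi>)"
    unfolding charge_def by (rule) (use conj_spinor_spinors[OF assms] in auto)
  also have "\<dots> = hermitian n \<psi> \<psi>"
    by (simp add: pointwise hermitian_def conj_spinor_def mult.commute)
  finally show ?thesis .
qed

section \<open>Spinors determined by their lowest coefficients\<close>

text \<open>
The equations of \<open>E\<^sub>2\<close> (for \<open>\<epsilon> = 1\<close>) and of \<open>E\<^sub>3\<close> (for \<open>\<epsilon> = -1\<close>), in terms of coefficients.
\<close>

definition pair_sector :: "nat \<Rightarrow> complex \<Rightarrow> spinor \<Rightarrow> bool" where
  "pair_sector n \<epsilon> \<psi> \<longleftrightarrow> \<psi> \<in> spinors n \<and>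
     (\<forall>p\<in>{1..n-1}. \<forall>R. 2*p \<notin> R \<longrightarrow> 2*p+1 \<notin> R \<longrightarrow>
        \<psi> (insert (2*p) R) = 0 \<and> \<psi> (insert (2*p+1) R) = 0 \<and>
        \<psi> (insert (2*p) (insert (2*p+1) R)) =
          (if 1 \<in> R then \<epsilon> * \<i> * \<psi> (R - {1}) else \<i> * \<psi> (insert 1 R)))"

text \<open>
The step of a descent: a non-zero coefficient at a set that is not contained in \<open>{1}\<close> comes from
one at a smaller set.
\<close>

lemma pair_sector_reduce:
  assumes "pair_sector n \<epsilon> \<psi>" "\<psi> S \<noteq> 0" "\<not> S \<subseteq> {1}"
  obtains p where "p \<in> {1..n-1}" "2*p \<in> S" "2*p+1 \<in> S" "\<psi> (toggle 1 (S - {2*p, 2*p+1})) \<noteq> 0"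
proof -
  have sub: "S \<subseteq> {1..2*n-1}"
    using assms spinors_eq_0 unfolding pair_sector_def by blast
  then obtain k where k: "k \<in> S" "k \<noteq> 1" "1 \<le> k" "k \<le> 2*n-1" using assms(3) by fastforce
  define p where "p = k div 2"
  define R where "R = S - {2*p, 2*p+1}"
  have p: "p \<in> {1..n-1}" and kp: "k = 2*p \<or> k = 2*p+1" using k by (auto simp: p_def)
  have R: "2*p \<notin> R" "2*p+1 \<notin> R" by (auto simp: R_def)
  note rel = assms(1)[unfolded pair_sector_def, THEN conjunct2, rule_format, OF p R]
  have both: "2*p \<in> S" "2*p+1 \<in> S"
  proof -
    have "S = insert (2*p) R" if "2*p+1 \<notin> S" using that kp k(1) by (auto simp: R_def)
    then show "2*p+1 \<in> S" using rel assms(2) by metis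
    have "S = insert (2*p+1) R" if "2*p \<notin> S" using that kp k(1) by (auto simp: R_def)
    then show "2*p \<in> S" using rel assms(2) by metis
  qed
  then have "S = insert (2*p) (insert (2*p+1) R)" by (auto simp: R_def)
  then have "\<psi> (toggle 1 R) \<noteq> 0" using rel assms(2) by (auto simp: toggle_def split: if_splits)
  then show ?thesis using that p both unfolding R_def by blast
qed

lemma card_toggle_pair:
  assumes "finite S" "1 \<le> p" "2*p \<in> S" "2*p+1 \<in> S"
  shows "card (toggle 1 (S - {2*p, 2*p+1})) < card S"
    "(-1) ^ card (toggle 1 (S - {2*p, 2*p+1})) = - ((-1 :: complex) ^ card S)"
proof -
  have c: "card S = Suc (Suc (card (S - {2*p, 2*p+1})))"
  proof -
    have sub: "{2*p, 2*p+1} \<subseteq> S" using assms by simp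
    have two: "card {2*p, 2*p+1} = 2" by simp
    have "2 \<le> card S" using card_mono[OF assms(1) sub] two by simp
    moreover have "card (S - {2*p, 2*p+1}) = card S - 2"
      using card_Diff_subset[OF _ sub] two by simp
    ultimately show ?thesis by linarith
  qed
  show "(-1) ^ card (toggle 1 (S - {2*p, 2*p+1})) = - ((-1 :: complex) ^ card S)"
    using assms(1) by (simp add: power_card_toggle c)
  have "card (toggle 1 (S - {2*p, 2*p+1})) \<le> Suc (card (S - {2*p, 2*p+1}))"
    using assms(1) by (auto simp: toggle_def card_insert_if intro: le_trans[OF card_Diff1_le])
  then show "card (toggle 1 (S - {2*p, 2*p+1})) < card S" using c by simp
qed

lemma pair_sector_eq_0:
  assumes "pair_sector n \<epsilon> \<psi>" "\<psi> {} = 0" "\<psi> {1} = 0"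
  shows "\<psi> = 0"
proof -
  have "\<psi> S = 0" if "finite S" for S
    using that
  proof (induction "card S" arbitrary: S rule: less_induct)
    case less
    show ?case
    proof (rule ccontr)
      assume nz: "\<psi> S \<noteq> 0"
      then have "\<not> S \<subseteq> {1}" using assms(2,3) by (auto simp: subset_singleton_iff)
      then obtain p where p: "p \<in> {1..n-1}" "2*p \<in> S" "2*p+1 \<in> S"
        and "\<psi> (toggle 1 (S - {2*p, 2*p+1})) \<noteq> 0"
        using pair_sector_reduce[OF assms(1) nz] by blast
      then show False
        using less.hyps[OF card_toggle_pair(1)[OF less.prems _ p(2,3)]] p(1) less.prems by simp
    qed
  qed
  moreover have "\<psi> S = 0" if "infinite S" for S
    using assms(1) that spinors_infinite unfolding pair_sector_def by blast
  ultimately show ?thesis by (auto simp: fun_eq_iff pointwise)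
qed

text \<open>
Each descent step changes the membership of \<open>1\<close> and the parity of the set.
\<close>

lemma pair_sector_parity:
  assumes "pair_sector n \<epsilon> \<psi>" "\<psi> S \<noteq> 0"
  shows "(-1) ^ card S = (if 1 \<in> S then -1 else 1 :: complex)"
proof -
  have "finite S" using assms spinors_infinite unfolding pair_sector_def by blast
  then show ?thesis using assms(2)
  proof (induction "card S" arbitrary: S rule: less_induct)
    case less
    show ?case
    proof (cases "S \<subseteq> {1}")
      case True
      then consider "S = {}" | "S = {1}" by blast
      then show ?thesis by cases auto
    next
      case False
      obtain p where p: "p \<in> {1..n-1}" "2*p \<in> S" "2*p+1 \<in> S"
        and nz: "\<psi> (toggle 1 (S - {2*p, 2*p+1})) \<noteq> 0"
        using pair_sector_reduce[OF assms(1) less.prems(2) False] by blast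
      have p1: "1 \<le> p" using p(1) by simp
      have "(-1) ^ card (toggle 1 (S - {2*p, 2*p+1})) =
          (if 1 \<in> toggle 1 (S - {2*p, 2*p+1}) then -1 else 1 :: complex)"
        using less.hyps[OF card_toggle_pair(1)[OF less.prems(1) p1 p(2,3)]] nz less.prems by simp
      moreover have "1 \<in> toggle 1 (S - {2*p, 2*p+1}) \<longleftrightarrow> 1 \<notin> S" using p1 by auto
      ultimately show ?thesis
        using card_toggle_pair(2)[OF less.prems(1) p1 p(2,3)] by (auto split: if_splits simp: minus_equation_iff)
    qed
  qed
qed

definition paired :: "nat \<Rightarrow> nat set \<Rightarrow> bool" where
  "paired n S \<longleftrightarrow> S \<subseteq> {1..2*n-1} \<and> (\<forall>p\<in>{1..n-1}. 2*p \<in> S \<longleftrightarrow> 2*p+1 \<in> S)"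

definition weight :: "nat \<Rightarrow> nat set \<Rightarrow> nat" where
  "weight n S = card {p\<in>{1..n-1}. 2*p \<in> S} + (if 1 \<in> S then 1 else 0)"

text \<open>
Coefficients that depend only on the weight.  The factor \<open>-\<i>\<close> is the one in front of \<open>y\<^sub>1\<close> in
\<open>\<psi>\<^sub>k = \<omega>\<^sup>k\<^sup>+\<^sup>1 - \<i> (k + 1) y\<^sub>1 \<and> \<omega>\<^sup>k\<close>; with it, the weight counts \<open>1\<close> like a pair.
\<close>

definition ladder :: "nat \<Rightarrow> (nat \<Rightarrow> complex) \<Rightarrow> spinor" where
  "ladder n F S = (if paired n S then (if 1 \<in> S then - \<i> else 1) * F (weight n S) else 0)"

lemma weight_insert_pair:
  assumes "p \<in> {1..n-1}" "2*p \<notin> R"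
  shows "weight n (insert (2*p) (insert (2*p+1) R)) = Suc (weight n R)"
proof -
  have "{q \<in> {1..n-1}. 2*q \<in> insert (2*p) (insert (2*p+1) R)} = insert p {q \<in> {1..n-1}. 2*q \<in> R}"
  proof -
    have "2*q \<in> insert (2*p) (insert (2*p+1) R) \<longleftrightarrow> q = p \<or> 2*q \<in> R" for q
    proof -
      have "2*q \<noteq> 2*p+1" by presburger
      then show ?thesis by auto
    qed
    then show ?thesis using assms(1) by blast
  qed
  then show ?thesis using assms by (auto simp: weight_def)
qed

lemma paired_insert_pair:
  assumes "p \<in> {1..n-1}" "2*p \<notin> R" "2*p+1 \<notin> R"
  shows "paired n (insert (2*p) (insert (2*p+1) R)) \<longleftrightarrow> paired n R"
proof -
  have "2*q \<noteq> 2*p+1" "2*q+1 \<noteq> 2*p" for q by presburger+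
  moreover have "2*p \<in> {1..2*n-1}" "2*p+1 \<in> {1..2*n-1}" using assms(1) by auto
  ultimately show ?thesis using assms by (auto simp: paired_def)
qed

lemma paired_toggle_1: "1 \<le> n \<Longrightarrow> paired n (toggle 1 S) \<longleftrightarrow> paired n S"
  by (auto simp: paired_def toggle_def)

lemma weight_remove_1: "1 \<in> S \<Longrightarrow> weight n S = Suc (weight n (S - {1}))"
  and weight_insert_1: "1 \<notin> S \<Longrightarrow> weight n (insert 1 S) = Suc (weight n S)"
  by (auto simp: weight_def intro!: arg_cong[where f = card])

lemma ladder_spinors: "ladder n F \<in> spinors n"
  by (auto simp: spinors_def ladder_def paired_def)

text \<open>
Adding a pair and toggling \<open>1\<close> changes the weight by \<open>0\<close> or \<open>2\<close>, hence a two-step recursion.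
\<close>

lemma ladder_pair_sector:
  assumes "1 \<le> n" "\<And>m. F (m + 2) = - \<epsilon> * F m"
  shows "pair_sector n \<epsilon> (ladder n F)"
  unfolding pair_sector_def
proof (intro conjI ballI allI impI)
  show "ladder n F \<in> spinors n" by (rule ladder_spinors)
  fix p R assume p: "p \<in> {1..n-1}" and R: "2*p \<notin> R" "2*p+1 \<notin> R"
  have "\<not> paired n (insert (2*p) R)" "\<not> paired n (insert (2*p+1) R)"
    using p R by (auto simp: paired_def)
  then show "ladder n F (insert (2*p) R) = 0" "ladder n F (insert (2*p+1) R) = 0"
    by (simp_all add: ladder_def)
  have 1: "1 \<in> insert (2*p) (insert (2*p+1) R) \<longleftrightarrow> 1 \<in> R" using p by auto
  show "ladder n F (insert (2*p) (insert (2*p+1) R)) =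
     (if 1 \<in> R then \<epsilon> * \<i> * ladder n F (R - {1}) else \<i> * ladder n F (insert 1 R))"
  proof (cases "1 \<in> R")
    case True
    have "F (Suc (Suc (weight n (R - {1})))) = - \<epsilon> * F (weight n (R - {1}))"
      using assms(2)[of "weight n (R - {1})"] by simp
    then show ?thesis
      using True paired_toggle_1[OF assms(1), of R] weight_remove_1[OF True, of n]
      unfolding ladder_def paired_insert_pair[OF p R] weight_insert_pair[OF p R(1)] 1
      by (simp add: toggle_def)
  next
    case False
    then show ?thesis
      using paired_toggle_1[OF assms(1), of R] weight_insert_1[OF False, of n]
      unfolding ladder_def paired_insert_pair[OF p R] weight_insert_pair[OF p R(1)] 1
      by (simp add: toggle_def)
  qed
qed

section \<open>The distinguished spinors\<close>

lemma omega_apply: "\<omega> n S = (\<Sum>p=1..n-1. if S = {2*p, 2*p+1} then 1 else 0)"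
  unfolding \<omega>_def
proof (rule sum.cong[OF refl])
  fix p
  show "wedge (ygen (2*p)) (ygen (2*p+1)) S = (if S = {2*p, 2*p+1} then 1 else 0)"
  proof (cases "S = {2*p, 2*p+1}")
    case True
    have "{k \<in> S. k < 2*p} = {}" using True by auto
    then have "count_sign (2*p) S = 1" by (simp only: count_sign_def card.empty power_0)
    moreover have "S - {2*p} = {2*p+1}" "finite S" "2*p \<in> S" using True by auto
    ultimately show ?thesis using True by (simp add: wedge_ygen ygen_def)
  next
    case False
    then have "\<not> (2*p \<in> S \<and> S - {2*p} = {2*p+1})" by auto
    then show ?thesis using False by (simp add: wedge_ygen ygen_def)
  qed
qed

text \<open>
A factor \<open>y\<^sub>2\<^sub>p \<and> y\<^sub>2\<^sub>p\<^sub>+\<^sub>1\<close> has even degree and adjacent indices, so it moves without signs.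
\<close>

lemma wedge_omega:
  assumes "finite S"
  shows "wedge (\<omega> n) \<phi> S =
     (\<Sum>p=1..n-1. if 2*p \<in> S \<and> 2*p+1 \<in> S then \<phi> (S - {2*p, 2*p+1}) else 0)"
proof -
  let ?s = "\<lambda>A. (-1 :: complex) ^ card {(a, b). a \<in> A \<and> b \<in> S - A \<and> b < a}"
  have s: "?s {2*p, 2*p+1} = 1" for p
  proof -
    have "{(a, b). a \<in> {2*p, 2*p+1} \<and> b \<in> S - {2*p, 2*p+1} \<and> b < a} = {2*p, 2*p+1} \<times> {b \<in> S. b < 2*p}"
      by auto
    then show ?thesis by (simp add: card_cartesian_product power_mult)
  qed
  have "wedge (\<omega> n) \<phi> S = (\<Sum>A\<in>Pow S. \<Sum>p=1..n-1. if A = {2*p, 2*p+1} then ?s A * \<phi> (S - A) else 0)"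
    unfolding wedge_def omega_apply
    by (intro sum.cong refl) (auto simp: sum_distrib_left sum_distrib_right intro!: sum.cong)
  also have "\<dots> = (\<Sum>p=1..n-1. \<Sum>A\<in>Pow S. if A = {2*p, 2*p+1} then ?s A * \<phi> (S - A) else 0)"
    by (rule sum.swap)
  also have "\<dots> = (\<Sum>p=1..n-1. if 2*p \<in> S \<and> 2*p+1 \<in> S then \<phi> (S - {2*p, 2*p+1}) else 0)"
  proof (rule sum.cong[OF refl])
    fix p
    have "(\<Sum>A\<in>Pow S. if A = {2*p, 2*p+1} then ?s A * \<phi> (S - A) else 0)
       = (if {2*p, 2*p+1} \<in> Pow S then ?s {2*p, 2*p+1} * \<phi> (S - {2*p, 2*p+1}) else 0)"
      using assms by (subst sum.delta) auto
    then show "(\<Sum>A\<in>Pow S. if A = {2*p, 2*p+1} then ?s A * \<phi> (S - A) else 0)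
       = (if 2*p \<in> S \<and> 2*p+1 \<in> S then \<phi> (S - {2*p, 2*p+1}) else 0)"
      unfolding s by simp
  qed
  finally show ?thesis .
qed

lemma paired_finite: "paired n S \<Longrightarrow> finite S"
  by (auto simp: paired_def dest: finite_subset)

lemma paired_weight_0: 
  assumes "1 \<le> n" shows "paired n S \<and> weight n S = 0 \<longleftrightarrow> S = {}"
proof
  assume S: "paired n S \<and> weight n S = 0"
  have no: "1 \<notin> S" "p \<in> {1..n-1} \<Longrightarrow> 2*p \<notin> S" for p
    using S by (auto simp: weight_def split: if_splits)
  show "S = {}"
  proof (rule ccontr)
    assume "S \<noteq> {}"
    then obtain k where k: "k \<in> S" by blast
    then have "k \<in> {1..2*n-1}" "k \<noteq> 1" using S no by (auto simp: paired_def)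
    then have "k div 2 \<in> {1..n-1}" "k = 2 * (k div 2) \<or> k = 2 * (k div 2) + 1" by auto
    then show False using S no k unfolding paired_def by metis
  qed
qed (auto simp: paired_def weight_def)

text \<open>
The pairs of \<open>S\<close> can be collected in any of \<open>k!\<close> orders.
\<close>

lemma wedge_power_omega:
  assumes "1 \<le> n"
  shows "wedge_power (\<omega> n) k S = (if paired n S \<and> 1 \<notin> S \<and> weight n S = k then fact k else 0)"
proof (induction k arbitrary: S)
  case 0
  then show ?case using paired_weight_0[OF assms, of S] by (auto simp: unit_form_def)
next
  case (Suc k)
  show ?case
  proof (cases "finite S")
    case False
    then show ?thesis using paired_finite[of n S] by (auto simp: wedge_def)
  next
    case True
    have "(if 2*p \<in> S \<and> 2*p+1 \<in> S then wedge_power (\<omega> n) k (S - {2*p, 2*p+1}) else 0)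
       = (if 2*p \<in> S \<and> paired n S \<and> 1 \<notin> S \<and> weight n S = Suc k then fact k else 0)"
      if p: "p \<in> {1..n-1}" for p
    proof (cases "2*p \<in> S \<and> 2*p+1 \<in> S")
      case True
      define R where "R = S - {2*p, 2*p+1}"
      have R: "2*p \<notin> R" "2*p+1 \<notin> R" and S: "S = insert (2*p) (insert (2*p+1) R)"
        using True by (auto simp: R_def)
      have 1: "1 \<in> S \<longleftrightarrow> 1 \<in> R" using p S by auto
      show ?thesis
        using True Suc paired_insert_pair[OF p R, folded S] weight_insert_pair[OF p R(1), folded S] 1
        by (simp only: R_def[symmetric]) auto
    next
      case False
      then show ?thesis using p by (auto simp: paired_def)
    qed
    then have "wedge_power (\<omega> n) (Suc k) S
       = (\<Sum>p=1..n-1. if 2*p \<in> S \<and> paired n S \<and> 1 \<notin> S \<and> weight n S = Suc k then fact k else 0)"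
      by (simp only: wedge_power.simps wedge_omega[OF True]) (rule sum.cong[OF refl], blast)
    also have "\<dots> = (if paired n S \<and> 1 \<notin> S \<and> weight n S = Suc k
        then of_nat (card {p \<in> {1..n-1}. 2*p \<in> S}) * fact k else 0)"
      by (auto simp flip: sum.inter_filter)
    also have "\<dots> = (if paired n S \<and> 1 \<notin> S \<and> weight n S = Suc k then fact (Suc k) else 0)"
      by (auto simp: weight_def simp del: of_nat_Suc)
    finally show ?thesis .
  qed
qed

text \<open>
For \<open>n = 1\<close> the spinor \<open>\<psi>\<^sub>0\<close> is \<open>y\<^sub>1\<close>, whereas the general formula would give \<open>-\<i> y\<^sub>1\<close>; this is the
reason for the exceptional factor \<open>\<i>\<close>.
\<close>

lemma psi_apply:
  assumes "1 \<le> n" "n = 1 \<longrightarrow> m \<le> 1"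
  shows "psi n (int m - 1) S =
     (if n = 1 \<and> m = 1 then \<i> else 1) * fact m * ladder n (\<lambda>w. if w = m then 1 else 0) S"
proof (cases "n = 1")
  case True
  then have m: "m = 0 \<or> m = 1" using assms(2) by auto
  have "paired 1 S \<longleftrightarrow> S = {} \<or> S = {1}" by (auto simp: paired_def)
  then show ?thesis using m True
    by (auto simp: psi_def ladder_def weight_def unit_form_def ygen_def)
next
  case False
  have 1: "psi n (int m - 1) S = wedge_power (\<omega> n) m S
      - \<i> * of_nat m * wedge (ygen 1) (\<omega>_power n (int m - 1)) S"
    using False by (simp add: psi_def \<omega>_power_def)
  show ?thesis
  proof (cases "1 \<in> S")
    case True
    have S: "paired n (S - {1}) \<longleftrightarrow> paired n S" 
      using paired_toggle_1[OF assms(1), of S] True by (simp add: toggle_def)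
    have c: "count_sign 1 S = 1" if "paired n S"
    proof -
      have "{k \<in> S. k < 1} = {}" using that by (auto simp: paired_def)
      then show ?thesis by (simp only: count_sign_def card.empty power_0)
    qed
    have "of_nat m * wedge (ygen 1) (\<omega>_power n (int m - 1)) S =
       (if paired n S \<and> weight n S = m then fact m else 0)"
    proof (cases m)
      case 0
      then show ?thesis using weight_remove_1[OF True, of n] by simp
    next
      case (Suc k)
      then show ?thesis
        using True S c weight_remove_1[OF True, of n] paired_finite[of n S]
        by (auto simp: \<omega>_power_def wedge_ygen wedge_power_omega[OF assms(1)])
    qed
    then show ?thesis using 1 True False
      by (simp add: wedge_power_omega[OF assms(1)] ladder_def mult.assoc)
  next
    case F: False
    then show ?thesis using 1 False
      by (simp add: wedge_ygen wedge_power_omega[OF assms(1)] ladder_def)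
  qed
qed

lemma weight_le:
  assumes "1 \<le> n"
  shows "weight n S \<le> n"
proof -
  have "card {p\<in>{1..n-1}. 2*p \<in> S} \<le> card {1..n-1}" by (rule card_mono) auto
  then show ?thesis using assms by (auto simp: weight_def)
qed

lemma paired_weight_max:
  assumes "1 \<le> n"
  shows "paired n S \<and> weight n S = n \<longleftrightarrow> S = {1..2*n-1}"
proof
  assume S: "paired n S \<and> weight n S = n"
  have le: "card {p\<in>{1..n-1}. 2*p \<in> S} \<le> card {1..n-1}" by (rule card_mono) auto
  then have "1 \<in> S" "card {p\<in>{1..n-1}. 2*p \<in> S} = card {1..n-1}"
    using S assms by (auto simp: weight_def split: if_splits)
  moreover have "{p\<in>{1..n-1}. 2*p \<in> S} \<subseteq> {1..n-1}" by auto
  ultimately have eq: "1 \<in> S" "{p\<in>{1..n-1}. 2*p \<in> S} = {1..n-1}"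
    using card_subset_eq[of "{1..n-1}" "{p\<in>{1..n-1}. 2*p \<in> S}"] by blast+
  have "k \<in> S" if "k \<in> {1..2*n-1}" for k
  proof (cases "k = 1")
    case False
    then have "k div 2 \<in> {1..n-1}" "k = 2 * (k div 2) \<or> k = 2 * (k div 2) + 1"
      using that by auto
    then show ?thesis using S eq(2) unfolding paired_def by (metis (mono_tags, lifting) mem_Collect_eq)
  qed (use eq in simp)
  then show "S = {1..2*n-1}" using S by (auto simp: paired_def)
next
  assume S: "S = {1..2*n-1}"
  then have "{p\<in>{1..n-1}. 2*p \<in> S} = {1..n-1}" by auto
  moreover have "1 \<in> S" using S assms by simp
  ultimately have "weight n S = card {1..n-1} + 1" by (simp only: weight_def if_True)
  moreover have "paired n S" using S by (auto simp: paired_def)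
  ultimately show "paired n S \<and> weight n S = n" using assms by simp
qed

text \<open>
At an index set of weight \<open>w\<close> only \<open>k = w div 2\<close> contributes, and the factorials cancel.  The
summation bound \<open>(n - r) div 2\<close> is large enough because the weight is at most \<open>n\<close>.
\<close>

lemma psi_sum:
  assumes "1 \<le> n" "r \<le> 1"
  shows "(\<Sum>k=0..(n-r) div 2. c k / fact (2*k+r) * psi n (int (2*k+r) - 1) S) =
     (if n = 1 \<and> r = 1 then \<i> else 1) *
       ladder n (\<lambda>w. if odd w = (r = 1) then c (w div 2) else 0) S"
proof -
  let ?u = "if 1 \<in> S then - \<i> else 1 :: complex" and ?w = "weight n S"
  let ?\<kappa> = "if n = 1 \<and> r = 1 then \<i> else 1 :: complex"
  have "(\<Sum>k=0..(n-r) div 2. c k / fact (2*k+r) * psi n (int (2*k+r) - 1) S)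
     = (\<Sum>k=0..(n-r) div 2. if k = ?w div 2 then
          (if paired n S \<and> odd ?w = (r = 1) then ?\<kappa> * ?u * c k else 0) else 0)"
  proof (rule sum.cong[OF refl])
    fix k assume k: "k \<in> {0..(n-r) div 2}"
    then have "n = 1 \<longrightarrow> k = 0" "n = 1 \<longrightarrow> 2*k+r \<le> 1" using assms by auto
    moreover have "?w = 2*k+r \<longleftrightarrow> k = ?w div 2 \<and> odd ?w = (r = 1)"
      using assms(2) by (cases "r = 0") (auto, presburger+)
    ultimately show "c k / fact (2*k+r) * psi n (int (2*k+r) - 1) S = (if k = ?w div 2 then
          (if paired n S \<and> odd ?w = (r = 1) then ?\<kappa> * ?u * c k else 0) else 0)"
      by (subst psi_apply[OF assms(1)]) (auto simp: ladder_def)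
  qed
  also have "\<dots> = (if paired n S \<and> odd ?w = (r = 1) then ?\<kappa> * ?u * c (?w div 2) else 0)"
  proof -
    have "?w div 2 \<in> {0..(n-r) div 2}" if "odd ?w = (r = 1)"
    proof -
      have "?w \<le> n" by (rule weight_le[OF assms(1)])
      then show ?thesis using that assms(2) by (cases "r = 0") (auto elim!: oddE)
    qed
    then show ?thesis by (subst sum.delta) auto
  qed
  finally show ?thesis by (simp add: ladder_def)
qed

lemma Psi_ladder:
  assumes "1 \<le> n" "i \<in> {2, 3}" "j \<in> {0, 1}"
  shows "Psi n i j = smul (if n = 1 \<and> j = 0 then \<i> else 1)
     (ladder n (\<lambda>w. if odd w = (j = 0) then (if i = 2 then -1 else 1) ^ (w div 2) else 0))"
proof
  fix S
  have j: "1 - j \<le> 1" "1 - j = 1 \<longleftrightarrow> j = 0" using assms(3) by auto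
  note sum = psi_sum[OF assms(1) j(1), of "\<lambda>k. (if i = 2 then -1 else 1) ^ k" S, unfolded j(2)]
  have "Psi n i j S = (\<Sum>k=0..(n-(1-j)) div 2. (if i = 2 then -1 else 1) ^ k / fact (2*k+(1-j)) * psi n (int (2*k+(1-j)) - 1) S)"
    using assms(2,3) by (auto simp: Psi_def)
  then show "Psi n i j S = smul (if n = 1 \<and> j = 0 then \<i> else 1)
     (ladder n (\<lambda>w. if odd w = (j = 0) then (if i = 2 then -1 else 1) ^ (w div 2) else 0)) S"
    unfolding sum smul_apply .
qed

lemma Psi_1_0: "Psi n 1 0 = unit_form"
  by (auto simp: Psi_def psi_def \<omega>_power_def fun_eq_iff)

lemma Psi_1_1:
  assumes "1 \<le> n"
  obtains c where "c \<noteq> 0" "Psi n 1 1 = (\<lambda>S. if S = {1..2*n-1} then c else 0)"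
proof
  let ?c = "\<i> / of_nat n * ((if n = 1 then \<i> else 1) * fact n * - \<i>)"
  show "?c \<noteq> 0" using assms by auto
  have "1 \<in> {1..2*n-1}" using assms by auto
  have "ladder n (\<lambda>w. if w = n then 1 else 0) S = (if S = {1..2*n-1} then - \<i> else 0)" for S
  proof (cases "S = {1..2*n-1}")
    case True
    then have "paired n S" "weight n S = n" using paired_weight_max[OF assms, of S] by blast+
    then show ?thesis using True \<open>1 \<in> {1..2*n-1}\<close> by (simp only: ladder_def if_True) simp
  next
    case False
    then have "\<not> (paired n S \<and> weight n S = n)" using paired_weight_max[OF assms, of S] by blast
    then show ?thesis using False by (simp only: ladder_def if_False) simp
  qed
  then have "psi n (int n - 1) S = (if n = 1 then \<i> else 1) * fact n * (if S = {1..2*n-1} then - \<i> else 0)" for S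
    using psi_apply[OF assms, of n S] by (simp only: conj_absorb) auto
  then show "Psi n 1 1 = (\<lambda>S. if S = {1..2*n-1} then ?c else 0)"
    by (intro ext) (simp add: Psi_def mult.assoc)
qed

section \<open>Clifford multiplication by tangent vectors\<close>

lemma sum_upper_triangle:
  fixes F :: "nat \<Rightarrow> nat \<Rightarrow> 'b::comm_monoid_add"
  assumes "\<And>a. a \<in> {1..N} \<Longrightarrow> F a a = 0"
  shows "(\<Sum>(a, b)\<in>{(a, b). 1 \<le> a \<and> a < b \<and> b \<le> N}. F a b + F b a) = (\<Sum>a\<in>{1..N}. \<Sum>b\<in>{1..N}. F a b)"
proof -
  let ?U = "{(a, b). 1 \<le> a \<and> a < b \<and> b \<le> N}"
  let ?L = "{(a, b). 1 \<le> b \<and> b < a \<and> a \<le> N}"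
  let ?D = "{(a, b). a = b \<and> 1 \<le> a \<and> a \<le> N}"
  have fin: "finite ?U" "finite ?L" "finite ?D"
    by (rule finite_subset[of _ "{1..N} \<times> {1..N}"]; auto)+
  have "(\<Sum>a\<in>{1..N}. \<Sum>b\<in>{1..N}. F a b) = (\<Sum>(a, b)\<in>{1..N} \<times> {1..N}. F a b)"
    by (rule sum.cartesian_product)
  also have "{1..N} \<times> {1..N} = (?U \<union> ?L) \<union> ?D" by auto
  also have "(\<Sum>(a, b)\<in>(?U \<union> ?L) \<union> ?D. F a b)
     = (\<Sum>(a, b)\<in>?U. F a b) + (\<Sum>(a, b)\<in>?L. F a b) + (\<Sum>(a, b)\<in>?D. F a b)"
    using fin by (subst sum.union_disjoint, auto)+
  also have "(\<Sum>(a, b)\<in>?D. F a b) = 0" by (rule sum.neutral) (use assms in auto)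
  also have "(\<Sum>(a, b)\<in>?L. F a b) = (\<Sum>(a, b)\<in>?U. F b a)"
    by (rule sum.reindex_bij_witness[of _ prod.swap prod.swap]) auto
  finally show ?thesis by (simp add: sum.distrib[symmetric] case_prod_unfold)
qed

locale clifford_frame =
  fixes Q :: "('n::finite) hspace" and n :: nat and e :: "nat \<Rightarrow> 'n mat"
  assumes n_pos: "1 \<le> n"
    and span_frame: "span (e ` {1..4*n-1}) = tng Q"
    and orthonormal: "\<And>a b. a \<in> {1..4*n-1} \<Longrightarrow> b \<in> {1..4*n-1} \<Longrightarrow>
      met Q (e a) (e b) = (if a = b then 1 else 0)"
    and met_bilinear: "bilinear_on (tng Q) (met Q)"
    and met_commute: "\<And>X Y. X \<in> tng Q \<Longrightarrow> Y \<in> tng Q \<Longrightarrow> met Q X Y = met Q Y X"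
begin

abbreviation "g \<equiv> met Q"
abbreviation "cl \<equiv> cliff Q n e"
abbreviation "I \<equiv> {1..4*n-1}"

lemma subspace_tng: "subspace (tng Q)"
  unfolding span_frame[symmetric] by (rule subspace_span)

lemma frame_mem: "a \<in> I \<Longrightarrow> e a \<in> tng Q"
  unfolding span_frame[symmetric] by (intro span_base imageI)

lemma tng_add: "X \<in> tng Q \<Longrightarrow> Y \<in> tng Q \<Longrightarrow> X + Y \<in> tng Q"
  and tng_scale: "X \<in> tng Q \<Longrightarrow> c *\<^sub>R X \<in> tng Q"
  and tng_zero: "0 \<in> tng Q"
  and tng_minus: "X \<in> tng Q \<Longrightarrow> - X \<in> tng Q"
  and tng_diff: "X \<in> tng Q \<Longrightarrow> Y \<in> tng Q \<Longrightarrow> X - Y \<in> tng Q"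
  and tng_sum: "(\<And>a. a \<in> A \<Longrightarrow> f a \<in> tng Q) \<Longrightarrow> sum f A \<in> tng Q"
  using subspace_tng
  by (auto intro: subspace_add subspace_scale subspace_0 subspace_neg subspace_diff subspace_sum)

lemmas tng_closed = frame_mem tng_add tng_scale tng_zero tng_minus tng_diff

lemma met_add_left: "X \<in> tng Q \<Longrightarrow> Y \<in> tng Q \<Longrightarrow> Z \<in> tng Q \<Longrightarrow> g (X + Y) Z = g X Z + g Y Z"
  using met_bilinear[unfolded bilinear_on_def, rule_format, of X Y Z 1 1] by simp

lemma met_scale_left: "X \<in> tng Q \<Longrightarrow> Z \<in> tng Q \<Longrightarrow> g (c *\<^sub>R X) Z = c * g X Z"
  using met_bilinear[unfolded bilinear_on_def, rule_format, of X X Z c 0] by simp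

lemma met_zero_left: "Z \<in> tng Q \<Longrightarrow> g 0 Z = 0"
  using met_scale_left[OF tng_zero, of Z 0] by simp

lemma met_minus_left: "X \<in> tng Q \<Longrightarrow> Z \<in> tng Q \<Longrightarrow> g (- X) Z = - g X Z"
  using met_scale_left[of X Z "-1"] by simp

lemma met_diff_left: "X \<in> tng Q \<Longrightarrow> Y \<in> tng Q \<Longrightarrow> Z \<in> tng Q \<Longrightarrow> g (X - Y) Z = g X Z - g Y Z"
  using met_add_left[of X "- Y" Z] by (simp add: met_minus_left tng_minus)

lemma met_sum_left:
  "finite A \<Longrightarrow> (\<And>a. a \<in> A \<Longrightarrow> f a \<in> tng Q) \<Longrightarrow> Z \<in> tng Q \<Longrightarrow> g (sum f A) Z = (\<Sum>a\<in>A. g (f a) Z)"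
  by (induction A rule: finite_induct) (auto simp: met_zero_left met_add_left tng_sum)

lemma frame_expansion:
  assumes "X \<in> tng Q"
  shows "(\<Sum>a\<in>I. g X (e a) *\<^sub>R e a) = X"
proof -
  have inj: "inj_on e I"
    by (rule inj_onI) (metis orthonormal zero_neq_one)
  obtain u where "X = (\<Sum>v\<in>e ` I. u v *\<^sub>R v)"
    using assms span_finite[of "e ` I"] unfolding span_frame by auto
  then have X: "X = (\<Sum>a\<in>I. u (e a) *\<^sub>R e a)"
    using sum.reindex[OF inj, of "\<lambda>v. u v *\<^sub>R v"] by (simp add: o_def)
  have "g X (e b) = u (e b)" if b: "b \<in> I" for b
  proof -
    have "g X (e b) = (\<Sum>a\<in>I. u (e a) * g (e a) (e b))"
      unfolding X using b by (subst met_sum_left) (auto intro!: sum.cong simp: tng_closed met_scale_left)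
    also have "\<dots> = (\<Sum>a\<in>I. if a = b then u (e a) else 0)"
      by (intro sum.cong refl) (simp add: orthonormal[OF _ b])
    also have "\<dots> = u (e b)" using b by (subst sum.delta) simp_all
    finally show ?thesis .
  qed
  then have "(\<Sum>a\<in>I. g X (e a) *\<^sub>R e a) = (\<Sum>a\<in>I. u (e a) *\<^sub>R e a)"
    by (intro sum.cong refl) metis
  then show ?thesis using X by simp
qed

lemma met_eqI:
  assumes "X \<in> tng Q" "Y \<in> tng Q" "\<And>Z. Z \<in> tng Q \<Longrightarrow> g X Z = g Y Z"
  shows "X = Y"
proof -
  have "(\<Sum>a\<in>I. g X (e a) *\<^sub>R e a) = (\<Sum>a\<in>I. g Y (e a) *\<^sub>R e a)"
    by (intro sum.cong refl) (use assms(3) frame_mem in simp)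
  then show ?thesis using assms by (simp only: frame_expansion)
qed

lemma parseval:
  assumes "X \<in> tng Q" "Y \<in> tng Q"
  shows "g X Y = (\<Sum>a\<in>I. g X (e a) * g Y (e a))"
proof -
  have "g X Y = g (\<Sum>a\<in>I. g X (e a) *\<^sub>R e a) Y"
    using assms by (simp only: frame_expansion)
  also have "\<dots> = (\<Sum>a\<in>I. g X (e a) * g Y (e a))"
    using assms by (subst met_sum_left)
      (auto intro!: sum.cong simp: tng_closed met_scale_left met_commute[of Y])
  finally show ?thesis .
qed

lemma cl_sum: "cl X \<psi> = (\<Sum>a\<in>I. smul (of_real (g X (e a))) (cliff_basis a \<psi>))"
  by (simp add: fun_eq_iff sum_spinor_apply cliff_def smul_apply)

lemma cl_frame:
  assumes "a \<in> I" shows "cl (e a) \<psi> = cliff_basis a \<psi>"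
proof
  fix S
  have "cl (e a) \<psi> S = (\<Sum>b\<in>I. if b = a then cliff_basis b \<psi> S else 0)"
    unfolding cliff_def by (intro sum.cong refl) (use orthonormal[OF assms] in auto)
  also have "\<dots> = cliff_basis a \<psi> S" using assms by (subst sum.delta) simp_all
  finally show "cl (e a) \<psi> S = cliff_basis a \<psi> S" .
qed

lemma spinors_add: "\<psi> \<in> spinors n \<Longrightarrow> \<phi> \<in> spinors n \<Longrightarrow> \<psi> + \<phi> \<in> spinors n"
  and spinors_smul: "\<psi> \<in> spinors n \<Longrightarrow> smul c \<psi> \<in> spinors n"
  and spinors_zero: "0 \<in> spinors n"
  and spinors_minus: "\<psi> \<in> spinors n \<Longrightarrow> - \<psi> \<in> spinors n"
  and spinors_diff: "\<psi> \<in> spinors n \<Longrightarrow> \<phi> \<in> spinors n \<Longrightarrow> \<psi> - \<phi> \<in> spinors n"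
  by (simp_all add: spinors_def pointwise)

lemma spinors_sum: "(\<And>a. a \<in> A \<Longrightarrow> f a \<in> spinors n) \<Longrightarrow> sum f A \<in> spinors n"
  by (induction A rule: infinite_finite_induct) (auto simp: spinors_zero spinors_add)

lemma cl_spinors: "\<psi> \<in> spinors n \<Longrightarrow> cl X \<psi> \<in> spinors n"
  unfolding cl_sum by (intro spinors_sum spinors_smul cliff_basis_spinors) auto

lemmas spinors_closed = spinors_add spinors_smul spinors_zero spinors_minus spinors_diff cl_spinors

lemma cl_add: "cl X (\<psi> + \<phi>) = cl X \<psi> + cl X \<phi>"
  by (simp add: fun_eq_iff cliff_def cliff_basis_add pointwise algebra_simps sum.distrib)

lemma cl_smul: "cl X (smul c \<psi>) = smul c (cl X \<psi>)"
  by (simp add: fun_eq_iff cliff_def cliff_basis_smul pointwise sum_distrib_left mult.left_commute)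

lemma minus_smul: "- \<psi> = smul (-1) \<psi>"
  by (simp add: fun_eq_iff pointwise)

lemma cl_minus: "cl X (- \<psi>) = - cl X \<psi>"
  by (simp only: minus_smul cl_smul)

lemma cl_diff: "cl X (\<psi> - \<phi>) = cl X \<psi> - cl X \<phi>"
  using cl_add[of X \<psi> "- \<phi>"] by (simp add: cl_minus)

lemma cl_zero: "cl X 0 = 0"
  using cl_diff[of X 0 0] by simp

lemma cl_sum_right: "cl X (sum f A) = (\<Sum>a\<in>A. cl X (f a))"
  by (induction A rule: infinite_finite_induct) (simp_all add: cl_zero cl_add)

lemmas cl_linear = cl_add cl_smul cl_minus cl_diff cl_zero

lemma smul_sum: "smul c (sum f A) = (\<Sum>a\<in>A. smul c (f a))"
  by (simp add: fun_eq_iff smul_apply sum_spinor_apply sum_distrib_left)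

lemma cl_vec_add: "X \<in> tng Q \<Longrightarrow> Y \<in> tng Q \<Longrightarrow> cl (X + Y) \<psi> = cl X \<psi> + cl Y \<psi>"
  unfolding cl_sum sum.distrib[symmetric]
  by (intro sum.cong refl) (simp only: met_add_left frame_mem, simp add: fun_eq_iff pointwise algebra_simps)

lemma cl_vec_scale: "X \<in> tng Q \<Longrightarrow> cl (c *\<^sub>R X) \<psi> = smul (of_real c) (cl X \<psi>)"
  unfolding cl_sum smul_sum
  by (intro sum.cong refl) (simp only: met_scale_left frame_mem, simp)

lemma cl_vec_minus: "X \<in> tng Q \<Longrightarrow> cl (- X) \<psi> = - cl X \<psi>"
  using cl_vec_scale[of X "-1" \<psi>] by (simp add: minus_smul)

lemma cl_vec_diff: "X \<in> tng Q \<Longrightarrow> Y \<in> tng Q \<Longrightarrow> cl (X - Y) \<psi> = cl X \<psi> - cl Y \<psi>"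
  using cl_vec_add[of X "- Y" \<psi>] by (simp add: cl_vec_minus tng_minus)

lemma cl_vec_zero: "cl 0 \<psi> = 0"
  using cl_vec_diff[OF tng_zero tng_zero, of \<psi>] by simp

lemmas cl_vec_linear = cl_vec_add cl_vec_scale cl_vec_minus cl_vec_diff cl_vec_zero

lemma cl_anticommute_frame:
  assumes "\<psi> \<in> spinors n" "Y \<in> tng Q" "a \<in> I"
  shows "cl (e a) (cl Y \<psi>) = - cl Y (cl (e a) \<psi>) - smul (of_real (2 * g Y (e a))) \<psi>"
proof
  fix S
  have "cl (e a) (cl Y \<psi>) S = (\<Sum>b\<in>I. of_real (g Y (e b)) * cl (e a) (cliff_basis b \<psi>) S)"
    by (subst cl_sum[of Y]) (simp add: cl_sum_right cl_smul sum_spinor_apply smul_apply)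
  also have "\<dots> = (\<Sum>b\<in>I. - (of_real (g Y (e b)) * cliff_basis b (cl (e a) \<psi>) S)
      - (if b = a then 2 * of_real (g Y (e b)) * \<psi> S else 0))"
    by (intro sum.cong refl)
      (auto simp: cl_frame[OF assms(3)] cliff_basis_anticommute[OF assms(1,3)] pointwise algebra_simps)
  also have "\<dots> = - cl Y (cl (e a) \<psi>) S - 2 * of_real (g Y (e a)) * \<psi> S"
    using assms(3) by (simp add: sum_subtractf sum_negf cliff_def)
  finally show "cl (e a) (cl Y \<psi>) S = (- cl Y (cl (e a) \<psi>) - smul (of_real (2 * g Y (e a))) \<psi>) S"
    by (simp add: pointwise)
qed

lemma cl_frame_sum: "cl X \<psi> = (\<Sum>a\<in>I. smul (of_real (g X (e a))) (cl (e a) \<psi>))"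
  unfolding cl_sum[of X] by (intro sum.cong refl) (simp add: cl_frame)

text \<open>
The Clifford relation \<open>X \<cdot> Y + Y \<cdot> X = - 2 g(X, Y)\<close>.
\<close>

lemma cl_anticommute:
  assumes "\<psi> \<in> spinors n" "X \<in> tng Q" "Y \<in> tng Q"
  shows "cl X (cl Y \<psi>) = - cl Y (cl X \<psi>) - smul (of_real (2 * g X Y)) \<psi>"
proof
  fix S
  have "cl X (cl Y \<psi>) S = (\<Sum>a\<in>I. of_real (g X (e a)) * cl (e a) (cl Y \<psi>) S)"
    by (subst cl_frame_sum[of X]) (simp add: sum_spinor_apply smul_apply)
  also have "\<dots> = (\<Sum>a\<in>I. - (of_real (g X (e a)) * cl Y (cl (e a) \<psi>) S)
      - 2 * of_real (g X (e a) * g Y (e a)) * \<psi> S)"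
    by (intro sum.cong refl) (simp add: cl_anticommute_frame[OF assms(1,3)] pointwise algebra_simps)
  also have "\<dots> = - (\<Sum>a\<in>I. of_real (g X (e a)) * cl Y (cl (e a) \<psi>) S)
      - 2 * of_real (\<Sum>a\<in>I. g X (e a) * g Y (e a)) * \<psi> S"
    by (simp add: sum_subtractf sum_negf sum_distrib_left sum_distrib_right)
  also have "(\<Sum>a\<in>I. of_real (g X (e a)) * cl Y (cl (e a) \<psi>) S) = cl Y (cl X \<psi>) S"
    by (subst (2) cl_frame_sum) (simp add: cl_sum_right cl_smul sum_spinor_apply smul_apply)
  finally show "cl X (cl Y \<psi>) S = (- cl Y (cl X \<psi>) - smul (of_real (2 * g X Y)) \<psi>) S"
    using parseval[OF assms(2,3)] by (simp add: pointwise)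
qed

lemma cl_skew:
  assumes "\<psi> \<in> spinors n" "\<phi> \<in> spinors n"
  shows "hermitian n (cl X \<psi>) \<phi> = - hermitian n \<psi> (cl X \<phi>)"
  unfolding cl_sum hermitian_sum_left hermitian_sum_right sum_negf[symmetric]
  by (intro sum.cong refl)
    (simp only: hermitian_smul_left hermitian_smul_right cliff_basis_skew[OF assms], simp)

lemma charge_zero: "charge n 0 = 0"
  using charge_add[of n 0 0] by simp

lemma charge_sum: "charge n (sum f A) = (\<Sum>a\<in>A. charge n (f a))"
  by (induction A rule: infinite_finite_induct) (simp_all add: charge_zero charge_add)

lemma cl_charge:
  assumes "\<psi> \<in> spinors n"
  shows "charge n (cl X \<psi>) = cl X (charge n \<psi>)"
  unfolding cl_sum charge_sum
  by (intro sum.cong refl) (simp only: charge_smul charge_cliff_basis[OF assms n_pos], simp)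

abbreviation "pairs \<equiv> {(a, b). 1 \<le> a \<and> a < b \<and> b \<le> 4*n-1}"

lemma spin_rep_sum: "spin_rep Q n e A \<psi> =
   (\<Sum>(a, b)\<in>pairs. smul (of_real (g (A (e a)) (e b) / 2)) (cl (e a) (cl (e b) \<psi>)))"
  by (rule ext) (simp add: spin_rep_def sum_spinor_apply case_prod_unfold smul_apply)

lemma spin_rep_spinors: "\<psi> \<in> spinors n \<Longrightarrow> spin_rep Q n e A \<psi> \<in> spinors n"
  unfolding spin_rep_sum by (intro spinors_sum) (auto intro!: spinors_closed)

lemma spin_rep_smul: "spin_rep Q n e A (smul c \<psi>) = smul c (spin_rep Q n e A \<psi>)"
  by (simp add: fun_eq_iff spin_rep_def case_prod_unfold cl_smul pointwise sum_distrib_left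
      mult.left_commute)

lemma spin_rep_charge:
  assumes "\<psi> \<in> spinors n"
  shows "charge n (spin_rep Q n e A \<psi>) = spin_rep Q n e A (charge n \<psi>)"
  unfolding spin_rep_sum charge_sum
  by (intro sum.cong refl) (auto simp: charge_smul cl_charge assms cl_spinors)

lemma spin_rep_skew:
  assumes "\<psi> \<in> spinors n" "\<phi> \<in> spinors n"
  shows "hermitian n (spin_rep Q n e A \<psi>) \<phi> = - hermitian n \<psi> (spin_rep Q n e A \<phi>)"
  unfolding spin_rep_sum hermitian_sum_left hermitian_sum_right sum_negf[symmetric]
proof (rule sum.cong[OF refl], clarify)
  fix a b assume "1 \<le> a" "a < b" "b \<le> 4*n-1"
  then have ab: "a \<in> I" "b \<in> I" "a \<noteq> b" by auto
  have "cl (e b) (cl (e a) \<phi>) = - cl (e a) (cl (e b) \<phi>)"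
    using cl_anticommute[OF assms(2) frame_mem[OF ab(2)] frame_mem[OF ab(1)]]
      orthonormal[OF ab(2,1)] ab(3) by (simp add: fun_eq_iff pointwise)
  then have "hermitian n (cl (e a) (cl (e b) \<psi>)) \<phi> = - hermitian n \<psi> (cl (e a) (cl (e b) \<phi>))"
    using assms by (simp add: cl_skew cl_spinors minus_smul hermitian_smul_right)
  then show "hermitian n (smul (of_real (g (A (e a)) (e b) / 2)) (cl (e a) (cl (e b) \<psi>))) \<phi>
     = - hermitian n \<psi> (smul (of_real (g (A (e a)) (e b) / 2)) (cl (e a) (cl (e b) \<phi>)))"
    by (simp add: hermitian_smul_left hermitian_smul_right)
qed

text \<open>
The defining property of the spin representation: its commutator with the Clifford product by a
vector is the Clifford product by the image of that vector.  Since \<open>A\<close> is skew, the sum over pairs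
\<open>a < b\<close> unfolds to the sum over all pairs.
\<close>

lemma spin_rep_cl:
  assumes "\<psi> \<in> spinors n" "Y \<in> tng Q"
    and A: "\<And>X. X \<in> tng Q \<Longrightarrow> A X \<in> tng Q"
    and skew: "\<And>X Z. X \<in> tng Q \<Longrightarrow> Z \<in> tng Q \<Longrightarrow> g (A X) Z = - g X (A Z)"
  shows "spin_rep Q n e A (cl Y \<psi>) = cl Y (spin_rep Q n e A \<psi>) + cl (A Y) \<psi>"
proof
  fix S
  define F where "F a b = of_real (g (A (e a)) (e b) * g Y (e a)) * cl (e b) \<psi> S" for a b
  have arith: "of_real (r / 2) * (c + of_real (2 * a) * x - of_real (2 * b) * y - c)
      = of_real (r * a) * x + of_real (- r * b) * y" for r a b and c x y :: complex
    by (simp add: left_diff_distrib distrib_left right_diff_distrib)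
  have A_skew: "g (A (e a)) (e b) = - g (A (e b)) (e a)" if "a \<in> I" "b \<in> I" for a b
    using skew[of "e a" "e b"] that met_commute[of "e a" "A (e b)"] by (simp add: frame_mem A)
  have "spin_rep Q n e A (cl Y \<psi>) S - cl Y (spin_rep Q n e A \<psi>) S
     = (\<Sum>(a, b)\<in>pairs. of_real (g (A (e a)) (e b) / 2) *
          (cl (e a) (cl (e b) (cl Y \<psi>)) S - cl Y (cl (e a) (cl (e b) \<psi>)) S))"
    by (simp add: spin_rep_sum cl_sum_right sum_spinor_apply smul_apply cl_smul
        case_prod_unfold right_diff_distrib sum_subtractf)
  also have "\<dots> = (\<Sum>(a, b)\<in>pairs. F a b + F b a)"
  proof (rule sum.cong[OF refl], clarify)
    fix a b assume "1 \<le> a" "a < b" "b \<le> 4*n-1"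
    then have ab: "a \<in> I" "b \<in> I" by auto
    have eq: "cl (e a) (cl (e b) (cl Y \<psi>)) = cl Y (cl (e a) (cl (e b) \<psi>))
        + smul (of_real (2 * g Y (e a))) (cl (e b) \<psi>) - smul (of_real (2 * g Y (e b))) (cl (e a) \<psi>)"
      using ab by (simp add: cl_anticommute_frame[OF assms(1,2)] cl_linear
          cl_anticommute_frame[OF cl_spinors[OF assms(1)] assms(2)])
    have *: "cl (e a) (cl (e b) (cl Y \<psi>)) S = cl Y (cl (e a) (cl (e b) \<psi>)) S
        + of_real (2 * g Y (e a)) * cl (e b) \<psi> S - of_real (2 * g Y (e b)) * cl (e a) \<psi> S"
      using fun_cong[OF eq, of S] unfolding pointwise .
    show "of_real (g (A (e a)) (e b) / 2) *
        (cl (e a) (cl (e b) (cl Y \<psi>)) S - cl Y (cl (e a) (cl (e b) \<psi>)) S) = F a b + F b a"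
      unfolding F_def A_skew[OF ab(2,1)] * by (rule arith)
  qed
  also have "\<dots> = (\<Sum>a\<in>I. \<Sum>b\<in>I. F a b)"
  proof (rule sum_upper_triangle)
    fix a assume "a \<in> I"
    then have "g (A (e a)) (e a) = 0" using A_skew[of a a] by simp
    then show "F a a = 0" by (simp add: F_def)
  qed
  also have "\<dots> = (\<Sum>b\<in>I. \<Sum>a\<in>I. F a b)" by (rule sum.swap)
  also have "\<dots> = cl (A Y) \<psi> S"
    unfolding cliff_def[of _ _ _ "A Y"]
  proof (rule sum.cong[OF refl])
    fix b assume b: "b \<in> I"
    have "g (A Y) (e b) = - g (A (e b)) Y"
      using skew[OF assms(2) frame_mem[OF b]] met_commute[OF assms(2) A[OF frame_mem[OF b]]] by simp
    also have "\<dots> = - (\<Sum>a\<in>I. g (A (e b)) (e a) * g Y (e a))"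
      using parseval[OF A[OF frame_mem[OF b]] assms(2)] by simp
    also have "\<dots> = (\<Sum>a\<in>I. g (A (e a)) (e b) * g Y (e a))"
      unfolding sum_negf[symmetric] by (intro sum.cong refl) (simp add: A_skew[OF _ b])
    finally show "(\<Sum>a\<in>I. F a b) = of_real (g (A Y) (e b)) * cliff_basis b \<psi> S"
      by (simp add: F_def cl_frame[OF b] sum_distrib_right)
  qed
  finally show "spin_rep Q n e A (cl Y \<psi>) S = (cl Y (spin_rep Q n e A \<psi>) + cl (A Y) \<psi>) S"
    by (simp add: pointwise algebra_simps)
qed

end

section \<open>The algebra of a 3-Sasakian structure\<close>

definition structure_end :: "('n::finite mat \<Rightarrow> 'n mat \<Rightarrow> 'n mat) \<Rightarrow> (nat \<Rightarrow> 'n mat) \<Rightarrow> nat \<Rightarrow> 'n mat \<Rightarrow> 'n mat" where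
  "structure_end \<Lambda> e i X = - \<Lambda> X (e i)"

text \<open>
Kept as a constant, so that membership in it remains a single premise for rewriting.
\<close>

definition reeb_idx :: "nat set" where
  "reeb_idx = {1, 2, 3}"

lemma cyclic_reeb_idx:
  "(i, j, k) \<in> {(1,2,3), (2,3,1), (3,1,2)} \<Longrightarrow> i \<in> reeb_idx \<and> j \<in> reeb_idx \<and> k \<in> reeb_idx \<and> i \<noteq> j"
  by (auto simp: reeb_idx_def)

text \<open>
The structure at the base point.  All tensors involved are invariant, so nothing is differentiated:
the Sasakian identity becomes a commutator with \<open>\<Lambda> X\<close>, and the Lie bracket of Reeb fields is
expressed through the torsion-free \<open>\<Lambda>\<close>.
\<close>

locale three_sasakian_frame = clifford_frame Q n e
  for Q :: "('n::finite) hspace" and n :: nat and e :: "nat \<Rightarrow> 'n mat" +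
  fixes \<Lambda> :: "'n mat \<Rightarrow> 'n mat \<Rightarrow> 'n mat"
  assumes connection_mem: "\<And>X Y. X \<in> tng Q \<Longrightarrow> Y \<in> tng Q \<Longrightarrow> \<Lambda> X Y \<in> tng Q"
    and connection_bilinear: "bilinear_on (tng Q) \<Lambda>"
    and connection_skew: "\<And>X Y Z. X \<in> tng Q \<Longrightarrow> Y \<in> tng Q \<Longrightarrow> Z \<in> tng Q \<Longrightarrow>
      met Q (\<Lambda> X Y) Z = - met Q Y (\<Lambda> X Z)"
    and reeb_killing: "\<And>i X Y. i \<in> reeb_idx \<Longrightarrow> X \<in> tng Q \<Longrightarrow> Y \<in> tng Q \<Longrightarrow>
      met Q (structure_end \<Lambda> e i X) Y = - met Q X (structure_end \<Lambda> e i Y)"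
    and reeb_sasakian: "\<And>i X Y. i \<in> reeb_idx \<Longrightarrow> X \<in> tng Q \<Longrightarrow> Y \<in> tng Q \<Longrightarrow>
      \<Lambda> X (structure_end \<Lambda> e i Y) - structure_end \<Lambda> e i (\<Lambda> X Y)
        = met Q X Y *\<^sub>R e i - met Q (e i) Y *\<^sub>R X"
    and reeb_bracket: "\<And>i j k. (i, j, k) \<in> {(1,2,3), (2,3,1), (3,1,2)} \<Longrightarrow>
      structure_end \<Lambda> e i (e j) - structure_end \<Lambda> e j (e i) = 2 *\<^sub>R e k"
    and frame_adapted: "\<And>i p. i \<in> reeb_idx \<Longrightarrow> p \<in> {1..n-1} \<Longrightarrow>
      e (4*p+i) = structure_end \<Lambda> e i (e (4*p))"
begin

abbreviation "\<phi> \<equiv> structure_end \<Lambda> e"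

lemma reeb_index: "i \<in> reeb_idx \<Longrightarrow> i \<in> I"
  using n_pos by (auto simp: reeb_idx_def)

lemma reeb_mem: "i \<in> reeb_idx \<Longrightarrow> e i \<in> tng Q"
  by (rule frame_mem[OF reeb_index])

lemma reeb_orthonormal: "i \<in> reeb_idx \<Longrightarrow> j \<in> reeb_idx \<Longrightarrow> g (e i) (e j) = (if i = j then 1 else 0)"
  by (rule orthonormal[OF reeb_index reeb_index])

lemma phi_mem: "i \<in> reeb_idx \<Longrightarrow> X \<in> tng Q \<Longrightarrow> \<phi> i X \<in> tng Q"
  unfolding structure_end_def by (intro tng_minus connection_mem reeb_mem)

lemma connection_add: "X \<in> tng Q \<Longrightarrow> Y \<in> tng Q \<Longrightarrow> Z \<in> tng Q \<Longrightarrow> \<Lambda> (X + Y) Z = \<Lambda> X Z + \<Lambda> Y Z"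
  using connection_bilinear[unfolded bilinear_on_def, rule_format, of X Y Z 1 1] by simp

lemma connection_scale: "X \<in> tng Q \<Longrightarrow> Z \<in> tng Q \<Longrightarrow> \<Lambda> (c *\<^sub>R X) Z = c *\<^sub>R \<Lambda> X Z"
  using connection_bilinear[unfolded bilinear_on_def, rule_format, of X X Z c 0] by simp

lemma connection_right_minus: "X \<in> tng Q \<Longrightarrow> Z \<in> tng Q \<Longrightarrow> \<Lambda> Z (- X) = - \<Lambda> Z X"
  using connection_bilinear[unfolded bilinear_on_def, rule_format, of X X Z "-1" 0] by simp

lemma connection_right_zero: "Z \<in> tng Q \<Longrightarrow> \<Lambda> Z 0 = 0"
  using connection_bilinear[unfolded bilinear_on_def, rule_format, of Z Z Z 0 0] by simp

lemma phi_add: "i \<in> reeb_idx \<Longrightarrow> X \<in> tng Q \<Longrightarrow> Y \<in> tng Q \<Longrightarrow> \<phi> i (X + Y) = \<phi> i X + \<phi> i Y"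
  using connection_add[OF _ _ reeb_mem] by (simp add: structure_end_def)

lemma phi_scale: "i \<in> reeb_idx \<Longrightarrow> X \<in> tng Q \<Longrightarrow> \<phi> i (c *\<^sub>R X) = c *\<^sub>R \<phi> i X"
  using connection_scale[OF _ reeb_mem] by (simp add: structure_end_def)

lemma phi_minus: "i \<in> reeb_idx \<Longrightarrow> X \<in> tng Q \<Longrightarrow> \<phi> i (- X) = - \<phi> i X"
  using phi_scale[of i X "-1"] by simp

lemma phi_reeb:
  assumes i: "i \<in> reeb_idx"
  shows "\<phi> i (e i) = 0"
proof (rule met_eqI)
  fix Z assume Z: "Z \<in> tng Q"
  have "g (\<Lambda> Z (e i)) (e i) = - g (e i) (\<Lambda> Z (e i))"
    by (intro connection_skew Z reeb_mem i)
  moreover have "g (e i) (\<Lambda> Z (e i)) = g (\<Lambda> Z (e i)) (e i)"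
    by (intro met_commute reeb_mem connection_mem Z i)
  ultimately have "g (\<phi> i Z) (e i) = 0"
    by (simp add: structure_end_def met_minus_left connection_mem reeb_mem Z i)
  then have "g Z (\<phi> i (e i)) = 0" using reeb_killing[OF i Z reeb_mem[OF i]] by simp
  then show "g (\<phi> i (e i)) Z = g 0 Z"
    using met_commute[OF phi_mem[OF i reeb_mem[OF i]] Z] by (simp add: met_zero_left Z)
qed (auto intro: tng_zero phi_mem reeb_mem i)

text \<open>
The Sasakian identity evaluated at \<open>Y = \<xi>\<^sub>i\<close>.
\<close>

lemma phi_phi:
  assumes i: "i \<in> reeb_idx" and X: "X \<in> tng Q"
  shows "\<phi> i (\<phi> i X) = - X + g (e i) X *\<^sub>R e i"
proof -
  have "\<Lambda> X (e i) = - \<phi> i X" by (simp add: structure_end_def)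
  then have "\<phi> i (\<Lambda> X (e i)) = - \<phi> i (\<phi> i X)" by (simp add: phi_minus phi_mem i X)
  then have "\<phi> i (\<phi> i X) = g X (e i) *\<^sub>R e i - X"
    using reeb_sasakian[OF i X reeb_mem[OF i]]
    by (simp only: phi_reeb[OF i] connection_right_zero[OF X] reeb_orthonormal[OF i i]) simp
  then show ?thesis using met_commute[OF X reeb_mem[OF i]] by simp
qed

lemma eta_phi:
  assumes i: "i \<in> reeb_idx" and X: "X \<in> tng Q"
  shows "g (e i) (\<phi> i X) = 0"
proof -
  have "g (e i) (\<phi> i X) = - g (\<phi> i (e i)) X"
    using reeb_killing[OF i reeb_mem[OF i] X] by simp
  then show ?thesis by (simp add: phi_reeb[OF i] met_zero_left X)
qed

text \<open>
Orthogonality of the Reeb fields makes \<open>\<phi>\<^sub>i \<xi>\<^sub>j\<close> antisymmetric in \<open>i, j\<close>, and the bracket relation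
then fixes its value.
\<close>

lemma phi_cross:
  assumes "(i, j, k) \<in> {(1,2,3), (2,3,1), (3,1,2)}"
  shows "\<phi> i (e j) = e k" "\<phi> j (e i) = - e k"
proof -
  have ij: "i \<in> reeb_idx" "j \<in> reeb_idx" "i \<noteq> j" using cyclic_reeb_idx[OF assms] by auto
  have "\<phi> i (e j) = - \<phi> j (e i)"
  proof (rule met_eqI)
    fix Z assume Z: "Z \<in> tng Q"
    have "g (\<Lambda> Z (e i)) (e j) = - g (e i) (\<Lambda> Z (e j))"
      by (intro connection_skew Z reeb_mem ij)
    then have "g (\<phi> i Z) (e j) = g (e i) (\<Lambda> Z (e j))"
      by (simp add: structure_end_def met_minus_left connection_mem reeb_mem Z ij)
    also have "\<dots> = g (\<Lambda> Z (e j)) (e i)"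
      by (intro met_commute reeb_mem connection_mem Z ij)
    also have "\<dots> = - g (\<phi> j Z) (e i)"
      by (simp add: structure_end_def met_minus_left connection_mem reeb_mem Z ij)
    finally have "g Z (\<phi> i (e j)) = - g Z (\<phi> j (e i))"
      using reeb_killing[OF ij(1) Z reeb_mem[OF ij(2)]] reeb_killing[OF ij(2) Z reeb_mem[OF ij(1)]] by simp
    then show "g (\<phi> i (e j)) Z = g (- \<phi> j (e i)) Z"
      using ij Z by (simp only: met_commute[of _ Z] phi_mem reeb_mem met_minus_left)
  qed (auto intro!: phi_mem reeb_mem tng_minus ij)
  then have "2 *\<^sub>R \<phi> i (e j) = 2 *\<^sub>R e k"
    using reeb_bracket[OF assms] by (simp add: scaleR_2)
  then show "\<phi> i (e j) = e k" by simp
  then show "\<phi> j (e i) = - e k" using \<open>\<phi> i (e j) = - \<phi> j (e i)\<close> by (metis minus_minus)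
qed

text \<open>
The Sasakian identities for \<open>\<phi>\<^sub>i\<close> at \<open>Y = \<xi>\<^sub>j\<close> and for \<open>\<phi>\<^sub>j\<close> at \<open>Y = \<xi>\<^sub>i\<close> contain the quaternion
relations.
\<close>

lemma phi_phi_cross:
  assumes c: "(i, j, k) \<in> {(1,2,3), (2,3,1), (3,1,2)}" and X: "X \<in> tng Q"
  shows "\<phi> i (\<phi> j X) = \<phi> k X + g (e j) X *\<^sub>R e i"
    "\<phi> j (\<phi> i X) = - \<phi> k X + g (e i) X *\<^sub>R e j"
proof -
  have ijk: "i \<in> reeb_idx" "j \<in> reeb_idx" "k \<in> reeb_idx" "i \<noteq> j" using cyclic_reeb_idx[OF c] by auto
  have L: "\<Lambda> X (e l) = - \<phi> l X" for l by (simp add: structure_end_def)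
  have "\<Lambda> X (\<phi> i (e j)) - \<phi> i (\<Lambda> X (e j)) = g X (e j) *\<^sub>R e i - g (e i) (e j) *\<^sub>R X"
    by (intro reeb_sasakian X ijk reeb_mem)
  then show "\<phi> i (\<phi> j X) = \<phi> k X + g (e j) X *\<^sub>R e i"
    using ijk by (simp only: phi_cross[OF c] L phi_minus[OF _ phi_mem[OF _ X]] reeb_orthonormal
        met_commute[OF X reeb_mem]) (simp add: algebra_simps)
  have "\<Lambda> X (\<phi> j (e i)) - \<phi> j (\<Lambda> X (e i)) = g X (e i) *\<^sub>R e j - g (e j) (e i) *\<^sub>R X"
    by (intro reeb_sasakian X ijk reeb_mem)
  then show "\<phi> j (\<phi> i X) = - \<phi> k X + g (e i) X *\<^sub>R e j"
    using ijk by (simp only: phi_cross[OF c] L phi_minus[OF _ phi_mem[OF _ X]] reeb_orthonormal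
        met_commute[OF X reeb_mem] connection_right_minus[OF reeb_mem X]) (simp add: algebra_simps)
qed

section \<open>Spinors adapted to one Sasakian structure\<close>

definition defect :: "nat \<Rightarrow> 'n mat \<Rightarrow> spinor \<Rightarrow> spinor" where
  "defect i Y \<psi> = cl (\<phi> i Y) \<psi> + cl Y (cl (e i) \<psi>) + smul (of_real (g (e i) Y)) \<psi>"

definition sasaki_spinors :: "nat \<Rightarrow> spinor set" where
  "sasaki_spinors i = {\<psi> \<in> spinors n. \<forall>Y\<in>tng Q. defect i Y \<psi> = 0}"

lemma sasaki_spinorsD: "\<psi> \<in> sasaki_spinors i \<Longrightarrow> \<psi> \<in> spinors n"
  and sasaki_defect: "\<psi> \<in> sasaki_spinors i \<Longrightarrow> Y \<in> tng Q \<Longrightarrow> defect i Y \<psi> = 0"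
  by (auto simp: sasaki_spinors_def)

lemma sasaki_phi:
  assumes "\<psi> \<in> sasaki_spinors i" "Y \<in> tng Q"
  shows "cl (\<phi> i Y) \<psi> = - cl Y (cl (e i) \<psi>) - smul (of_real (g (e i) Y)) \<psi>"
proof -
  have "cl (\<phi> i Y) \<psi> = defect i Y \<psi> - cl Y (cl (e i) \<psi>) - smul (of_real (g (e i) Y)) \<psi>"
    by (simp add: defect_def)
  then show ?thesis by (simp add: sasaki_defect[OF assms])
qed

lemma reeb_square:
  assumes i: "i \<in> reeb_idx" and "\<psi> \<in> spinors n"
  shows "cl (e i) (cl (e i) \<psi>) = - \<psi>"
proof
  fix S
  have "cl (e i) (cl (e i) \<psi>) S = - cl (e i) (cl (e i) \<psi>) S - 2 * \<psi> S"
    using fun_cong[OF cl_anticommute[OF assms(2) reeb_mem[OF i] reeb_mem[OF i]], of S] i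
    by (simp add: pointwise reeb_orthonormal)
  then show "cl (e i) (cl (e i) \<psi>) S = (- \<psi>) S" by (simp add: pointwise)
qed

text \<open>
The first equation makes \<open>E\<^sub>i\<close> stable under \<open>\<xi>\<^sub>i\<close>; the second shows that the condition at \<open>Y\<close>
implies the one at \<open>\<phi>\<^sub>i Y\<close>.
\<close>

lemma defect_reeb:
  assumes i: "i \<in> reeb_idx" and Y: "Y \<in> tng Q" and \<psi>: "\<psi> \<in> spinors n"
  shows "defect i Y (cl (e i) \<psi>) = - cl (e i) (defect i Y \<psi>)"
    and "defect i (\<phi> i Y) \<psi> = - cl (e i) (defect i Y \<psi>)"
proof -
  note [simp] = cl_linear reeb_square[OF i \<psi>] eta_phi[OF i Y] 
  have a: "cl (e i) (cl (\<phi> i Y) \<psi>) = - cl (\<phi> i Y) (cl (e i) \<psi>)"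
    using cl_anticommute[OF \<psi> reeb_mem[OF i] phi_mem[OF i Y]]
    by (simp add: fun_eq_iff pointwise)
  have b: "cl (e i) (cl Y (cl (e i) \<psi>)) = cl Y \<psi> - smul (of_real (2 * g (e i) Y)) (cl (e i) \<psi>)"
    using cl_anticommute[OF cl_spinors[OF \<psi>] reeb_mem[OF i] Y] by simp
  have r: "- cl (e i) (defect i Y \<psi>) =
      cl (\<phi> i Y) (cl (e i) \<psi>) - cl Y \<psi> + smul (of_real (g (e i) Y)) (cl (e i) \<psi>)"
    unfolding defect_def by (simp add: a b) (simp add: fun_eq_iff pointwise algebra_simps)
  show "defect i Y (cl (e i) \<psi>) = - cl (e i) (defect i Y \<psi>)"
    unfolding r unfolding defect_def by simp
  have "cl (\<phi> i (\<phi> i Y)) \<psi> = - cl Y \<psi> + smul (of_real (g (e i) Y)) (cl (e i) \<psi>)"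
    using i Y by (simp only: phi_phi cl_vec_linear tng_closed reeb_mem)
  then show "defect i (\<phi> i Y) \<psi> = - cl (e i) (defect i Y \<psi>)"
    unfolding r unfolding defect_def by (simp add: fun_eq_iff pointwise)
qed

lemma sasaki_reeb: "i \<in> reeb_idx \<Longrightarrow> \<psi> \<in> sasaki_spinors i \<Longrightarrow> cl (e i) \<psi> \<in> sasaki_spinors i"
  by (auto simp: sasaki_spinors_def cl_spinors defect_reeb cl_zero)

lemma defect_add: "defect i Y (\<psi> + \<phi>') = defect i Y \<psi> + defect i Y \<phi>'"
  by (simp add: defect_def cl_linear) (simp add: fun_eq_iff pointwise algebra_simps)

lemma defect_smul: "defect i Y (smul c \<psi>) = smul c (defect i Y \<psi>)"
  by (simp add: defect_def cl_linear) (simp add: fun_eq_iff pointwise algebra_simps)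

lemma sasaki_smul: "\<psi> \<in> sasaki_spinors i \<Longrightarrow> smul c \<psi> \<in> sasaki_spinors i"
  by (auto simp: sasaki_spinors_def spinors_smul defect_smul fun_eq_iff pointwise)

lemma sasaki_add: "\<psi> \<in> sasaki_spinors i \<Longrightarrow> \<phi>' \<in> sasaki_spinors i \<Longrightarrow> \<psi> + \<phi>' \<in> sasaki_spinors i"
  by (auto simp: sasaki_spinors_def spinors_add defect_add)

lemma sasaki_diff: "\<psi> \<in> sasaki_spinors i \<Longrightarrow> \<phi>' \<in> sasaki_spinors i \<Longrightarrow> \<psi> - \<phi>' \<in> sasaki_spinors i"
  using sasaki_add[of \<psi> i "smul (-1) \<phi>'"] sasaki_smul[of \<phi>' i "-1"] by (simp flip: minus_smul)

lemma sasaki_charge: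
  assumes "\<psi> \<in> sasaki_spinors i" shows "charge n \<psi> \<in> sasaki_spinors i"
proof -
  note \<psi> = sasaki_spinorsD[OF assms]
  have "defect i Y (charge n \<psi>) = charge n (defect i Y \<psi>)" if "Y \<in> tng Q" for Y
    by (simp add: defect_def charge_add charge_smul cl_charge \<psi> cl_spinors)
  then show ?thesis
    using assms by (auto simp: sasaki_spinors_def charge_spinors charge_zero)
qed

lemma defect_vec_add: 
  assumes "i \<in> reeb_idx" "Y \<in> tng Q" "Z \<in> tng Q"
  shows "defect i (Y + Z) \<psi> = defect i Y \<psi> + defect i Z \<psi>"
proof -
  have "g (e i) (Y + Z) = g (e i) Y + g (e i) Z"
    using assms by (simp only: met_commute[OF reeb_mem] tng_add met_add_left reeb_mem)
  then show ?thesis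
    using assms by (simp only: defect_def phi_add cl_vec_linear phi_mem)
     (simp add: fun_eq_iff pointwise algebra_simps)
qed

lemma defect_vec_scale: 
  assumes "i \<in> reeb_idx" "Y \<in> tng Q"
  shows "defect i (c *\<^sub>R Y) \<psi> = smul (of_real c) (defect i Y \<psi>)"
proof -
  have "g (e i) (c *\<^sub>R Y) = c * g (e i) Y"
    using assms by (simp only: met_commute[OF reeb_mem] tng_scale met_scale_left reeb_mem)
  then show ?thesis
    using assms by (simp only: defect_def phi_scale cl_vec_linear phi_mem)
     (simp add: fun_eq_iff pointwise algebra_simps)
qed

lemma sasaki_spinorsI:
  assumes i: "i \<in> reeb_idx" and \<psi>: "\<psi> \<in> spinors n"
    and frame: "\<And>a. a \<in> I \<Longrightarrow> defect i (e a) \<psi> = 0"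
  shows "\<psi> \<in> sasaki_spinors i"
proof -
  have "Y \<in> tng Q \<and> defect i Y \<psi> = 0" if "Y \<in> span (e ` I)" for Y
    using that
  proof (induction rule: span_induct_alt)
    case base
    show ?case using defect_vec_scale[OF i tng_zero, of 0 \<psi>] tng_zero
      by (simp add: fun_eq_iff pointwise)
  next
    case (step c x Y)
    then obtain a where a: "x = e a" "a \<in> I" by auto
    have Y: "Y \<in> tng Q" "defect i Y \<psi> = 0" using step by auto
    show ?case unfolding a(1)
      using defect_vec_add[OF i tng_scale[OF frame_mem[OF a(2)]] Y(1), of c \<psi>]
        defect_vec_scale[OF i frame_mem[OF a(2)], of c \<psi>] frame[OF a(2)] Y
        tng_add[OF tng_scale[OF frame_mem[OF a(2)]] Y(1), of c]
      by (simp add: fun_eq_iff pointwise)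
  qed
  then show ?thesis using \<psi> unfolding sasaki_spinors_def span_frame by blast
qed

section \<open>The Killing equation preserves adapted spinors\<close>

definition killing_defect :: "'n mat \<Rightarrow> spinor \<Rightarrow> spinor" where
  "killing_defect X \<psi> = spin_rep Q n e (\<Lambda> X) \<psi> - smul (1/2) (cl X \<psi>)"

lemma spin_connection_cl:
  assumes "\<psi> \<in> spinors n" "X \<in> tng Q" "Y \<in> tng Q"
  shows "spin_rep Q n e (\<Lambda> X) (cl Y \<psi>) = cl Y (spin_rep Q n e (\<Lambda> X) \<psi>) + cl (\<Lambda> X Y) \<psi>"
  using assms by (intro spin_rep_cl connection_mem connection_skew)

lemma killing_defect_spinors: "\<psi> \<in> spinors n \<Longrightarrow> killing_defect X \<psi> \<in> spinors n"
  unfolding killing_defect_def by (intro spinors_closed spin_rep_spinors)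

lemma killing_defect_smul: "killing_defect X (smul c \<psi>) = smul c (killing_defect X \<psi>)"
  by (simp add: killing_defect_def spin_rep_smul cl_smul) (simp add: fun_eq_iff pointwise algebra_simps)

lemma killing_defect_alt:
  "killing_defect X \<psi> = spin_rep Q n e (\<Lambda> X) \<psi> + smul (-1/2) (cl X \<psi>)"
  by (simp add: killing_defect_def fun_eq_iff pointwise)

lemma killing_defect_charge:
  "\<psi> \<in> spinors n \<Longrightarrow> charge n (killing_defect X \<psi>) = killing_defect X (charge n \<psi>)"
  by (simp add: killing_defect_alt charge_add spin_rep_charge cl_charge charge_smul)

lemma killing_defect_skew:
  assumes "\<psi> \<in> spinors n" "\<phi>' \<in> spinors n"
  shows "hermitian n (killing_defect X \<psi>) \<phi>' = - hermitian n \<psi> (killing_defect X \<phi>')"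
  by (simp add: killing_defect_alt hermitian_add_left hermitian_add_right hermitian_smul_left
      hermitian_smul_right spin_rep_skew[OF assms] cl_skew[OF assms])

text \<open>
On \<open>E\<^sub>i\<close> the term \<open>\<Lambda> X \<xi>\<^sub>i = - \<phi>\<^sub>i X\<close> that arises when \<open>\<xi>\<^sub>i\<close> is moved past the connection equals
the commutator of \<open>\<onehalf> X\<close> with \<open>\<xi>\<^sub>i\<close>.
\<close>

lemma killing_defect_reeb:
  assumes i: "i \<in> reeb_idx" and X: "X \<in> tng Q" and "\<psi> \<in> sasaki_spinors i"
  shows "killing_defect X (cl (e i) \<psi>) = cl (e i) (killing_defect X \<psi>)"
proof -
  note \<psi> = sasaki_spinorsD[OF assms(3)]
  have L: "\<Lambda> X (e i) = - \<phi> i X" by (simp add: structure_end_def)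
  have c: "cl (\<Lambda> X (e i)) \<psi> = cl X (cl (e i) \<psi>) + smul (of_real (g (e i) X)) \<psi>"
    unfolding L by (simp add: cl_vec_minus phi_mem i X sasaki_phi[OF assms(3) X])
  have a: "cl (e i) (cl X \<psi>) = - cl X (cl (e i) \<psi>) - smul (of_real (2 * g (e i) X)) \<psi>"
    by (rule cl_anticommute[OF \<psi> reeb_mem[OF i] X])
  show ?thesis
    unfolding killing_defect_def
    by (simp add: spin_connection_cl[OF \<psi> X reeb_mem[OF i]] cl_linear c a)
      (simp add: fun_eq_iff pointwise algebra_simps)
qed

text \<open>
The commutators of the defect with the connection term and with \<open>\<onehalf> X\<close> coincide on \<open>E\<^sub>i\<close>: the first
is computed from the Sasakian identity, the second from the Clifford relation, and in both the
terms \<open>\<phi>\<^sub>i X \<cdot> \<psi>\<close> and \<open>\<phi>\<^sub>i Y \<cdot> \<psi>\<close> are eliminated by means of the equations of \<open>E\<^sub>i\<close>.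
\<close>

lemma killing_defect_sasaki:
  assumes i: "i \<in> reeb_idx" and X: "X \<in> tng Q" and \<psi>E: "\<psi> \<in> sasaki_spinors i"
  shows "killing_defect X \<psi> \<in> sasaki_spinors i"
proof -
  note \<psi> = sasaki_spinorsD[OF \<psi>E]
  have "defect i Y (killing_defect X \<psi>) = 0" if Y: "Y \<in> tng Q" for Y
  proof -
    let ?T = "spin_rep Q n e (\<Lambda> X)" and ?\<xi> = "e i"
    note \<xi> = reeb_mem[OF i] and \<phi>Y = phi_mem[OF i Y] and \<phi>X = phi_mem[OF i X]
    note \<xi>\<psi> = cl_spinors[OF \<psi>, of ?\<xi>]
    have L: "\<Lambda> X ?\<xi> = - \<phi> i X" by (simp add: structure_end_def)
    have \<Lambda>\<phi>: "\<Lambda> X (\<phi> i Y) = \<phi> i (\<Lambda> X Y) + g X Y *\<^sub>R ?\<xi> + (- g ?\<xi> Y) *\<^sub>R X"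
      using reeb_sasakian[OF i X Y] by (simp add: algebra_simps)
    have \<eta>\<Lambda>: "g ?\<xi> (\<Lambda> X Y) = g (\<phi> i X) Y"
      using connection_skew[OF X \<xi> Y] by (simp add: L met_minus_left \<phi>X Y)
    \<comment> \<open>commutator of the connection term with the defect\<close>
    have T1: "?T (cl (\<phi> i Y) \<psi>) = cl (\<phi> i Y) (?T \<psi>) + cl (\<phi> i (\<Lambda> X Y)) \<psi>
        + smul (of_real (g X Y)) (cl ?\<xi> \<psi>) - smul (of_real (g ?\<xi> Y)) (cl X \<psi>)"
      unfolding spin_connection_cl[OF \<psi> X \<phi>Y] \<Lambda>\<phi>
      using i X Y \<xi> by (simp only: cl_vec_linear tng_closed phi_mem connection_mem)
        (simp add: fun_eq_iff pointwise)
    have T2: "?T (cl Y (cl ?\<xi> \<psi>)) = cl Y (cl ?\<xi> (?T \<psi>)) - cl Y (cl (\<phi> i X) \<psi>) + cl (\<Lambda> X Y) (cl ?\<xi> \<psi>)"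
      by (simp add: spin_connection_cl[OF \<xi>\<psi> X Y] spin_connection_cl[OF \<psi> X \<xi>] L cl_linear
          cl_vec_minus[OF \<phi>X])
    have "?T (defect i Y \<psi>) = ?T 0" using sasaki_defect[OF \<psi>E Y] by simp
    have T0: "?T 0 = 0" using spin_rep_smul[of "\<Lambda> X" 0 0] by (simp add: smul_def zero_fun_def)
    have Tadd: "?T (\<alpha> + \<beta>) = ?T \<alpha> + ?T \<beta>" for \<alpha> \<beta>
      by (simp add: fun_eq_iff spin_rep_def cl_linear pointwise algebra_simps sum.distrib case_prod_unfold)
    have "?T (defect i Y \<psi>) = defect i Y (?T \<psi>) + defect i (\<Lambda> X Y) \<psi>
        + smul (of_real (g X Y)) (cl ?\<xi> \<psi>) - smul (of_real (g ?\<xi> Y)) (cl X \<psi>)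
        - cl Y (cl (\<phi> i X) \<psi>) - smul (of_real (g (\<phi> i X) Y)) \<psi>"
      unfolding defect_def Tadd T1 T2 spin_rep_smul \<eta>\<Lambda> by (simp add: fun_eq_iff pointwise algebra_simps)
    then have DT: "defect i Y (?T \<psi>) = smul (of_real (g ?\<xi> Y)) (cl X \<psi>) + cl Y (cl (\<phi> i X) \<psi>)
        + smul (of_real (g (\<phi> i X) Y)) \<psi> - smul (of_real (g X Y)) (cl ?\<xi> \<psi>)"
      by (simp add: sasaki_defect[OF \<psi>E] Y connection_mem X T0 fun_eq_iff pointwise algebra_simps)
    have c1: "cl Y (cl (\<phi> i X) \<psi>) = - cl Y (cl X (cl ?\<xi> \<psi>)) - smul (of_real (g ?\<xi> X)) (cl Y \<psi>)"
      by (simp add: sasaki_phi[OF \<psi>E X] cl_linear)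
    have c2: "cl (\<phi> i Y) (cl X \<psi>) = cl X (cl Y (cl ?\<xi> \<psi>)) + smul (of_real (g ?\<xi> Y)) (cl X \<psi>)
        + smul (of_real (2 * g (\<phi> i X) Y)) \<psi>"
    proof -
      have "g (\<phi> i Y) X = - g (\<phi> i X) Y"
        using reeb_killing[OF i Y X] met_commute[OF Y \<phi>X] by simp
      then have "cl (\<phi> i Y) (cl X \<psi>) = - cl X (cl (\<phi> i Y) \<psi>) + smul (of_real (2 * g (\<phi> i X) Y)) \<psi>"
        using cl_anticommute[OF \<psi> \<phi>Y X] by (simp add: fun_eq_iff pointwise)
      then show ?thesis
        by (simp add: sasaki_phi[OF \<psi>E Y] cl_linear fun_eq_iff pointwise)
    qed
    have c3: "cl X (cl Y (cl ?\<xi> \<psi>)) = - cl Y (cl X (cl ?\<xi> \<psi>)) - smul (of_real (2 * g X Y)) (cl ?\<xi> \<psi>)"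
      by (rule cl_anticommute[OF \<xi>\<psi> X Y])
    have c4: "cl Y (cl ?\<xi> (cl X \<psi>)) = - cl Y (cl X (cl ?\<xi> \<psi>)) - smul (of_real (2 * g ?\<xi> X)) (cl Y \<psi>)"
      by (simp add: cl_anticommute[OF \<psi> \<xi> X] cl_linear)
    have DX: "defect i Y (cl X \<psi>) = smul 2 (defect i Y (?T \<psi>))"
      unfolding DT unfolding defect_def c1 c2 c3 c4
      by (simp add: fun_eq_iff pointwise algebra_simps)
    show ?thesis
      by (simp only: killing_defect_alt defect_add defect_smul DX) (simp add: fun_eq_iff pointwise)
  qed
  then show ?thesis using killing_defect_spinors[OF \<psi>] by (simp add: sasaki_spinors_def)
qed

end

section \<open>The equations of adapted spinors on coefficients\<close>

lemma imaginary_mult: "\<i> * a * (\<i> * b * c) = - (a * b * c :: complex)"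
proof -
  have "\<i> * a * (\<i> * b * c) = (\<i> * \<i>) * (a * b * c)" by (simp only: ac_simps)
  then show ?thesis by simp
qed

text \<open>
The equation for \<open>j\<close> at \<open>toggle j S\<close> says that a non-zero coefficient at \<open>S\<close> forces \<open>S\<close> to have odd
size if it contains \<open>j\<close> and even size if not.  For all \<open>j\<close> together, \<open>S\<close> contains all indices or
none.
\<close>

lemma extremal_support_iff:
  assumes \<psi>: "\<psi> \<in> spinors n" and n: "1 \<le> n"
  shows "(\<forall>j\<in>{1..2*n-1}. cliff_basis (2*j+1) \<psi> + cliff_basis (2*j) (cliff_basis 1 \<psi>) = 0) \<longleftrightarrow>
    (\<forall>S. S \<noteq> {} \<longrightarrow> S \<noteq> {1..2*n-1} \<longrightarrow> \<psi> S = 0)"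
proof -
  have val: "(cliff_basis (2*j+1) \<psi> + cliff_basis (2*j) (cliff_basis 1 \<psi>)) S =
     count_sign j S * \<psi> (toggle j S) * ((if j \<in> S then 1 else -1) - (-1) ^ card (toggle j S))"
    if j: "1 \<le> j" for j S
  proof -
    have 1: "cliff_basis 1 \<psi> \<in> spinors n" using n by (intro cliff_basis_spinors[OF \<psi>]) auto
    have "2*j+1 \<noteq> 1" "2*j \<noteq> 1" using j by auto
    then show ?thesis using j
      by (simp add: pointwise cliff_basis_apply[OF \<psi>] cliff_basis_apply[OF 1] phase_def target_def
          algebra_simps del: One_nat_def)
  qed
  show ?thesis
  proof (intro iffI allI impI ballI)
    fix S
    assume L: "\<forall>j\<in>{1..2*n-1}. cliff_basis (2*j+1) \<psi> + cliff_basis (2*j) (cliff_basis 1 \<psi>) = 0"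
      and S: "S \<noteq> {}" "S \<noteq> {1..2*n-1}"
    show "\<psi> S = 0"
    proof (rule ccontr)
      assume nz: "\<psi> S \<noteq> 0"
      then have sub: "S \<subseteq> {1..2*n-1}" using spinors_eq_0[OF \<psi>] by blast
      have *: "(if j \<in> S then -1 else 1) = (-1 :: complex) ^ card S" if j: "j \<in> {1..2*n-1}" for j
      proof -
        have "(cliff_basis (2*j+1) \<psi> + cliff_basis (2*j) (cliff_basis 1 \<psi>)) (toggle j S) = 0"
          using L j by (simp add: zero_fun_def)
        moreover have "count_sign j (toggle j S) \<noteq> 0" by (simp add: count_sign_def)
        ultimately show ?thesis using nz j by (subst (asm) val) (auto split: if_splits)
      qed
      obtain j k where "j \<in> S" "k \<in> {1..2*n-1}" "k \<notin> S" using S sub by blast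
      then have "(-1 :: complex) = 1" using *[of j] *[of k] sub by auto
      then show False by simp
    qed
  next
    fix j
    assume R: "\<forall>S. S \<noteq> {} \<longrightarrow> S \<noteq> {1..2*n-1} \<longrightarrow> \<psi> S = 0" and j: "j \<in> {1..2*n-1}"
    have odd: "odd (2*n-1)" using n by auto
    show "cliff_basis (2*j+1) \<psi> + cliff_basis (2*j) (cliff_basis 1 \<psi>) = 0"
    proof
      fix S
      have j1: "1 \<le> j" using j by simp
      consider "toggle j S = {}" | "toggle j S = {1..2*n-1}" | "\<psi> (toggle j S) = 0" using R by blast
      then have "\<psi> (toggle j S) * ((if j \<in> S then 1 else -1) - (-1) ^ card (toggle j S)) = 0"
      proof cases
        case 1
        then have "j \<in> S" using mem_toggle[of j j S] by auto
        then show ?thesis using 1 by simp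
      next
        case 2
        then have "j \<notin> S" using mem_toggle[of j j S] j by auto
        then show ?thesis using 2 odd by simp
      qed simp
      then show "(cliff_basis (2*j+1) \<psi> + cliff_basis (2*j) (cliff_basis 1 \<psi>)) S = 0 S"
        unfolding val[OF j1] by (simp add: zero_fun_def)
    qed
  qed
qed

lemma spinors_contains_0:
  assumes "\<psi> \<in> spinors n" "0 \<in> T"
  shows "\<psi> T = 0"
proof (rule spinors_eq_0[OF assms(1)])
  have "0 \<notin> {1..2*n-1}" by simp
  then show "\<not> T \<subseteq> {1..2*n-1}" using assms(2) by blast
qed

text \<open>
The recursion in the form in which the Clifford equations deliver it: one relation, for each pair
and each index set \<open>S\<close>, between the coefficients at \<open>S\<close> with \<open>2p+1\<close> toggled and at \<open>S\<close> with \<open>2p\<close>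
and \<open>1\<close> toggled.  Sets with the element \<open>0\<close> carry no coefficients.
\<close>

lemma pair_sector_local:
  assumes \<epsilon>: "\<epsilon> * \<epsilon> = 1" and \<psi>: "\<psi> \<in> spinors n"
  shows "pair_sector n \<epsilon> \<psi> \<longleftrightarrow>
    (\<forall>p\<in>{1..n-1}. \<forall>S. 0 \<notin> S \<longrightarrow>
      (if 2*p \<in> S \<longleftrightarrow> 2*p+1 \<in> S
       then \<psi> (toggle (2*p+1) S) = 0 \<and> \<psi> (toggle 1 (toggle (2*p) S)) = 0
       else \<psi> (toggle 1 (toggle (2*p) S)) =
         \<i> * (if 2*p \<in> S then - (if 1 \<in> S then \<epsilon> else 1) else if 1 \<in> S then 1 else \<epsilon>)
           * \<psi> (toggle (2*p+1) S)))"
    (is "_ \<longleftrightarrow> (\<forall>p\<in>_. \<forall>S. _ \<longrightarrow> ?local p S)")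
proof -
  have e2: "\<epsilon> * \<epsilon> * x = x" for x using \<epsilon> by simp
  let ?pair = "\<lambda>p R. insert (2*p) (insert (2*p+1) R)"
  have def: "pair_sector n \<epsilon> \<psi> \<longleftrightarrow> (\<forall>p\<in>{1..n-1}. \<forall>R. 2*p \<notin> R \<longrightarrow> 2*p+1 \<notin> R \<longrightarrow>
        \<psi> (insert (2*p) R) = 0 \<and> \<psi> (insert (2*p+1) R) = 0 \<and>
        \<psi> (?pair p R) = \<i> * (if 1 \<in> R then \<epsilon> else 1) * \<psi> (toggle 1 R))"
    unfolding pair_sector_def using \<psi> by (auto simp: toggle_def mult.commute)
  show ?thesis
  proof
    assume "pair_sector n \<epsilon> \<psi>"
    note rel = this[unfolded def, rule_format]
    show "\<forall>p\<in>{1..n-1}. \<forall>S. 0 \<notin> S \<longrightarrow> ?local p S"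
    proof (intro ballI allI impI)
      fix p S assume p: "p \<in> {1..n-1}"
      define R where "R = S - {2*p, 2*p+1}"
      have R: "2*p \<notin> R" "2*p+1 \<notin> R" by (auto simp: R_def)
      have R': "2*p \<notin> toggle 1 R" "2*p+1 \<notin> toggle 1 R" using R p by auto
      have 1: "1 \<in> R \<longleftrightarrow> 1 \<in> S" using p by (auto simp: R_def)
      note r = rel[OF p R] and r' = rel[OF p R', simplified toggle_toggle]
      consider "2*p \<in> S" "2*p+1 \<in> S" | "2*p \<in> S" "2*p+1 \<notin> S" | "2*p \<notin> S" "2*p+1 \<in> S"
        | "2*p \<notin> S" "2*p+1 \<notin> S" by blast
      then show "?local p S"
      proof cases
        case 1
        then have "toggle (2*p+1) S = insert (2*p) R"
          "toggle 1 (toggle (2*p) S) = insert (2*p+1) (toggle 1 R)"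
          using p by (auto simp: R_def toggle_def)
        then show ?thesis using 1 r r' by simp
      next
        case 2
        then have "toggle (2*p+1) S = ?pair p R" "toggle 1 (toggle (2*p) S) = toggle 1 R"
          using p by (auto simp: R_def toggle_def)
        then show ?thesis using 2 r 1 e2 by (simp add: imaginary_mult del: One_nat_def)
      next
        case 3
        then have "toggle (2*p+1) S = R" "toggle 1 (toggle (2*p) S) = ?pair p (toggle 1 R)"
          using p by (auto simp: R_def toggle_def)
        then show ?thesis using 3 r' 1 by (simp del: One_nat_def)
      next
        case 4
        then have "toggle (2*p+1) S = insert (2*p+1) R"
          "toggle 1 (toggle (2*p) S) = insert (2*p) (toggle 1 R)"
          using p by (auto simp: R_def toggle_def)
        then show ?thesis using 4 r r' by simp
      qed
    qed
  next
    assume L: "\<forall>p\<in>{1..n-1}. \<forall>S. 0 \<notin> S \<longrightarrow> ?local p S"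
    show "pair_sector n \<epsilon> \<psi>" unfolding def
    proof (intro ballI allI impI)
      fix p R assume p: "p \<in> {1..n-1}" and R: "2*p \<notin> R" "2*p+1 \<notin> R"
      show "\<psi> (insert (2*p) R) = 0 \<and> \<psi> (insert (2*p+1) R) = 0 \<and>
        \<psi> (?pair p R) = \<i> * (if 1 \<in> R then \<epsilon> else 1) * \<psi> (toggle 1 R)"
      proof (cases "0 \<in> R")
        case True
        then show ?thesis by (simp add: spinors_contains_0[OF \<psi>])
      next
        case False
        have ne: "2*p \<noteq> 1" "2*p+1 \<noteq> 1" "2*p \<noteq> 0" using p by auto
        have z: "0 \<notin> toggle 1 R" "0 \<notin> insert (2*p) R" using False ne by auto
        have "toggle (2*p+1) R = insert (2*p+1) R" using R by (simp add: toggle_def)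
        then have 1: "\<psi> (insert (2*p+1) R) = 0"
          using L[rule_format, OF p False] R by simp
        have "toggle 1 (toggle (2*p) (toggle 1 R)) = insert (2*p) R"
          using R ne by (auto simp: toggle_def)
        then have 2: "\<psi> (insert (2*p) R) = 0"
          using L[rule_format, OF p z(1)] R ne by (simp del: One_nat_def)
        have "toggle (2*p+1) (insert (2*p) R) = ?pair p R"
          "toggle 1 (toggle (2*p) (insert (2*p) R)) = toggle 1 R"
          using R ne by (auto simp: toggle_def)
        then have "\<psi> (toggle 1 R) = - (\<i> * (if 1 \<in> R then \<epsilon> else 1) * \<psi> (?pair p R))"
          using L[rule_format, OF p z(2)] R ne by (simp del: One_nat_def)
        then have "\<i> * (if 1 \<in> R then \<epsilon> else 1) * \<psi> (toggle 1 R) = \<psi> (?pair p R)"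
          using e2 by (simp add: imaginary_mult del: One_nat_def)
        then show ?thesis using 1 2 by simp
      qed
    qed
  qed
qed

lemma count_sign_1: "0 \<notin> S \<Longrightarrow> count_sign (Suc 0) S = 1"
proof -
  assume "0 \<notin> S"
  then have "{k \<in> S. k < Suc 0} = {}" by auto
  then show ?thesis by (simp only: count_sign_def card.empty power_0)
qed

lemma count_sign_Suc: "count_sign (Suc j) S = count_sign j S * (if j \<in> S then -1 else 1)"
proof (cases "j \<in> S")
  case True
  then have "{k \<in> S. k < Suc j} = insert j {k \<in> S. k < j}" by auto
  then have "card {k \<in> S. k < Suc j} = Suc (card {k \<in> S. k < j})" by simp
  then show ?thesis using True by (simp only: count_sign_def if_True) simp
next
  case False
  then have "{k \<in> S. k < Suc j} = {k \<in> S. k < j}" by (auto simp: less_Suc_eq)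
  then show ?thesis using False by (simp only: count_sign_def if_False) simp
qed

lemma count_sign_cases: "count_sign j S = 1 \<or> count_sign j S = -1"
  using count_sign_square[of j S] square_eq_1_iff by blast

text \<open>
The two Clifford equations at one index set, as linear equations for the two coefficients \<open>A\<close> and
\<open>B\<close> involved; \<open>x\<close>, \<open>y\<close>, \<open>z\<close> stand for the membership of \<open>2p\<close>, \<open>2p+1\<close> and \<open>1\<close>, and \<open>c\<close> for a sign.
\<close>

lemma sector_2_arith:
  fixes A B c :: complex
  assumes "c = 1 \<or> c = -1"
  shows "\<i> * (c * (if x then -1 else 1)) * A - c * 1 * B = 0 \<and>
      - ((if y then 1 else -1) * (c * (if x then -1 else 1)) * A) + (if x then 1 else -1) * \<i> * c * 1 * B = 0
    \<longleftrightarrow> (if x \<longleftrightarrow> y then A = 0 \<and> B = 0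
         else B = \<i> * (if x then - (if z then 1 else 1) else if z then 1 else 1) * A)"
  using assms by (cases x; cases y) (auto simp: complex_eq_iff)

lemma sector_3_arith:
  fixes A B c :: complex
  assumes "c = 1 \<or> c = -1"
  shows "(if y then 1 else -1) * (c * (if x then -1 else 1)) * A + \<i> * (if z then 1 else -1) * c * 1 * B = 0 \<and>
      \<i> * (c * (if x then -1 else 1)) * A + (if x then 1 else -1) * (if z then 1 else -1) * c * 1 * B = 0
    \<longleftrightarrow> (if x \<longleftrightarrow> y then A = 0 \<and> B = 0
         else B = \<i> * (if x then - (if z then -1 else 1) else if z then 1 else -1) * A)"
  using assms by (cases x; cases y; cases z) (auto simp: complex_eq_iff)

lemma quadruple_index:
  assumes "1 \<le> p"
  shows "(4*p+2) div 2 = Suc (2*p)" "(4*p+3) div 2 = Suc (2*p)" "4*p div 2 = 2*p" "(4*p+1) div 2 = 2*p"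
    "4*p+1 \<noteq> 1" "4*p \<noteq> 1" "even (4*p+2)" "odd (4*p+3)" "odd (4*p+1)" "even (4*p)" "4*p+3 \<noteq> 1" "4*p+2 \<noteq> 1"
    "1 \<le> 4*p" "1 \<le> 4*p+1" "1 \<le> 4*p+2" "1 \<le> 4*p+3" "\<not> 2*p < Suc 0"
  using assms by (auto; presburger)+

lemma sector_2_local:
  assumes \<psi>: "\<psi> \<in> spinors n" and p: "p \<in> {1..n-1}"
  shows "(cliff_basis (4*p+2) \<psi> + cliff_basis (4*p) (cliff_basis 2 \<psi>) = 0 \<and>
      - cliff_basis (4*p+3) \<psi> + cliff_basis (4*p+1) (cliff_basis 2 \<psi>) = 0) \<longleftrightarrow>
    (\<forall>S. 0 \<notin> S \<longrightarrow>
      (if 2*p \<in> S \<longleftrightarrow> 2*p+1 \<in> S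
       then \<psi> (toggle (2*p+1) S) = 0 \<and> \<psi> (toggle 1 (toggle (2*p) S)) = 0
       else \<psi> (toggle 1 (toggle (2*p) S)) =
         \<i> * (if 2*p \<in> S then - (if 1 \<in> S then 1 else 1) else if 1 \<in> S then 1 else 1)
           * \<psi> (toggle (2*p+1) S)))"
    (is "?l1 = 0 \<and> ?l2 = 0 \<longleftrightarrow> (\<forall>S. _ \<longrightarrow> ?r S)")
proof -
  have 2: "cliff_basis 2 \<psi> \<in> spinors n" using p by (intro cliff_basis_spinors[OF \<psi>]) auto
  have "1 \<le> p" using p by simp
  note d = quadruple_index[OF this]
  have v1: "?l1 S = \<i> * count_sign (Suc (2*p)) S * \<psi> (toggle (Suc (2*p)) S)
      - count_sign (2*p) S * count_sign (Suc 0) S * \<psi> (toggle (Suc 0) (toggle (2*p) S))" for S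
    using p by (simp add: pointwise cliff_basis_apply[OF \<psi>] cliff_basis_apply[OF 2] phase_def target_def d
        count_sign_toggle imaginary_mult)
  have v2: "?l2 S = - ((if Suc (2*p) \<in> S then 1 else -1) * count_sign (Suc (2*p)) S * \<psi> (toggle (Suc (2*p)) S))
      + (if 2*p \<in> S then 1 else -1) * \<i> * count_sign (2*p) S * count_sign (Suc 0) S * \<psi> (toggle (Suc 0) (toggle (2*p) S))" for S
    using p by (simp add: pointwise cliff_basis_apply[OF \<psi>] cliff_basis_apply[OF 2] phase_def target_def d
        count_sign_toggle imaginary_mult)
  have loc: "?l1 S = 0 \<and> ?l2 S = 0 \<longleftrightarrow> ?r S" if "0 \<notin> S" for S
  proof -
    define A where "A = \<psi> (toggle (Suc (2*p)) S)"
    define B where "B = \<psi> (toggle (Suc 0) (toggle (2*p) S))"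
    have r: "?r S \<longleftrightarrow> (if (2*p \<in> S) = (Suc (2*p) \<in> S) then A = 0 \<and> B = 0
        else B = \<i> * (if 2*p \<in> S then - (if Suc 0 \<in> S then 1 else 1)
          else if Suc 0 \<in> S then 1 else 1) * A)"
      unfolding A_def B_def by simp
    show ?thesis
      unfolding r unfolding v1 v2 count_sign_1[OF that] A_def[symmetric] B_def[symmetric]
      unfolding count_sign_Suc by (rule sector_2_arith[OF count_sign_cases])
  qed
  have zero: "?l1 S = 0 \<and> ?l2 S = 0" if "0 \<in> S" for S
  proof -
    have "\<psi> (toggle (Suc (2*p)) S) = 0" "\<psi> (toggle (Suc 0) (toggle (2*p) S)) = 0"
      using that p by (auto intro!: spinors_contains_0[OF \<psi>])
    then show ?thesis unfolding v1 v2 by simp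
  qed
  have "?l1 = 0 \<and> ?l2 = 0 \<longleftrightarrow> (\<forall>S. ?l1 S = 0 \<and> ?l2 S = 0)"
    by (auto simp: fun_eq_iff zero_fun_def)
  then show ?thesis using loc zero by blast
qed

lemma sector_3_local:
  assumes \<psi>: "\<psi> \<in> spinors n" and p: "p \<in> {1..n-1}"
  shows "(cliff_basis (4*p+3) \<psi> + cliff_basis (4*p) (cliff_basis 3 \<psi>) = 0 \<and>
      cliff_basis (4*p+2) \<psi> + cliff_basis (4*p+1) (cliff_basis 3 \<psi>) = 0) \<longleftrightarrow>
    (\<forall>S. 0 \<notin> S \<longrightarrow>
      (if 2*p \<in> S \<longleftrightarrow> 2*p+1 \<in> S
       then \<psi> (toggle (2*p+1) S) = 0 \<and> \<psi> (toggle 1 (toggle (2*p) S)) = 0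
       else \<psi> (toggle 1 (toggle (2*p) S)) =
         \<i> * (if 2*p \<in> S then - (if 1 \<in> S then -1 else 1) else if 1 \<in> S then 1 else -1)
           * \<psi> (toggle (2*p+1) S)))"
    (is "?l1 = 0 \<and> ?l2 = 0 \<longleftrightarrow> (\<forall>S. _ \<longrightarrow> ?r S)")
proof -
  have 3: "cliff_basis 3 \<psi> \<in> spinors n" using p by (intro cliff_basis_spinors[OF \<psi>]) auto
  have "1 \<le> p" using p by simp
  note d = quadruple_index[OF this]
  let ?w = "\<lambda>S. if Suc 0 \<in> S then 1 else -1 :: complex"
  have v1: "?l1 S = (if Suc (2*p) \<in> S then 1 else -1) * count_sign (Suc (2*p)) S * \<psi> (toggle (Suc (2*p)) S)
      + \<i> * ?w S * count_sign (2*p) S * count_sign (Suc 0) S * \<psi> (toggle (Suc 0) (toggle (2*p) S))" for S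
    using p by (simp add: pointwise cliff_basis_apply[OF \<psi>] cliff_basis_apply[OF 3] phase_def target_def d
        count_sign_toggle imaginary_mult)
  have v2: "?l2 S = \<i> * count_sign (Suc (2*p)) S * \<psi> (toggle (Suc (2*p)) S)
      + (if 2*p \<in> S then 1 else -1) * ?w S * count_sign (2*p) S * count_sign (Suc 0) S * \<psi> (toggle (Suc 0) (toggle (2*p) S))" for S
    using p by (simp add: pointwise cliff_basis_apply[OF \<psi>] cliff_basis_apply[OF 3] phase_def target_def d
        count_sign_toggle imaginary_mult)
  have loc: "?l1 S = 0 \<and> ?l2 S = 0 \<longleftrightarrow> ?r S" if "0 \<notin> S" for S
  proof -
    define A where "A = \<psi> (toggle (Suc (2*p)) S)"
    define B where "B = \<psi> (toggle (Suc 0) (toggle (2*p) S))"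
    have r: "?r S \<longleftrightarrow> (if (2*p \<in> S) = (Suc (2*p) \<in> S) then A = 0 \<and> B = 0
        else B = \<i> * (if 2*p \<in> S then - (if Suc 0 \<in> S then -1 else 1)
          else if Suc 0 \<in> S then 1 else -1) * A)"
      unfolding A_def B_def by simp
    show ?thesis
      unfolding r unfolding v1 v2 count_sign_1[OF that] A_def[symmetric] B_def[symmetric]
      unfolding count_sign_Suc by (rule sector_3_arith[OF count_sign_cases])
  qed
  have zero: "?l1 S = 0 \<and> ?l2 S = 0" if "0 \<in> S" for S
  proof -
    have "\<psi> (toggle (Suc (2*p)) S) = 0" "\<psi> (toggle (Suc 0) (toggle (2*p) S)) = 0"
      using that p by (auto intro!: spinors_contains_0[OF \<psi>])
    then show ?thesis unfolding v1 v2 by simp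
  qed
  have "?l1 = 0 \<and> ?l2 = 0 \<longleftrightarrow> (\<forall>S. ?l1 S = 0 \<and> ?l2 S = 0)"
    by (auto simp: fun_eq_iff zero_fun_def)
  then show ?thesis using loc zero by blast
qed

text \<open>
The remaining equation, for the direction of a Reeb field, is the parity rule.
\<close>

lemma pair_sector_vertical:
  assumes "1 \<le> n"
  shows "pair_sector n 1 \<psi> \<Longrightarrow> cliff_basis 1 \<psi> + cliff_basis 3 (cliff_basis 2 \<psi>) = 0"
    and "pair_sector n (-1) \<psi> \<Longrightarrow> cliff_basis 2 \<psi> + cliff_basis 1 (cliff_basis 3 \<psi>) = 0"
proof -
  assume s: "pair_sector n 1 \<psi>"
  then have \<psi>: "\<psi> \<in> spinors n" by (simp add: pair_sector_def)
  have 2: "cliff_basis 2 \<psi> \<in> spinors n" using assms by (intro cliff_basis_spinors[OF \<psi>]) auto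
  show "cliff_basis 1 \<psi> + cliff_basis 3 (cliff_basis 2 \<psi>) = 0"
  proof
    fix S
    have "(cliff_basis 1 \<psi> + cliff_basis 3 (cliff_basis 2 \<psi>)) S
       = \<i> * \<psi> S * ((-1) ^ card S + (if 1 \<in> S then 1 else -1))"
      by (simp add: pointwise cliff_basis_apply[OF \<psi>] cliff_basis_apply[OF 2] phase_def target_def
          count_sign_toggle algebra_simps)
    also have "\<dots> = 0" using pair_sector_parity[OF s, of S] by (cases "\<psi> S = 0") auto
    finally show "(cliff_basis 1 \<psi> + cliff_basis 3 (cliff_basis 2 \<psi>)) S = 0 S"
      by (simp add: zero_fun_def)
  qed
next
  assume s: "pair_sector n (-1) \<psi>"
  then have \<psi>: "\<psi> \<in> spinors n" by (simp add: pair_sector_def)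
  have 3: "cliff_basis 3 \<psi> \<in> spinors n" using assms by (intro cliff_basis_spinors[OF \<psi>]) auto
  show "cliff_basis 2 \<psi> + cliff_basis 1 (cliff_basis 3 \<psi>) = 0"
  proof
    fix S
    let ?T = "toggle 1 S"
    have "(cliff_basis 2 \<psi> + cliff_basis 1 (cliff_basis 3 \<psi>)) S
       = \<i> * count_sign 1 S * \<psi> ?T * (1 + (-1) ^ card S * (if 1 \<in> S then 1 else -1))"
      by (simp add: pointwise cliff_basis_apply[OF \<psi>] cliff_basis_apply[OF 3] phase_def target_def
          algebra_simps)
    also have "\<dots> = 0"
    proof (cases "\<psi> ?T = 0")
      case False
      then have "finite S" using spinors_infinite[OF \<psi>, of ?T] by auto
      then have c: "(-1 :: complex) ^ card S = - ((-1) ^ card ?T)"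
        using power_card_toggle[of S 1] by simp
      show ?thesis unfolding c pair_sector_parity[OF s False] by simp
    qed simp
    finally show "(cliff_basis 2 \<psi> + cliff_basis 1 (cliff_basis 3 \<psi>)) S = 0 S"
      by (simp add: zero_fun_def)
  qed
qed

context three_sasakian_frame
begin

lemma reeb_idx_simps [simp]: "1 \<in> reeb_idx" "Suc 0 \<in> reeb_idx" "2 \<in> reeb_idx" "3 \<in> reeb_idx"
  by (auto simp: reeb_idx_def)

lemma eta_frame: "i \<in> reeb_idx \<Longrightarrow> a \<in> I \<Longrightarrow> a \<noteq> i \<Longrightarrow> g (e i) (e a) = 0"
  using orthonormal[OF reeb_index] by simp

lemma defect_frame:
  assumes "i \<in> reeb_idx" "a \<in> I" "a \<noteq> i" "b \<in> I"
  shows "\<phi> i (e a) = e b \<Longrightarrow> defect i (e a) \<psi> = cliff_basis b \<psi> + cliff_basis a (cliff_basis i \<psi>)"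
    and "\<phi> i (e a) = - e b \<Longrightarrow> defect i (e a) \<psi> = - cliff_basis b \<psi> + cliff_basis a (cliff_basis i \<psi>)"
proof -
  have "smul (of_real (g (e i) (e a))) \<psi> = 0"
    using eta_frame[OF assms(1-3)] by (simp add: fun_eq_iff pointwise)
  then have d: "defect i (e a) \<psi> = cl (\<phi> i (e a)) \<psi> + cliff_basis a (cliff_basis i \<psi>)"
    unfolding defect_def cl_frame[OF assms(2)] cl_frame[OF reeb_index[OF assms(1)]] by simp
  show "\<phi> i (e a) = e b \<Longrightarrow> defect i (e a) \<psi> = cliff_basis b \<psi> + cliff_basis a (cliff_basis i \<psi>)"
    unfolding d by (simp only: cl_frame[OF assms(4)])
  show "\<phi> i (e a) = - e b \<Longrightarrow> defect i (e a) \<psi> = - cliff_basis b \<psi> + cliff_basis a (cliff_basis i \<psi>)"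
    unfolding d by (simp only: cl_vec_minus[OF frame_mem[OF assms(4)]] cl_frame[OF assms(4)])
qed

lemma defect_frame_phi:
  assumes i: "i \<in> reeb_idx" and \<psi>: "\<psi> \<in> spinors n" and ab: "a \<in> I" "b \<in> I"
    and e: "\<phi> i (e a) = e b \<or> \<phi> i (e a) = - e b" and d: "defect i (e a) \<psi> = 0"
  shows "defect i (e b) \<psi> = 0"
proof -
  have 0: "defect i (\<phi> i (e a)) \<psi> = 0"
    using defect_reeb(2)[OF i frame_mem[OF ab(1)] \<psi>] d by (simp add: cl_zero)
  from e show ?thesis
  proof
    assume "\<phi> i (e a) = - e b"
    then have "e b = (-1) *\<^sub>R \<phi> i (e a)" by simp
    then show ?thesis
      using defect_vec_scale[OF i phi_mem[OF i frame_mem[OF ab(1)]], of "-1" \<psi>] 0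
      by (simp add: fun_eq_iff pointwise)
  qed (use 0 in simp)
qed

lemma defect_reeb_self: "i \<in> reeb_idx \<Longrightarrow> \<psi> \<in> spinors n \<Longrightarrow> defect i (e i) \<psi> = 0"
  by (simp add: defect_def phi_reeb cl_vec_zero reeb_square reeb_orthonormal)

text \<open>
The action on the horizontal frame vectors, from the quaternion relations.
\<close>

lemma phi_frame:
  assumes p: "p \<in> {1..n-1}"
  shows "\<phi> 1 (e (4*p)) = e (4*p+1)" "\<phi> 1 (e (4*p+2)) = e (4*p+3)"
    "\<phi> 2 (e (4*p)) = e (4*p+2)" "\<phi> 2 (e (4*p+1)) = - e (4*p+3)"
    "\<phi> 3 (e (4*p)) = e (4*p+3)" "\<phi> 3 (e (4*p+1)) = e (4*p+2)"
proof -
  have I: "4*p \<in> I" "4*p \<noteq> 1" "4*p \<noteq> 2" "4*p \<noteq> 3" using p by (auto; presburger)+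
  show 1: "\<phi> 1 (e (4*p)) = e (4*p+1)" and 2: "\<phi> 2 (e (4*p)) = e (4*p+2)"
    and 3: "\<phi> 3 (e (4*p)) = e (4*p+3)"
    using frame_adapted[OF _ p] by (metis reeb_idx_simps)+
  have c: "(1, 2, 3) \<in> {(1,2,3), (2,3,1), (3,1,2)}" "(3, 1, 2) \<in> {(1,2,3), (2,3,1), (3,1,2 :: nat)}"
    by auto
  show "\<phi> 1 (e (4*p+2)) = e (4*p+3)"
    using phi_phi_cross(1)[OF c(1) frame_mem[OF I(1)]] eta_frame[of 2 "4*p"] I unfolding 2 3 by simp
  show "\<phi> 2 (e (4*p+1)) = - e (4*p+3)"
    using phi_phi_cross(2)[OF c(1) frame_mem[OF I(1)]] eta_frame[of 1 "4*p"] I unfolding 1 3 by simp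
  show "\<phi> 3 (e (4*p+1)) = e (4*p+2)"
    using phi_phi_cross(1)[OF c(2) frame_mem[OF I(1)]] eta_frame[of 1 "4*p"] I unfolding 1 2 by simp
qed

lemma phi_vertical: "\<phi> 1 (e 2) = e 3" "\<phi> 2 (e 3) = e 1" "\<phi> 3 (e 1) = e 2"
  using phi_cross(1)[of 1 2 3] phi_cross(1)[of 2 3 1] phi_cross(1)[of 3 1 2] by auto

lemma frame_index_cases:
  assumes "a \<in> I"
  obtains "a \<in> reeb_idx" | p where "p \<in> {1..n-1}" "a \<in> {4*p, 4*p+1, 4*p+2, 4*p+3}"
proof (cases "a \<in> reeb_idx")
  case False
  then have "a div 4 \<in> {1..n-1}" using assms by (auto simp: reeb_idx_def)
  moreover have "a \<in> {4*(a div 4), 4*(a div 4)+1, 4*(a div 4)+2, 4*(a div 4)+3}"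
    by simp presburger
  ultimately show ?thesis using that by blast
qed

lemma frame_index:
  assumes "p \<in> {1..n-1}"
  shows "4*p \<in> I" "4*p+1 \<in> I" "4*p+2 \<in> I" "4*p+3 \<in> I"
  using assms by auto

lemma vertical_index: "1 \<in> I" "2 \<in> I" "3 \<in> I"
  using reeb_index by auto

text \<open>
By \<open>defect_frame_phi\<close> it is enough to check one vector of each pair exchanged by \<open>\<phi>\<^sub>i\<close>; this is also
how the equations of \<open>E\<^sub>2\<close> and \<open>E\<^sub>3\<close> below are obtained.
\<close>

lemma sasaki_1_equations:
  assumes \<psi>: "\<psi> \<in> spinors n"
  shows "\<psi> \<in> sasaki_spinors 1 \<longleftrightarrow>
    (\<forall>j\<in>{1..2*n-1}. cliff_basis (2*j+1) \<psi> + cliff_basis (2*j) (cliff_basis 1 \<psi>) = 0)"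
proof -
  have t: "1 \<in> reeb_idx" by simp
  have phi: "\<phi> 1 (e (2*j)) = e (2*j+1) \<and> 2*j \<in> I \<and> 2*j+1 \<in> I \<and> 2*j \<noteq> 1" if j: "j \<in> {1..2*n-1}" for j
  proof (cases "j = 1")
    case True
    then show ?thesis using phi_vertical(1) vertical_index by (simp add: numeral_3_eq_3)
  next
    case False
    then have p: "j div 2 \<in> {1..n-1}" using j by auto
    have "2*j = 4*(j div 2) \<or> 2*j = 4*(j div 2)+2" by presburger
    then show ?thesis
    proof
      assume 1: "2*j = 4*(j div 2)"
      show ?thesis using phi_frame(1)[OF p] frame_index[OF p] unfolding 1 by auto
    next
      assume 2: "2*j = 4*(j div 2)+2"
      show ?thesis using phi_frame(2)[OF p] frame_index[OF p] unfolding 2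
        by (auto simp: numeral_3_eq_3)
    qed
  qed
  have eq: "defect 1 (e (2*j)) \<psi> = cliff_basis (2*j+1) \<psi> + cliff_basis (2*j) (cliff_basis 1 \<psi>)"
    if "j \<in> {1..2*n-1}" for j
    using phi[OF that] by (intro defect_frame(1)[OF t]) auto
  show ?thesis
  proof
    assume E: "\<psi> \<in> sasaki_spinors 1"
    show "\<forall>j\<in>{1..2*n-1}. cliff_basis (2*j+1) \<psi> + cliff_basis (2*j) (cliff_basis 1 \<psi>) = 0"
      using eq sasaki_defect[OF E frame_mem] phi by metis
  next
    assume L: "\<forall>j\<in>{1..2*n-1}. cliff_basis (2*j+1) \<psi> + cliff_basis (2*j) (cliff_basis 1 \<psi>) = 0"
    show "\<psi> \<in> sasaki_spinors 1"
    proof (rule sasaki_spinorsI[OF t \<psi>])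
      fix a assume a: "a \<in> I"
      show "defect 1 (e a) \<psi> = 0"
      proof (cases "a = 1")
        case False
        then have j: "a div 2 \<in> {1..2*n-1}" using a by auto
        have 0: "defect 1 (e (2*(a div 2))) \<psi> = 0" using eq[OF j] L j by metis
        have "defect 1 (e (2*(a div 2)+1)) \<psi> = 0"
          by (rule defect_frame_phi[OF t \<psi> _ _ _ 0]) (use phi[OF j] in blast)+
        moreover have "a = 2*(a div 2) \<or> a = 2*(a div 2)+1" by presburger
        ultimately show ?thesis using 0 by metis
      qed (use defect_reeb_self[OF t \<psi>] in simp)
    qed
  qed
qed

lemma sasaki_2_equations:
  assumes \<psi>: "\<psi> \<in> spinors n"
  shows "\<psi> \<in> sasaki_spinors 2 \<longleftrightarrow> cliff_basis 1 \<psi> + cliff_basis 3 (cliff_basis 2 \<psi>) = 0 \<and>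
    (\<forall>p\<in>{1..n-1}. cliff_basis (4*p+2) \<psi> + cliff_basis (4*p) (cliff_basis 2 \<psi>) = 0 \<and>
      - cliff_basis (4*p+3) \<psi> + cliff_basis (4*p+1) (cliff_basis 2 \<psi>) = 0)"
    (is "_ \<longleftrightarrow> ?v = 0 \<and> (\<forall>p\<in>_. ?h1 p = 0 \<and> ?h2 p = 0)")
proof -
  have t: "2 \<in> reeb_idx" by simp
  have v: "defect 2 (e 3) \<psi> = ?v"
    by (intro defect_frame(1)[OF t] phi_vertical vertical_index) auto
  have h: "defect 2 (e (4*p)) \<psi> = ?h1 p" "defect 2 (e (4*p+1)) \<psi> = ?h2 p" if p: "p \<in> {1..n-1}" for p
    using p by (intro defect_frame[OF t] phi_frame[OF p] frame_index[OF p]; auto; presburger)+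
  show ?thesis
  proof
    assume E: "\<psi> \<in> sasaki_spinors 2"
    show "?v = 0 \<and> (\<forall>p\<in>{1..n-1}. ?h1 p = 0 \<and> ?h2 p = 0)"
      using v h sasaki_defect[OF E frame_mem] vertical_index frame_index by metis
  next
    assume L: "?v = 0 \<and> (\<forall>p\<in>{1..n-1}. ?h1 p = 0 \<and> ?h2 p = 0)"
    show "\<psi> \<in> sasaki_spinors 2"
    proof (rule sasaki_spinorsI[OF t \<psi>])
      fix a assume "a \<in> I"
      then show "defect 2 (e a) \<psi> = 0"
      proof (cases rule: frame_index_cases)
        case 1
        have 3: "defect 2 (e 3) \<psi> = 0" using v L by simp
        then have "defect 2 (e 1) \<psi> = 0"
          using phi_vertical(2) by (intro defect_frame_phi[OF t \<psi> vertical_index(3,1)]) auto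
        then show ?thesis using 1 3 defect_reeb_self[OF t \<psi>] by (auto simp: reeb_idx_def)
      next
        case (2 p)
        note p = 2(1)
        have d: "defect 2 (e (4*p)) \<psi> = 0" "defect 2 (e (4*p+1)) \<psi> = 0" using h[OF p] L p by auto
        have "defect 2 (e (4*p+2)) \<psi> = 0" "defect 2 (e (4*p+3)) \<psi> = 0"
          using phi_frame[OF p] d
          by (intro defect_frame_phi[OF t \<psi> frame_index(1,3)[OF p]]
                defect_frame_phi[OF t \<psi> frame_index(2,4)[OF p]]; blast)+
        then show ?thesis using d 2(2) by auto
      qed
    qed
  qed
qed

lemma sasaki_3_equations:
  assumes \<psi>: "\<psi> \<in> spinors n"
  shows "\<psi> \<in> sasaki_spinors 3 \<longleftrightarrow> cliff_basis 2 \<psi> + cliff_basis 1 (cliff_basis 3 \<psi>) = 0 \<and>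
    (\<forall>p\<in>{1..n-1}. cliff_basis (4*p+3) \<psi> + cliff_basis (4*p) (cliff_basis 3 \<psi>) = 0 \<and>
      cliff_basis (4*p+2) \<psi> + cliff_basis (4*p+1) (cliff_basis 3 \<psi>) = 0)"
    (is "_ \<longleftrightarrow> ?v = 0 \<and> (\<forall>p\<in>_. ?h1 p = 0 \<and> ?h2 p = 0)")
proof -
  have t: "3 \<in> reeb_idx" by simp
  have v: "defect 3 (e 1) \<psi> = ?v"
    by (intro defect_frame(1)[OF t] phi_vertical vertical_index) auto
  have h: "defect 3 (e (4*p)) \<psi> = ?h1 p" "defect 3 (e (4*p+1)) \<psi> = ?h2 p" if p: "p \<in> {1..n-1}" for p
    using p by (intro defect_frame(1)[OF t] phi_frame[OF p] frame_index[OF p]; auto; presburger)+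
  show ?thesis
  proof
    assume E: "\<psi> \<in> sasaki_spinors 3"
    show "?v = 0 \<and> (\<forall>p\<in>{1..n-1}. ?h1 p = 0 \<and> ?h2 p = 0)"
      using v h sasaki_defect[OF E frame_mem] vertical_index frame_index by metis
  next
    assume L: "?v = 0 \<and> (\<forall>p\<in>{1..n-1}. ?h1 p = 0 \<and> ?h2 p = 0)"
    show "\<psi> \<in> sasaki_spinors 3"
    proof (rule sasaki_spinorsI[OF t \<psi>])
      fix a assume "a \<in> I"
      then show "defect 3 (e a) \<psi> = 0"
      proof (cases rule: frame_index_cases)
        case 1
        have 3: "defect 3 (e 1) \<psi> = 0" using v L by simp
        then have "defect 3 (e 2) \<psi> = 0"
          using phi_vertical(3) by (intro defect_frame_phi[OF t \<psi> vertical_index(1,2)]) auto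
        then show ?thesis using 1 3 defect_reeb_self[OF t \<psi>] by (auto simp: reeb_idx_def)
      next
        case (2 p)
        note p = 2(1)
        have d: "defect 3 (e (4*p)) \<psi> = 0" "defect 3 (e (4*p+1)) \<psi> = 0" using h[OF p] L p by auto
        have "defect 3 (e (4*p+3)) \<psi> = 0" "defect 3 (e (4*p+2)) \<psi> = 0"
          using phi_frame[OF p] d
          by (intro defect_frame_phi[OF t \<psi> frame_index(1,4)[OF p]]
                defect_frame_phi[OF t \<psi> frame_index(2,3)[OF p]]; blast)+
        then show ?thesis using d 2(2) by auto
      qed
    qed
  qed
qed

lemma sasaki_1_iff:
  "\<psi> \<in> sasaki_spinors 1 \<longleftrightarrow> \<psi> \<in> spinors n \<and> (\<forall>S. S \<noteq> {} \<longrightarrow> S \<noteq> {1..2*n-1} \<longrightarrow> \<psi> S = 0)"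
  using sasaki_1_equations extremal_support_iff[OF _ n_pos] sasaki_spinorsD by blast

lemma sasaki_2_iff: "\<psi> \<in> sasaki_spinors 2 \<longleftrightarrow> pair_sector n 1 \<psi>"
proof -
  have "pair_sector n 1 \<psi> \<longleftrightarrow> (\<forall>p\<in>{1..n-1}. cliff_basis (4*p+2) \<psi> + cliff_basis (4*p) (cliff_basis 2 \<psi>) = 0 \<and>
      - cliff_basis (4*p+3) \<psi> + cliff_basis (4*p+1) (cliff_basis 2 \<psi>) = 0)" if "\<psi> \<in> spinors n"
    unfolding pair_sector_local[OF mult_1 that] by (intro ball_cong refl sector_2_local[OF that, symmetric])
  then show ?thesis
    using sasaki_2_equations pair_sector_vertical(1)[OF n_pos] sasaki_spinorsD
    unfolding pair_sector_def by blast
qed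

lemma sasaki_3_iff: "\<psi> \<in> sasaki_spinors 3 \<longleftrightarrow> pair_sector n (-1) \<psi>"
proof -
  have m: "-1 * -1 = (1 :: complex)" by simp
  have "pair_sector n (-1) \<psi> \<longleftrightarrow> (\<forall>p\<in>{1..n-1}. cliff_basis (4*p+3) \<psi> + cliff_basis (4*p) (cliff_basis 3 \<psi>) = 0 \<and>
      cliff_basis (4*p+2) \<psi> + cliff_basis (4*p+1) (cliff_basis 3 \<psi>) = 0)" if "\<psi> \<in> spinors n"
    unfolding pair_sector_local[OF m that] by (intro ball_cong refl sector_3_local[OF that, symmetric])
  then show ?thesis
    using sasaki_3_equations pair_sector_vertical(2)[OF n_pos] sasaki_spinorsD
    unfolding pair_sector_def by blast
qed

text \<open>
Non-vanishing is seen at the coefficient of weight \<open>1\<close>, of weight \<open>0\<close>, or of the top form.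
\<close>

lemma Psi_sasaki:
  assumes "i \<in> reeb_idx" "j \<in> {0, 1}"
  shows "Psi n i j \<in> sasaki_spinors i" "Psi n i j \<noteq> 0"
proof -
  consider "i = 1" "j = 0" | "i = 1" "j = 1" | "i \<in> {2, 3}" using assms by (auto simp: reeb_idx_def)
  then have "Psi n i j \<in> sasaki_spinors i \<and> Psi n i j \<noteq> 0"
  proof cases
    case 1
    have "unit_form {} \<noteq> 0" by (simp add: unit_form_def)
    then have "unit_form \<noteq> 0" by (metis zero_fun_apply)
    then show ?thesis using 1
      by (auto simp: Psi_1_0 sasaki_1_iff unit_form_def spinors_def simp del: One_nat_def)
  next
    case 2
    obtain c where c: "c \<noteq> 0" "Psi n 1 1 = (\<lambda>S. if S = {1..2*n-1} then c else 0)"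
      using Psi_1_1[OF n_pos] .
    have "Psi n 1 1 {1..2*n-1} \<noteq> 0" using c by simp
    then have "Psi n 1 1 \<noteq> 0" by (metis zero_fun_apply)
    then show ?thesis using 2 c
      by (auto simp: sasaki_1_iff spinors_def simp del: One_nat_def)
  next
    case 3
    let ?F = "\<lambda>w. if odd w = (j = 0) then (if i = 2 then -1 else 1 :: complex) ^ (w div 2) else 0"
    let ?\<kappa> = "if n = 1 \<and> j = 0 then \<i> else 1 :: complex"
    have P: "Psi n i j = smul ?\<kappa> (ladder n ?F)"
      by (rule Psi_ladder[OF n_pos 3 assms(2)])
    have F: "?F (m + 2) = - (if i = 2 then 1 else -1) * ?F m" for m
    proof -
      have 1: "odd (m + 2) = odd m" and 2: "(m + 2) div 2 = Suc (m div 2)" by simp_all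
      show ?thesis unfolding 1 2 power_Suc
        by (cases "odd m = (j = 0)"; simp only: if_True if_False mult_zero_right; simp)
    qed
    have "pair_sector n (if i = 2 then 1 else -1) (ladder n ?F)"
      by (rule ladder_pair_sector[OF n_pos]) (rule F)
    then have "ladder n ?F \<in> sasaki_spinors i"
      using 3 sasaki_2_iff sasaki_3_iff by (cases "i = 2") auto
    then have E: "Psi n i j \<in> sasaki_spinors i" unfolding P by (rule sasaki_smul)
    have "ladder n ?F (if j = 0 then {1} else {}) \<noteq> 0"
    proof -
      have "paired n {1}" "weight n {1} = 1" "paired n {}" "weight n {} = 0"
        using n_pos by (auto simp: paired_def weight_def)
      then show ?thesis by (simp add: ladder_def del: One_nat_def)
    qed
    then have "Psi n i j (if j = 0 then {1} else {}) \<noteq> 0" unfolding P by (simp add: smul_apply)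
    then have "Psi n i j \<noteq> 0" by (metis zero_fun_apply)
    then show ?thesis using E by simp
  qed
  then show "Psi n i j \<in> sasaki_spinors i" "Psi n i j \<noteq> 0" by auto
qed

section \<open>Rigidity of adapted spinors\<close>

lemma sasaki_1_eq_0:
  assumes "\<psi> \<in> sasaki_spinors 1" "\<psi> {} = 0" "\<psi> {1..2*n-1} = 0"
  shows "\<psi> = 0"
  using assms unfolding sasaki_1_iff by (intro ext) (metis zero_fun_apply)

lemma sasaki_23_eq_0:
  assumes "i \<in> {2, 3}" "\<psi> \<in> sasaki_spinors i" "\<psi> {} = 0" "\<psi> {1} = 0"
  shows "\<psi> = 0"
  using assms pair_sector_eq_0 sasaki_2_iff sasaki_3_iff by blast

lemma hermitian_eq_0:
  assumes "\<psi> \<in> spinors n" "hermitian n \<psi> \<psi> = 0"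
  shows "\<psi> = 0"
proof (rule ccontr)
  assume "\<psi> \<noteq> 0"
  then obtain S where "\<psi> S \<noteq> 0" by (auto simp: fun_eq_iff zero_fun_def)
  then show False
    using hermitian_self_pos[of \<psi> S n] spinors_eq_0[OF assms(1), of S] assms(2) by auto
qed

lemma hermitian_unit_form: "hermitian n \<psi> unit_form = \<psi> {}"
proof -
  have "hermitian n \<psi> unit_form = (\<Sum>S\<in>Pow {1..2*n-1}. if S = {} then \<psi> S else 0)"
    unfolding hermitian_def unit_form_def by (intro sum.cong) auto
  then show ?thesis by (simp add: sum.delta)
qed

lemma unit_form_sasaki: "unit_form \<in> sasaki_spinors 1"
  by (auto simp: sasaki_1_iff unit_form_def spinors_def simp del: One_nat_def)

text \<open>
Let \<open>d\<close> be the eigenvalue of the adjoint \<open>T'\<close> at \<open>1\<close>.  Charge conjugation turns \<open>1\<close> into a multiple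
of the top form, so there the eigenvalue is \<open>cnj d\<close>.  Paired with \<open>1\<close> and with the top form, \<open>T\<close>
multiplies the lowest coefficient by \<open>cnj d\<close> and the highest by \<open>d\<close>.  The coefficient at \<open>{1}\<close> is
the lowest one of \<open>\<xi>\<^sub>2 \<cdot> \<psi>\<close> or \<open>\<xi>\<^sub>3 \<cdot> \<psi>\<close>, up to a factor.
\<close>

lemma rigidity:
  fixes T T' :: "spinor \<Rightarrow> spinor"
  assumes T_sasaki: "\<And>i \<psi>. i \<in> reeb_idx \<Longrightarrow> \<psi> \<in> sasaki_spinors i \<Longrightarrow> T \<psi> \<in> sasaki_spinors i"
    and T_reeb: "\<And>i \<psi>. i \<in> reeb_idx \<Longrightarrow> \<psi> \<in> sasaki_spinors i \<Longrightarrow> T (cl (e i) \<psi>) = cl (e i) (T \<psi>)"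
    and T'_sasaki: "T' unit_form \<in> sasaki_spinors 1"
    and T'_reeb: "T' (cl (e 1) unit_form) = cl (e 1) (T' unit_form)"
    and adjoint: "\<And>\<psi> \<phi>'. \<psi> \<in> spinors n \<Longrightarrow> \<phi>' \<in> spinors n \<Longrightarrow> hermitian n (T \<psi>) \<phi>' = hermitian n \<psi> (T' \<phi>')"
    and T'_smul: "T' (smul \<i> unit_form) = smul \<i> (T' unit_form)"
    and T'_charge: "charge n (T' unit_form) = T' (charge n unit_form)"
  obtains c :: real where "\<And>i \<psi>. i \<in> reeb_idx \<Longrightarrow> \<psi> \<in> sasaki_spinors i \<Longrightarrow> T \<psi> = smul (of_real c) \<psi>"
    "T' unit_form = smul (of_real c) unit_form"
proof -
  let ?top = "{1..2*n-1}" and ?u = unit_form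
  let ?v = "charge n ?u"
  have one: "1 \<in> reeb_idx" by simp
  note u = unit_form_sasaki and us = sasaki_spinorsD[OF unit_form_sasaki]
  have top: "?top \<noteq> {}" "card ?top = 2*n-1" using n_pos by auto
  have cl1: "cl (e 1) \<psi> S = \<i> * (-1) ^ card S * \<psi> S" if "\<psi> \<in> spinors n" for \<psi> S
    unfolding cl_frame[OF vertical_index(1)]
    using cliff_basis_apply[OF that, of 1 S] by (simp add: phase_def target_def)
  have sign_top: "(-1 :: complex) ^ card ?top = -1" unfolding top(2) using n_pos by simp
  have u1: "cl (e 1) ?u = smul \<i> ?u"
    by (rule ext) (simp add: cl1[OF us] smul_apply unit_form_def del: One_nat_def)
  define d where "d = T' ?u {}"
  have T'u: "T' ?u = smul d ?u"
  proof -
    have "T' ?u \<in> spinors n" by (rule sasaki_spinorsD[OF T'_sasaki])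
    moreover have "cl (e 1) (T' ?u) = smul \<i> (T' ?u)"
      using T'_reeb T'_smul unfolding u1 by simp
    ultimately have "T' ?u ?top = 0"
      using cl1[of "T' ?u" ?top] unfolding sign_top by (simp add: smul_apply)
    moreover have "T' ?u - smul d ?u \<in> sasaki_spinors 1"
      by (intro sasaki_diff T'_sasaki sasaki_smul u)
    ultimately have "T' ?u - smul d ?u = 0"
      using top(1) by (intro sasaki_1_eq_0) (simp_all add: pointwise d_def unit_form_def del: One_nat_def)
    then show ?thesis by simp
  qed
  have v: "?v \<in> sasaki_spinors 1" by (rule sasaki_charge[OF u])
  note vs = sasaki_spinorsD[OF v]
  \<comment> \<open>\<open>e\<^sub>1\<close> has eigenvalue \<open>\<i>\<close> at \<open>1\<close>, hence \<open>-\<i>\<close> at its conjugate, which excludes a component along \<open>1\<close>\<close>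
  have v0: "?v {} = 0"
  proof -
    have "cl (e 1) ?v = smul (-\<i>) ?v"
      using cl_charge[OF us, of "e 1"] charge_smul[of n \<i> ?u] unfolding u1 by simp
    then show ?thesis using cl1[OF vs, of "{}"] by (simp add: smul_apply)
  qed
  have vtop: "?v ?top \<noteq> 0"
  proof
    assume "?v ?top = 0"
    then have "?v = 0" using sasaki_1_eq_0[OF v v0] by simp
    then have "hermitian n ?u ?u = 0" using hermitian_charge[OF us] by (simp add: hermitian_def zero_fun_def)
    then show False by (simp add: hermitian_unit_form unit_form_def)
  qed
  have herm_v: "hermitian n \<psi> ?v = \<psi> ?top * cnj (?v ?top)" for \<psi>
  proof -
    have "?v S = 0" if "S \<noteq> ?top" for S
      using v v0 that unfolding sasaki_1_iff by metis
    then have "hermitian n \<psi> ?v = (\<Sum>S\<in>Pow ?top. if S = ?top then \<psi> S * cnj (?v S) else 0)"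
      unfolding hermitian_def by (intro sum.cong) auto
    then show ?thesis by (simp add: sum.delta)
  qed
  have T'v: "T' ?v = smul (cnj d) ?v"
    using T'_charge charge_smul[of n d ?u] unfolding T'u by simp
  have T_bot: "T \<psi> {} = cnj d * \<psi> {}" if "\<psi> \<in> spinors n" for \<psi>
    using adjoint[OF that us] unfolding T'u by (simp add: hermitian_unit_form hermitian_smul_right)
  have T_top: "T \<psi> ?top = d * \<psi> ?top" if "\<psi> \<in> spinors n" for \<psi>
    using adjoint[OF that vs] vtop unfolding T'v hermitian_smul_right herm_v
    by (simp add: mult.assoc[symmetric] del: One_nat_def)
  have T23: "T \<psi> = smul (cnj d) \<psi>" if i: "i \<in> {2, 3}" and E: "\<psi> \<in> sasaki_spinors i" for i \<psi>
  proof -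
    have it: "i \<in> reeb_idx" using i by auto
    have ph: "cl (e i) \<theta> {} = phase i {} * \<theta> {1}" if "\<theta> \<in> spinors n" for \<theta>
      unfolding cl_frame[OF reeb_index[OF it]]
      using i cliff_basis_apply[OF that, of i "{}"] by (auto simp: target_def toggle_def)
    have nz: "phase i {} \<noteq> 0" using i by (auto simp: phase_def count_sign_def)
    note \<psi> = sasaki_spinorsD[OF E] and TE = T_sasaki[OF it E]
    have "phase i {} * T \<psi> {1} = cl (e i) (T \<psi>) {}"
      by (rule ph[OF sasaki_spinorsD[OF TE], symmetric])
    also have "\<dots> = cnj d * cl (e i) \<psi> {}"
      using T_bot[OF cl_spinors[OF \<psi>, of "e i"]] T_reeb[OF it E] by simp
    also have "\<dots> = phase i {} * (cnj d * \<psi> {1})" by (simp add: ph[OF \<psi>])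
    finally have "T \<psi> {1} = cnj d * \<psi> {1}" using nz by simp
    then have "T \<psi> - smul (cnj d) \<psi> = 0"
      using T_bot[OF \<psi>] by (intro sasaki_23_eq_0[OF i] sasaki_diff TE sasaki_smul E) (simp_all add: pointwise del: One_nat_def)
    then show ?thesis by simp
  qed
  have "d = cnj d"
  proof -
    \<comment> \<open>the exponential series of \<open>\<i> (\<omega> - \<i> y\<^sub>1)\<close>, which has non-zero coefficients at all weights\<close>
    define \<psi> where "\<psi> = ladder n (\<lambda>w. \<i> ^ w)"
    have E: "\<psi> \<in> sasaki_spinors 2"
      unfolding sasaki_2_iff \<psi>_def by (rule ladder_pair_sector[OF n_pos]) simp
    have "paired n ?top \<and> weight n ?top = n" using paired_weight_max[OF n_pos, of ?top] by simp
    then have nz: "\<psi> ?top \<noteq> 0" by (simp add: \<psi>_def ladder_def del: One_nat_def)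
    have "d * \<psi> ?top = T \<psi> ?top" using T_top[OF sasaki_spinorsD[OF E]] by simp
    also have "\<dots> = cnj d * \<psi> ?top" using T23[OF _ E] by (simp add: smul_apply)
    finally show ?thesis using nz by simp
  qed
  then obtain c where c: "d = of_real c" by (metis Reals_cases Reals_cnj_iff)
  show ?thesis
  proof (rule that[of c])
    show "T' unit_form = smul (of_real c) unit_form" using T'u c by simp
    fix i \<psi> assume i: "i \<in> reeb_idx" and E: "\<psi> \<in> sasaki_spinors i"
    show "T \<psi> = smul (of_real c) \<psi>"
    proof (cases "i = 1")
      case True
      note \<psi> = sasaki_spinorsD[OF E]
      have "T \<psi> - smul (of_real c) \<psi> = 0"
        using T_bot[OF \<psi>] T_top[OF \<psi>] c T_sasaki[OF i E] E True
        by (intro sasaki_1_eq_0 sasaki_diff sasaki_smul) (simp_all add: pointwise del: One_nat_def)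
      then show ?thesis by simp
    next
      case False
      then have "i \<in> {2, 3}" using i by (auto simp: reeb_idx_def)
      from T23[OF this E] show ?thesis using c by simp
    qed
  qed
qed

lemma killing_defect_sasaki_eq_0:
  assumes X: "X \<in> tng Q" and i: "i \<in> reeb_idx" and E: "\<psi> \<in> sasaki_spinors i"
  shows "killing_defect X \<psi> = 0"
proof -
  have n0: "smul (-1) (killing_defect X \<phi>') = - killing_defect X \<phi>'" for \<phi>' by (simp add: minus_smul)
  note us = sasaki_spinorsD[OF unit_form_sasaki]
  obtain c :: real where c: "\<And>i \<psi>. i \<in> reeb_idx \<Longrightarrow> \<psi> \<in> sasaki_spinors i \<Longrightarrow> killing_defect X \<psi> = smul (of_real c) \<psi>"
    "smul (-1) (killing_defect X unit_form) = smul (of_real c) unit_form"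
  proof (rule rigidity[of "killing_defect X" "\<lambda>\<phi>'. smul (-1) (killing_defect X \<phi>')"])
    fix i \<psi> assume "i \<in> reeb_idx" "\<psi> \<in> sasaki_spinors i"
    then show "killing_defect X \<psi> \<in> sasaki_spinors i"
      "killing_defect X (cl (e i) \<psi>) = cl (e i) (killing_defect X \<psi>)"
      by (simp_all add: killing_defect_sasaki killing_defect_reeb X)
  next
    show "smul (-1) (killing_defect X unit_form) \<in> sasaki_spinors 1"
      by (intro sasaki_smul killing_defect_sasaki X unit_form_sasaki reeb_idx_simps)
    show "smul (-1) (killing_defect X (cl (e 1) unit_form)) = cl (e 1) (smul (-1) (killing_defect X unit_form))"
      by (simp only: killing_defect_reeb[OF reeb_idx_simps(1) X unit_form_sasaki] cl_smul)
    show "smul (-1) (killing_defect X (smul \<i> unit_form)) = smul \<i> (smul (-1) (killing_defect X unit_form))"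
      by (simp add: killing_defect_smul)
    show "charge n (smul (-1) (killing_defect X unit_form)) = smul (-1) (killing_defect X (charge n unit_form))"
      by (simp add: charge_smul killing_defect_charge[OF us])
    fix \<psi> \<phi>' assume "\<psi> \<in> spinors n" "\<phi>' \<in> spinors n"
    then show "hermitian n (killing_defect X \<psi>) \<phi>' = hermitian n \<psi> (smul (-1) (killing_defect X \<phi>'))"
      by (simp add: killing_defect_skew hermitian_smul_right)
  qed blast
  have "smul (of_real c) unit_form {} = smul (-1) (smul (of_real c) unit_form) {}"
    using c(1)[OF _ unit_form_sasaki] c(2) by simp
  then have "c = 0" by (simp add: smul_apply unit_form_def)
  then show ?thesis using c(1)[OF i E] by (simp add: fun_eq_iff pointwise)
qed

end

section \<open>Matrix groups and their Lie algebras\<close>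

lemma matrix_add_right_distrib:
  fixes A B :: "real^'n::finite^'n"
  shows "(A + B) ** C = A ** C + B ** C"
  by (simp add: matrix_matrix_mult_def vec_eq_iff distrib_right sum.distrib)

interpretation matrix_mult: bounded_bilinear "(**) :: real^'n::finite^'n \<Rightarrow> real^'n^'n \<Rightarrow> real^'n^'n"
proof -
  have "bilinear ((**) :: real^'n^'n \<Rightarrow> real^'n^'n \<Rightarrow> real^'n^'n)"
    unfolding bilinear_def
    by (auto intro!: linearI simp: matrix_add_ldistrib matrix_add_right_distrib matrix_scalar_ac
        scalar_matrix_assoc[symmetric])
  then show "bounded_bilinear ((**) :: real^'n^'n \<Rightarrow> real^'n^'n \<Rightarrow> real^'n^'n)"
    by (simp add: bilinear_conv_bounded_bilinear)
qed

lemma matrix_inv_mult: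
  fixes a :: "real^'n::finite^'n"
  assumes "invertible a"
  shows "a ** matrix_inv a = mat 1" "matrix_inv a ** a = mat 1"
  using someI_ex[of "\<lambda>a'. a ** a' = mat 1 \<and> a' ** a = mat 1"] assms
  unfolding invertible_def matrix_inv_def by auto

lemma matrix_inv_unique:
  fixes a b :: "real^'n::finite^'n"
  assumes "a ** b = mat 1" "b ** a = mat 1"
  shows "matrix_inv a = b"
proof -
  have "invertible a" using assms by (auto simp: invertible_def)
  then have "matrix_inv a = matrix_inv a ** (a ** b)" by (simp add: assms)
  also have "\<dots> = b" using matrix_inv_mult(2)[OF \<open>invertible a\<close>] by (simp add: matrix_mul_assoc)
  finally show ?thesis .
qed

lemma matrix_group_closed:
  assumes "compact_matrix_group G"
  shows "mat 1 \<in> G" "a \<in> G \<Longrightarrow> b \<in> G \<Longrightarrow> a ** b \<in> G" "a \<in> G \<Longrightarrow> matrix_inv a \<in> G"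
    "a \<in> G \<Longrightarrow> invertible a"
  using assms by (auto simp: compact_matrix_group_def)

lemma lie_algebra_add:
  assumes G: "compact_matrix_group G" and "X \<in> lie_algebra G" "Y \<in> lie_algebra G"
  shows "X + Y \<in> lie_algebra G"
proof -
  obtain c d where c: "tangent_curve G X c" and d: "tangent_curve G Y d"
    using assms by (auto simp: lie_algebra_def)
  have "((\<lambda>t. c t ** d t) has_vector_derivative c 0 ** Y + X ** d 0) (at 0)"
    using c d by (intro matrix_mult.has_vector_derivative) (auto simp: tangent_curve_def)
  then have "tangent_curve G (X + Y) (\<lambda>t. c t ** d t)"
    using c d matrix_group_closed(2)[OF G] by (auto simp: tangent_curve_def add.commute)
  then show ?thesis by (auto simp: lie_algebra_def)
qed

lemma lie_algebra_scale:
  assumes "X \<in> lie_algebra G"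
  shows "s *\<^sub>R X \<in> lie_algebra G"
proof -
  obtain c where c: "tangent_curve G X c" using assms by (auto simp: lie_algebra_def)
  have "((\<lambda>t. s * t) has_vector_derivative s) (at 0)"
    by (auto intro!: derivative_eq_intros simp: has_vector_derivative_def)
  then have "((c \<circ> (\<lambda>t. s * t)) has_vector_derivative s *\<^sub>R X) (at 0)"
    using c by (intro vector_diff_chain_at) (auto simp: tangent_curve_def)
  then have "tangent_curve G (s *\<^sub>R X) (c \<circ> (\<lambda>t. s * t))"
    using c by (auto simp: tangent_curve_def)
  then show ?thesis by (auto simp: lie_algebra_def)
qed

lemma lie_algebra_zero: "compact_matrix_group G \<Longrightarrow> 0 \<in> lie_algebra G"
  by (auto simp: lie_algebra_def tangent_curve_def matrix_group_closed intro!: exI[of _ "\<lambda>_. mat 1"])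

lemma subspace_lie_algebra: "compact_matrix_group G \<Longrightarrow> subspace (lie_algebra G)"
  by (simp add: subspace_def lie_algebra_zero lie_algebra_add lie_algebra_scale)

lemma lie_algebra_Ad:
  assumes G: "compact_matrix_group G" and a: "a \<in> G" and X: "X \<in> lie_algebra G"
  shows "Ad a X \<in> lie_algebra G"
proof -
  obtain c where c: "tangent_curve G X c" using X by (auto simp: lie_algebra_def)
  have "((\<lambda>t. a ** c t ** matrix_inv a) has_vector_derivative a ** X ** matrix_inv a) (at 0)"
    using c unfolding tangent_curve_def
    by (intro bounded_linear.has_vector_derivative[OF matrix_mult.bounded_linear_left]
        bounded_linear.has_vector_derivative[OF matrix_mult.bounded_linear_right]) auto
  then have "tangent_curve G (Ad a X) (\<lambda>t. a ** c t ** matrix_inv a)"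
    using c a matrix_group_closed[OF G] by (auto simp: tangent_curve_def Ad_def matrix_inv_mult)
  then show ?thesis by (auto simp: lie_algebra_def)
qed

text \<open>
The bracket is the derivative at \<open>0\<close> of the curve \<open>Ad(c(t)) Y\<close>, which lies in the Lie algebra, a
finite-dimensional and hence closed subspace.
\<close>

lemma lie_algebra_bracket:
  fixes G :: "(real^'n::finite^'n) set"
  assumes G: "compact_matrix_group G" and X: "X \<in> lie_algebra G" and Y: "Y \<in> lie_algebra G"
  shows "lie_bracket X Y \<in> lie_algebra G"
proof -
  obtain c where c: "\<And>t. c t \<in> G" "c 0 = mat 1" "(c has_vector_derivative X) (at 0)"
    using X by (auto simp: lie_algebra_def tangent_curve_def)
  note inv = matrix_inv_mult[OF matrix_group_closed(4)[OF G c(1)]]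
  have c_lim: "(c \<longlongrightarrow> mat 1) (at 0)"
    using has_vector_derivative_continuous[OF c(3)] c(2) by (simp add: continuous_at)
  \<comment> \<open>inversion is continuous along the curve because the group is bounded\<close>
  have "bounded G" using G by (intro compact_imp_bounded) (simp add: compact_matrix_group_def)
  then obtain K where K: "\<And>a. a \<in> G \<Longrightarrow> norm a \<le> K"
    by (auto simp: bounded_iff)
  have inv_lim: "((\<lambda>t. matrix_inv (c t)) \<longlongrightarrow> mat 1) (at 0)"
  proof -
    obtain B where B: "\<forall>(a :: real^'n^'n) (b :: real^'n^'n). norm (a ** b) \<le> norm a * norm b * B"
      using matrix_mult.bounded by (rule exE)
    have B0: "norm (a ** b) \<le> norm a * norm b * \<bar>B\<bar>" for a b :: "real^'n^'n"
      by (rule order_trans[OF B[rule_format]]) (simp add: mult_left_mono)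
    have bound: "norm (matrix_inv (c t) - mat 1) \<le> K * \<bar>B\<bar> * norm (c t - mat 1)" for t
    proof -
      have "matrix_inv (c t) - mat 1 = - (matrix_inv (c t) ** (c t - mat 1))"
        by (simp add: matrix_mult.diff_right inv)
      then have "norm (matrix_inv (c t) - mat 1) \<le> norm (matrix_inv (c t)) * norm (c t - mat 1) * \<bar>B\<bar>"
        using B0 by simp
      also have "\<dots> \<le> K * norm (c t - mat 1) * \<bar>B\<bar>"
        by (intro mult_right_mono K matrix_group_closed(3)[OF G] c) auto
      finally show ?thesis by (simp add: mult_ac)
    qed
    have "((\<lambda>t. K * \<bar>B\<bar> * norm (c t - mat 1)) \<longlongrightarrow> 0) (at 0)"
      using c_lim by (intro tendsto_mult_right_zero tendsto_norm_zero) (simp add: LIM_zero)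
    then have "((\<lambda>t. matrix_inv (c t) - mat 1) \<longlongrightarrow> 0) (at 0)"
      by (rule Lim_null_comparison[OF always_eventually[OF allI[OF bound]]])
    then show ?thesis by (simp add: LIM_zero_iff)
  qed
  define q where "q t = (1 / t) *\<^sub>R (c t - mat 1)" for t
  have q: "(q \<longlongrightarrow> X) (at 0)"
  proof -
    have "((\<lambda>t. norm (c t - mat 1 - t *\<^sub>R X) / norm t) \<longlongrightarrow> 0) (at 0)"
      using c(2,3) by (simp add: has_vector_derivative_def has_derivative_iff_norm)
    moreover have "norm (c t - mat 1 - t *\<^sub>R X) / norm t = norm (q t - X)" if "t \<noteq> 0" for t
    proof -
      have "q t - X = (1 / t) *\<^sub>R (c t - mat 1 - t *\<^sub>R X)"
        using that by (simp add: q_def scaleR_diff_right)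
      then show ?thesis by simp
    qed
    ultimately have "((\<lambda>t. norm (q t - X)) \<longlongrightarrow> 0) (at 0)"
      by (elim Lim_transform_eventually) (simp add: eventually_at_filter)
    then show ?thesis by (simp add: tendsto_norm_zero_iff LIM_zero_iff)
  qed
  have quot: "(1 / t) *\<^sub>R (Ad (c t) Y - Y) = (q t ** Y - Y ** q t) ** matrix_inv (c t)" for t
  proof -
    have "Ad (c t) Y - Y = (c t ** Y - Y ** c t) ** matrix_inv (c t)"
      by (simp add: Ad_def matrix_mult.diff_left matrix_mul_assoc[symmetric] inv)
    also have "c t ** Y - Y ** c t = (c t - mat 1) ** Y - Y ** (c t - mat 1)"
      by (simp add: matrix_mult.diff_left matrix_mult.diff_right)
    finally show ?thesis
      by (simp add: q_def matrix_mult.diff_left matrix_mult.diff_right matrix_mult.scaleR_left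
          matrix_mult.scaleR_right scaleR_diff_right)
  qed
  have "((\<lambda>t. (q t ** Y - Y ** q t) ** matrix_inv (c t)) \<longlongrightarrow> (X ** Y - Y ** X) ** mat 1) (at 0)"
    by (intro matrix_mult.tendsto tendsto_diff q inv_lim tendsto_const)
  then have "((\<lambda>t. (1 / t) *\<^sub>R (Ad (c t) Y - Y)) \<longlongrightarrow> lie_bracket X Y) (at 0)"
    by (simp add: quot lie_bracket_def)
  moreover have "closed (lie_algebra G)" by (rule closed_subspace[OF subspace_lie_algebra[OF G]])
  moreover have "(1 / t) *\<^sub>R (Ad (c t) Y - Y) \<in> lie_algebra G" for t
    using subspace_lie_algebra[OF G] lie_algebra_Ad[OF G c(1) Y] Y
    by (intro subspace_scale subspace_diff)
  ultimately show ?thesis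
    by (intro Lim_in_closed_set[of "lie_algebra G" _ "at (0::real)"]) (auto intro: always_eventually)
qed

lemma Ad_linear:
  "Ad h (X + Y) = Ad h X + Ad h Y" "Ad h (X - Y) = Ad h X - Ad h Y" "Ad h (s *\<^sub>R X) = s *\<^sub>R Ad h X"
  by (simp_all add: Ad_def matrix_mult.add_left matrix_mult.add_right matrix_mult.diff_left
      matrix_mult.diff_right matrix_mult.scaleR_left matrix_mult.scaleR_right)

lemma Ad_inv:
  fixes h :: "real^'n::finite^'n"
  assumes "invertible h"
  shows "Ad h (Ad (matrix_inv h) X) = X" "Ad (matrix_inv h) (Ad h X) = X"
proof -
  note inv = matrix_inv_mult[OF assms]
  have "matrix_inv (matrix_inv h) = h" by (rule matrix_inv_unique) (simp_all add: inv)
  then show "Ad h (Ad (matrix_inv h) X) = X" "Ad (matrix_inv h) (Ad h X) = X"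
    unfolding Ad_def
    by (metis inv matrix_mul_assoc matrix_mul_lid matrix_mul_rid)+
qed

lemma Ad_bracket:
  fixes h :: "real^'n::finite^'n"
  assumes "invertible h"
  shows "lie_bracket (Ad h X) (Ad h Y) = Ad h (lie_bracket X Y)"
proof -
  have "Ad h X ** Ad h Y = Ad h (X ** Y)" for X Y
  proof -
    have "Ad h X ** Ad h Y = h ** X ** (matrix_inv h ** h) ** Y ** matrix_inv h"
      by (simp add: Ad_def matrix_mul_assoc)
    then show ?thesis by (simp add: matrix_inv_mult[OF assms] Ad_def matrix_mul_assoc)
  qed
  then show ?thesis by (simp add: lie_bracket_def Ad_linear)
qed

section \<open>Riemannian homogeneous spaces\<close>

lemma proj_tng:
  assumes Q: "riemannian_hspace Q" and Z: "Z \<in> lie_algebra (grp Q)"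
  shows "proj_tng Q Z \<in> tng Q" "Z - proj_tng Q Z \<in> lie_algebra (stab Q)"
    and "Y \<in> tng Q \<Longrightarrow> Z - Y \<in> lie_algebra (stab Q) \<Longrightarrow> proj_tng Q Z = Y"
proof -
  have sub: "subspace (lie_algebra (stab Q))" "subspace (tng Q)"
    using Q subspace_lie_algebra by (auto simp: riemannian_hspace_def)
  have unique: "Y = Y'" if "Y \<in> tng Q" "Z - Y \<in> lie_algebra (stab Q)"
    "Y' \<in> tng Q" "Z - Y' \<in> lie_algebra (stab Q)" for Y Y'
  proof -
    have "Y' - Y = (Z - Y) - (Z - Y')" by simp
    then have "Y' - Y \<in> lie_algebra (stab Q)" using that subspace_diff[OF sub(1)] by metis
    moreover have "Y' - Y \<in> tng Q" using that subspace_diff[OF sub(2)] by blast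
    moreover have "lie_algebra (stab Q) \<inter> tng Q = {0}" using Q by (simp add: riemannian_hspace_def)
    ultimately have "Y' - Y = 0" by blast
    then show ?thesis by simp
  qed
  obtain A X where "A \<in> lie_algebra (stab Q)" "X \<in> tng Q" "Z = A + X"
    using Q Z unfolding riemannian_hspace_def by blast
  then have ex: "X \<in> tng Q \<and> Z - X \<in> lie_algebra (stab Q)" by simp
  then have "proj_tng Q Z \<in> tng Q \<and> Z - proj_tng Q Z \<in> lie_algebra (stab Q)"
    unfolding proj_tng_def by (rule theI) (use unique ex in blast)
  then show "proj_tng Q Z \<in> tng Q" "Z - proj_tng Q Z \<in> lie_algebra (stab Q)"
    and "Y \<in> tng Q \<Longrightarrow> Z - Y \<in> lie_algebra (stab Q) \<Longrightarrow> proj_tng Q Z = Y"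
    using unique by blast+
qed

lemma proj_bracket_Ad:
  assumes Q: "riemannian_hspace Q" and h: "h \<in> stab Q" and X: "X \<in> tng Q" and Y: "Y \<in> tng Q"
  shows "proj_tng Q (lie_bracket (Ad h X) (Ad h Y)) = Ad h (proj_tng Q (lie_bracket X Y))"
proof -
  have G: "compact_matrix_group (grp Q)" and H: "compact_matrix_group (stab Q)"
    and sub: "stab Q \<subseteq> grp Q" and t: "tng Q \<subseteq> lie_algebra (grp Q)"
    using Q by (auto simp: riemannian_hspace_def)
  let ?Z = "lie_bracket X Y"
  have Z: "?Z \<in> lie_algebra (grp Q)" using lie_algebra_bracket[OF G] X Y t by blast
  have "Ad h ?Z - Ad h (proj_tng Q ?Z) \<in> lie_algebra (stab Q)"
    unfolding Ad_linear(2)[symmetric] by (rule lie_algebra_Ad[OF H h proj_tng(2)[OF Q Z]])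
  moreover have "Ad h (proj_tng Q ?Z) \<in> tng Q"
    using Q h proj_tng(1)[OF Q Z] by (auto simp: riemannian_hspace_def)
  moreover have "Ad h ?Z \<in> lie_algebra (grp Q)" using lie_algebra_Ad[OF G _ Z] h sub by blast
  ultimately have "proj_tng Q (Ad h ?Z) = Ad h (proj_tng Q ?Z)" using proj_tng(3)[OF Q] by blast
  then show ?thesis using Ad_bracket[OF matrix_group_closed(4)[OF H h]] by simp
qed

text \<open>
Values off the group do not matter, since the curves that are used stay in it.
\<close>

lemma has_lderiv_const:
  assumes "compact_matrix_group (grp Q)" "a \<in> grp Q" "\<And>b. b \<in> grp Q \<Longrightarrow> f b = k"
  shows "has_lderiv Q X f a 0"
  unfolding has_lderiv_def
proof (intro allI impI)
  fix c assume "tangent_curve (grp Q) X c"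
  then have "f (a ** c t) = k" for t
    using assms(3)[OF matrix_group_closed(2)[OF assms(1,2)]] by (simp add: tangent_curve_def)
  then show "((\<lambda>t. f (a ** c t)) has_vector_derivative 0) (at 0)" by simp
qed

lemma lderiv_const:
  assumes "compact_matrix_group (grp Q)" "a \<in> grp Q" "\<And>b. b \<in> grp Q \<Longrightarrow> f b = k"
    and X: "X \<in> lie_algebra (grp Q)"
  shows "lderiv Q X f a = 0"
  unfolding lderiv_def
proof (rule the_equality)
  show 0: "has_lderiv Q X f a 0"
    by (rule has_lderiv_const[OF assms(1,2)]) (rule assms(3))
  fix D assume D: "has_lderiv Q X f a D"
  obtain c where c: "tangent_curve (grp Q) X c" using X by (auto simp: lie_algebra_def)
  have "((\<lambda>t. f (a ** c t)) has_vector_derivative D) (at 0)"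
    using D c by (simp add: has_lderiv_def)
  moreover have "((\<lambda>t. f (a ** c t)) has_vector_derivative 0) (at 0)"
    using 0 c by (simp add: has_lderiv_def)
  ultimately show "D = 0" by (rule vector_derivative_unique_at)
qed

section \<open>The isotropy group fixes adapted spinors\<close>

context clifford_frame
begin

lemma spin_action_spinors: "\<psi> \<in> spinors n \<Longrightarrow> spin_action Q n e vs \<psi> \<in> spinors n"
  by (induction vs) (simp_all add: spin_action_def cl_spinors)

lemma spin_action_add: "spin_action Q n e vs (\<psi> + \<phi>) = spin_action Q n e vs \<psi> + spin_action Q n e vs \<phi>"
  by (induction vs) (simp_all add: spin_action_def cl_add)

lemma spin_action_smul: "spin_action Q n e vs (smul c \<psi>) = smul c (spin_action Q n e vs \<psi>)"
  by (induction vs) (simp_all add: spin_action_def cl_smul)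

lemma spin_action_charge:
  assumes "\<psi> \<in> spinors n"
  shows "charge n (spin_action Q n e vs \<psi>) = spin_action Q n e vs (charge n \<psi>)"
proof (induction vs)
  case (Cons v vs)
  then show ?case
    using cl_charge[OF spin_action_spinors[OF assms, of vs]] by (simp add: spin_action_def)
qed (simp add: spin_action_def)

lemma hermitian_cl_unit:
  assumes "\<psi> \<in> spinors n" "\<phi> \<in> spinors n" "v \<in> tng Q" "g v v = 1"
  shows "hermitian n (cl v \<psi>) (cl v \<phi>) = hermitian n \<psi> \<phi>"
proof -
  have "cl v (cl v \<phi>) = smul (-1) \<phi>"
  proof
    fix S
    have "cl v (cl v \<phi>) S = - cl v (cl v \<phi>) S - 2 * \<phi> S"
      using fun_cong[OF cl_anticommute[OF assms(2,3,3)], of S] assms(4) by (simp add: pointwise)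
    then show "cl v (cl v \<phi>) S = smul (-1) \<phi> S" by (simp add: smul_apply)
  qed
  then show ?thesis
    using cl_skew[OF assms(1) cl_spinors[OF assms(2)], of v v] by (simp add: hermitian_smul_right)
qed

lemma hermitian_spin_action:
  assumes "\<psi> \<in> spinors n" "\<phi> \<in> spinors n" "\<forall>v\<in>set vs. v \<in> tng Q \<and> g v v = 1"
  shows "hermitian n (spin_action Q n e vs \<psi>) (spin_action Q n e vs \<phi>) = hermitian n \<psi> \<phi>"
  using assms(3)
proof (induction vs)
  case (Cons v vs)
  have "spin_action Q n e (v # vs) \<theta> = cl v (spin_action Q n e vs \<theta>)" for \<theta>
    by (simp add: spin_action_def)
  then show ?case
    using Cons hermitian_cl_unit[OF spin_action_spinors[OF assms(1), of vs] spin_action_spinors[OF assms(2), of vs]]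
    by simp
qed (simp add: spin_action_def)

lemma sharp_eqI:
  assumes "Z \<in> tng Q" "\<And>X. X \<in> tng Q \<Longrightarrow> g Z X = \<alpha> X"
  shows "sharp Q \<alpha> = Z"
  unfolding sharp_def
proof (rule the_equality)
  show "Z \<in> tng Q \<and> (\<forall>X\<in>tng Q. g Z X = \<alpha> X)" using assms by blast
  fix Y assume "Y \<in> tng Q \<and> (\<forall>X\<in>tng Q. g Y X = \<alpha> X)"
  then show "Y = Z" using assms by (intro met_eqI) auto
qed

end

context three_sasakian_frame
begin

lemma intertwiner_sasaki:
  assumes i: "i \<in> reeb_idx"
    and B_mem: "\<And>X. X \<in> tng Q \<Longrightarrow> B X \<in> tng Q"
    and B_surj: "\<And>Y. Y \<in> tng Q \<Longrightarrow> \<exists>X\<in>tng Q. Y = B X"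
    and B_met: "\<And>X Y. X \<in> tng Q \<Longrightarrow> Y \<in> tng Q \<Longrightarrow> g (B X) (B Y) = g X Y"
    and B_reeb: "B (e i) = e i"
    and B_phi: "\<And>X. X \<in> tng Q \<Longrightarrow> B (\<phi> i X) = \<phi> i (B X)"
    and T_spinors: "\<And>\<psi>. \<psi> \<in> spinors n \<Longrightarrow> T \<psi> \<in> spinors n"
    and T_add: "\<And>\<psi> \<phi>'. \<psi> \<in> spinors n \<Longrightarrow> \<phi>' \<in> spinors n \<Longrightarrow> T (\<psi> + \<phi>') = T \<psi> + T \<phi>'"
    and T_smul: "\<And>c \<psi>. \<psi> \<in> spinors n \<Longrightarrow> T (smul c \<psi>) = smul c (T \<psi>)"
    and T_cl: "\<And>X \<psi>. X \<in> tng Q \<Longrightarrow> \<psi> \<in> spinors n \<Longrightarrow> T (cl X \<psi>) = cl (B X) (T \<psi>)"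
    and E: "\<psi> \<in> sasaki_spinors i"
  shows "T \<psi> \<in> sasaki_spinors i"
proof -
  note \<psi> = sasaki_spinorsD[OF E] and \<xi> = reeb_mem[OF i]
  have "defect i Y (T \<psi>) = 0" if Y: "Y \<in> tng Q" for Y
  proof -
    obtain X where X: "X \<in> tng Q" "Y = B X" using B_surj[OF Y] by blast
    have "g (e i) (B X) = g (e i) X" using B_met[OF \<xi> X(1)] by (simp add: B_reeb)
    then have "T (defect i X \<psi>) = defect i (B X) (T \<psi>)"
      using X i by (simp add: defect_def T_add T_smul T_cl phi_mem cl_spinors spinors_add spinors_smul
          \<psi> \<xi> B_phi[symmetric] B_reeb)
    moreover have "T 0 = 0" using T_smul[OF spinors_zero, of 0] by (simp add: smul_def zero_fun_def)
    ultimately show ?thesis using sasaki_defect[OF E X(1)] X(2) by simp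
  qed
  then show ?thesis using T_spinors[OF \<psi>] by (simp add: sasaki_spinors_def)
qed

text \<open>
Rigidity applies to \<open>\<rho>(h)\<close> with the adjoint \<open>\<rho>(h\<inverse>)\<close>.  The scalar depends continuously on \<open>h\<close>, as it
is the lowest coefficient of \<open>\<rho>(h) 1\<close>.
\<close>

lemma spin_lift_invariant:
  assumes lift: "spin_lift Q n e \<rho>"
    and H: "compact_matrix_group (stab Q)" and conn: "connected (stab Q)"
    and Ad_mem: "\<And>h X. h \<in> stab Q \<Longrightarrow> X \<in> tng Q \<Longrightarrow> Ad h X \<in> tng Q"
    and Ad_met: "\<And>h X Y. h \<in> stab Q \<Longrightarrow> X \<in> tng Q \<Longrightarrow> Y \<in> tng Q \<Longrightarrow> g (Ad h X) (Ad h Y) = g X Y"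
    and Ad_reeb: "\<And>h i. h \<in> stab Q \<Longrightarrow> i \<in> reeb_idx \<Longrightarrow> Ad h (e i) = e i"
    and Ad_phi: "\<And>h i X. h \<in> stab Q \<Longrightarrow> i \<in> reeb_idx \<Longrightarrow> X \<in> tng Q \<Longrightarrow> Ad h (\<phi> i X) = \<phi> i (Ad h X)"
    and i: "i \<in> reeb_idx" and E: "\<psi> \<in> sasaki_spinors i" and h: "h \<in> stab Q"
  shows "\<rho> h \<psi> = \<psi>"
proof -
  note us = sasaki_spinorsD[OF unit_form_sasaki]
  have action: "\<exists>vs. (\<forall>v\<in>set vs. v \<in> tng Q \<and> g v v = 1) \<and> (\<forall>\<psi>\<in>spinors n. \<rho> h \<psi> = spin_action Q n e vs \<psi>)"
    if "h \<in> stab Q" for h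
    using lift that unfolding spin_lift_def by blast
  have \<rho>_cl: "\<rho> h (cl X \<psi>) = cl (Ad h X) (\<rho> h \<psi>)" if "h \<in> stab Q" "X \<in> tng Q" "\<psi> \<in> spinors n" for h X \<psi>
    using lift that unfolding spin_lift_def by blast
  have \<rho>_mult: "\<rho> (h ** k) \<psi> = \<rho> h (\<rho> k \<psi>)" if "h \<in> stab Q" "k \<in> stab Q" "\<psi> \<in> spinors n" for h k \<psi>
    using lift that unfolding spin_lift_def by blast
  have \<rho>_cont: "continuous_on (stab Q) (\<lambda>h. \<rho> h \<psi> S)" if "\<psi> \<in> spinors n" for \<psi> S
    using lift that unfolding spin_lift_def by blast
  have \<rho>_spinors: "\<rho> h \<psi> \<in> spinors n" if "h \<in> stab Q" "\<psi> \<in> spinors n" for h \<psi>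
    using action[OF that(1)] that(2) by (auto simp: spin_action_spinors)
  have \<rho>_add: "\<rho> h (\<psi> + \<phi>') = \<rho> h \<psi> + \<rho> h \<phi>'"
    if "h \<in> stab Q" "\<psi> \<in> spinors n" "\<phi>' \<in> spinors n" for h \<psi> \<phi>'
    using action[OF that(1)] that(2,3) by (auto simp: spin_action_add spinors_add)
  have \<rho>_smul: "\<rho> h (smul c \<psi>) = smul c (\<rho> h \<psi>)" if "h \<in> stab Q" "\<psi> \<in> spinors n" for h c \<psi>
    using action[OF that(1)] that(2) by (auto simp: spin_action_smul spinors_smul)
  have \<rho>_charge: "charge n (\<rho> h \<psi>) = \<rho> h (charge n \<psi>)" if "h \<in> stab Q" "\<psi> \<in> spinors n" for h \<psi>
    using action[OF that(1)] that(2) by (auto simp: spin_action_charge charge_spinors)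
  have \<rho>_herm: "hermitian n (\<rho> h \<psi>) (\<rho> h \<phi>') = hermitian n \<psi> \<phi>'"
    if h: "h \<in> stab Q" and s: "\<psi> \<in> spinors n" "\<phi>' \<in> spinors n" for h \<psi> \<phi>'
  proof -
    obtain vs where vs: "\<forall>v\<in>set vs. v \<in> tng Q \<and> g v v = 1"
      "\<forall>\<psi>\<in>spinors n. \<rho> h \<psi> = spin_action Q n e vs \<psi>" using action[OF h] by blast
    show ?thesis using hermitian_spin_action[OF s vs(1)] vs(2) s by simp
  qed
  have one: "mat 1 \<in> stab Q" by (rule matrix_group_closed(1)[OF H])
  \<comment> \<open>an isometric idempotent is the identity\<close>
  have \<rho>_one: "\<rho> (mat 1) \<psi> = \<psi>" if \<psi>: "\<psi> \<in> spinors n" for \<psi>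
  proof -
    let ?r = "\<rho> (mat 1)"
    have s: "?r \<psi> \<in> spinors n" by (rule \<rho>_spinors[OF one \<psi>])
    have d: "?r \<psi> - \<psi> = ?r \<psi> + smul (-1) \<psi>" by (simp flip: minus_smul)
    have "?r (?r \<psi>) = ?r \<psi>" using \<rho>_mult[OF one one \<psi>] by simp
    then have "?r (?r \<psi> - \<psi>) = 0"
      unfolding d \<rho>_add[OF one s spinors_smul[OF \<psi>]] \<rho>_smul[OF one \<psi>] by (simp flip: minus_smul)
    then have "hermitian n (?r \<psi> - \<psi>) (?r \<psi> - \<psi>) = 0"
      using \<rho>_herm[OF one spinors_diff[OF s \<psi>] spinors_diff[OF s \<psi>]] by (simp add: hermitian_def zero_fun_def)
    then have "?r \<psi> - \<psi> = 0" by (rule hermitian_eq_0[OF spinors_diff[OF s \<psi>]])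
    then show ?thesis by simp
  qed
  have inv: "matrix_inv h \<in> stab Q" "h ** matrix_inv h = mat 1" "matrix_inv h ** h = mat 1" "invertible h"
    if "h \<in> stab Q" for h
    using matrix_group_closed(3,4)[OF H that] matrix_inv_mult by blast+
  have \<rho>_sasaki: "\<rho> h \<psi> \<in> sasaki_spinors i"
    if h: "h \<in> stab Q" and i: "i \<in> reeb_idx" and E: "\<psi> \<in> sasaki_spinors i" for h i \<psi>
  proof (rule intertwiner_sasaki[where B = "Ad h", OF i _ _ _ _ _ _ _ _ _ E])
    fix Y assume "Y \<in> tng Q"
    then show "\<exists>X\<in>tng Q. Y = Ad h X"
      using Ad_mem[OF inv(1)[OF h]] Ad_inv(1)[OF inv(4)[OF h]] by metis
  qed (simp_all add: h i Ad_mem Ad_met Ad_reeb Ad_phi \<rho>_spinors \<rho>_add \<rho>_smul \<rho>_cl)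
  have \<rho>_reeb: "\<rho> h (cl (e i) \<psi>) = cl (e i) (\<rho> h \<psi>)"
    if "h \<in> stab Q" "i \<in> reeb_idx" "\<psi> \<in> spinors n" for h i \<psi>
    using \<rho>_cl[OF that(1) reeb_mem[OF that(2)] that(3)] Ad_reeb[OF that(1,2)] by simp
  have scalar: "\<exists>c. (c = 1 \<or> c = -1) \<and> (\<forall>i\<in>reeb_idx. \<forall>\<psi>\<in>sasaki_spinors i. \<rho> h \<psi> = smul c \<psi>)"
    if h: "h \<in> stab Q" for h
  proof -
    note k = inv(1)[OF h]
    obtain c :: real where c: "\<And>i \<psi>. i \<in> reeb_idx \<Longrightarrow> \<psi> \<in> sasaki_spinors i \<Longrightarrow> \<rho> h \<psi> = smul (of_real c) \<psi>"
    proof (rule rigidity[of "\<rho> h" "\<rho> (matrix_inv h)"])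
      fix i \<psi> assume "i \<in> reeb_idx" "\<psi> \<in> sasaki_spinors i"
      then show "\<rho> h \<psi> \<in> sasaki_spinors i" "\<rho> h (cl (e i) \<psi>) = cl (e i) (\<rho> h \<psi>)"
        by (auto intro: \<rho>_sasaki[OF h] \<rho>_reeb[OF h] sasaki_spinorsD)
    next
      show "\<rho> (matrix_inv h) unit_form \<in> sasaki_spinors 1"
        by (intro \<rho>_sasaki k unit_form_sasaki reeb_idx_simps)
      show "\<rho> (matrix_inv h) (cl (e 1) unit_form) = cl (e 1) (\<rho> (matrix_inv h) unit_form)"
        by (intro \<rho>_reeb k us reeb_idx_simps)
      show "\<rho> (matrix_inv h) (smul \<i> unit_form) = smul \<i> (\<rho> (matrix_inv h) unit_form)"
        by (intro \<rho>_smul k us)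
      show "charge n (\<rho> (matrix_inv h) unit_form) = \<rho> (matrix_inv h) (charge n unit_form)"
        by (intro \<rho>_charge k us)
      fix \<psi> \<phi>' assume s: "\<psi> \<in> spinors n" "\<phi>' \<in> spinors n"
      have "\<rho> h (\<rho> (matrix_inv h) \<phi>') = \<phi>'"
        using \<rho>_mult[OF h k s(2)] inv(2)[OF h] \<rho>_one[OF s(2)] by simp
      then show "hermitian n (\<rho> h \<psi>) \<phi>' = hermitian n \<psi> (\<rho> (matrix_inv h) \<phi>')"
        using \<rho>_herm[OF h s(1) \<rho>_spinors[OF k s(2)]] by simp
    qed blast
    have "hermitian n (\<rho> h unit_form) (\<rho> h unit_form) = 1"
      unfolding \<rho>_herm[OF h us us] by (simp add: hermitian_unit_form unit_form_def)
    then have "complex_of_real (c * c) = 1"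
      unfolding c[OF reeb_idx_simps(1) unit_form_sasaki]
      by (simp add: hermitian_smul_left hermitian_smul_right hermitian_unit_form unit_form_def)
    then have "c * c = 1" by (simp only: of_real_eq_1_iff)
    then have "c = 1 \<or> c = -1" by (simp add: square_eq_1_iff)
    then show ?thesis using c by (intro exI[of _ "of_real c"]) auto
  qed
  define f where "f h = \<rho> h unit_form {}" for h
  have f: "(f h = 1 \<or> f h = -1) \<and> (\<forall>i\<in>reeb_idx. \<forall>\<psi>\<in>sasaki_spinors i. \<rho> h \<psi> = smul (f h) \<psi>)"
    if h: "h \<in> stab Q" for h
  proof -
    obtain c where c: "c = 1 \<or> c = -1" "\<forall>i\<in>reeb_idx. \<forall>\<psi>\<in>sasaki_spinors i. \<rho> h \<psi> = smul c \<psi>"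
      using scalar[OF h] by blast
    have "\<rho> h unit_form = smul c unit_form" using c(2) unit_form_sasaki reeb_idx_simps(1) by blast
    then have "f h = c" by (simp add: f_def smul_apply unit_form_def)
    then show ?thesis using c by simp
  qed
  have "continuous_on (stab Q) f" unfolding f_def by (rule \<rho>_cont[OF us])
  then have "connected (f ` stab Q)" using conn by (rule connected_continuous_image)
  moreover have "finite (f ` stab Q)" by (rule finite_subset[of _ "{1, -1}"]) (use f in auto)
  ultimately have "f ` stab Q = {} \<or> (\<exists>c. f ` stab Q = {c})"
    using connected_finite_iff_sing[of "f ` stab Q"] by simp
  then have "f h = f (mat 1)" using h one by (metis empty_iff imageI singletonD)
  also have "\<dots> = 1" unfolding f_def \<rho>_one[OF us] by (simp add: unit_form_def)
  finally show ?thesis using f[OF h] i E by simp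
qed

end

section \<open>The Sasakian structures and their Killing spinors\<close>

text \<open>
Invariant fields are constant on the group, so all their derivatives vanish, and the differential
conditions reduce to algebraic ones at the identity.
\<close>

lemma homogeneous_three_sasakian_frame:
  fixes Q :: "('n::finite) hspace"
  assumes hom: "homogeneous_three_sasakian Q \<Lambda> \<xi>" and basis: "adapted_basis Q \<Lambda> \<xi> n e"
  shows "three_sasakian_frame Q n e \<Lambda>"
    and "a \<in> grp Q \<Longrightarrow> i \<in> reeb_idx \<Longrightarrow> \<xi> i a = e i"
    and "a \<in> grp Q \<Longrightarrow> i \<in> reeb_idx \<Longrightarrow> X \<in> tng Q \<Longrightarrow> reeb_end Q \<Lambda> (\<xi> i) a X = structure_end \<Lambda> e i X"
proof -
  have R: "riemannian_hspace Q" and LC: "levi_civita Q \<Lambda>" and TS: "three_sasakian Q \<Lambda> \<xi>"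
    and inv: "\<And>i. i \<in> reeb_idx \<Longrightarrow> invariant_field Q (\<xi> i)"
    using hom by (auto simp: homogeneous_three_sasakian_def reeb_idx_def)
  have G: "compact_matrix_group (grp Q)" and t: "tng Q \<subseteq> lie_algebra (grp Q)"
    using R by (auto simp: riemannian_hspace_def)
  note one = matrix_group_closed(1)[OF G]
  have e: "e i = \<xi> i (mat 1)" if "i \<in> reeb_idx" for i
    using basis that unfolding adapted_basis_def reeb_idx_def by blast
  have \<xi>: "\<xi> i a = e i" if "a \<in> grp Q" "i \<in> reeb_idx" for a i
  proof -
    have "\<xi> i (a ** mat 1) = \<xi> i (mat 1)"
      using inv[OF that(2)] that(1) one unfolding invariant_field_def by blast
    then show ?thesis using e[OF that(2)] by simp
  qed
  have lder: "lderiv Q X (\<xi> i) a = 0" if "a \<in> grp Q" "i \<in> reeb_idx" "X \<in> tng Q" for a i X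
    using that t by (intro lderiv_const[OF G that(1) \<xi>[OF _ that(2)]]) auto
  have cov: "cov_vf Q \<Lambda> X (\<xi> i) a = \<Lambda> X (e i)" if "a \<in> grp Q" "i \<in> reeb_idx" "X \<in> tng Q" for a i X
    using lder[OF that] \<xi>[OF that(1,2)] by (simp add: cov_vf_def)
  have end_eq: "reeb_end Q \<Lambda> (\<xi> i) a X = structure_end \<Lambda> e i X"
    if "a \<in> grp Q" "i \<in> reeb_idx" "X \<in> tng Q" for a i X
    using cov[OF that] by (simp add: reeb_end_def structure_end_def)
  have sas: "sasakian Q \<Lambda> (\<xi> i)" if "i \<in> reeb_idx" for i
    using TS that unfolding three_sasakian_def reeb_idx_def by blast
  have mem: "e i \<in> tng Q" if "i \<in> reeb_idx" for i
  proof -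
    have "vector_field Q (\<xi> i)" using sas[OF that] by (simp add: sasakian_def killing_field_def)
    then show ?thesis using e[OF that] one by (simp add: vector_field_def)
  qed
  have \<Lambda>_mem: "\<Lambda> X Y \<in> tng Q" if "X \<in> tng Q" "Y \<in> tng Q" for X Y
    using LC that by (simp add: levi_civita_def)
  have torsion: "\<Lambda> X Y - \<Lambda> Y X = proj_tng Q (lie_bracket X Y)" if "X \<in> tng Q" "Y \<in> tng Q" for X Y
    using LC that by (simp add: levi_civita_def)
  have sub: "subspace (tng Q)" using R by (simp add: riemannian_hspace_def)
  have bil: "bilinear_on (tng Q) (met Q)" using R by (simp add: riemannian_hspace_def)
  have minus: "met Q (- X) Y = - met Q X Y" "met Q Y (- X) = - met Q Y X" if "X \<in> tng Q" "Y \<in> tng Q" for X Y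
    using bil[unfolded bilinear_on_def, rule_format, of X X Y "-1" 0] that by simp_all
  show "three_sasakian_frame Q n e \<Lambda>"
  proof
    show "1 \<le> n" "span (e ` {1..4*n-1}) = tng Q"
      using basis by (simp_all add: adapted_basis_def)
    fix a b assume "a \<in> {1..4*n-1}" "b \<in> {1..4*n-1}"
    then show "met Q (e a) (e b) = (if a = b then 1 else 0)"
      using basis by (simp add: adapted_basis_def)
  next
    show "bilinear_on (tng Q) (met Q)" by (rule bil)
    fix X Y assume "X \<in> tng Q" "Y \<in> tng Q"
    then show "met Q X Y = met Q Y X" using R by (simp add: riemannian_hspace_def)
  next
    fix X Y assume "X \<in> tng Q" "Y \<in> tng Q"
    then show "\<Lambda> X Y \<in> tng Q" by (rule \<Lambda>_mem)
  next
    show "bilinear_on (tng Q) \<Lambda>" using LC by (simp add: levi_civita_def)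
  next
    fix X Y Z assume "X \<in> tng Q" "Y \<in> tng Q" "Z \<in> tng Q"
    then show "met Q (\<Lambda> X Y) Z = - met Q Y (\<Lambda> X Z)" using LC by (simp add: levi_civita_def)
  next
    fix i X Y assume i: "i \<in> reeb_idx" and X: "X \<in> tng Q" and Y: "Y \<in> tng Q"
    have "met Q (cov_vf Q \<Lambda> X (\<xi> i) (mat 1)) Y + met Q X (cov_vf Q \<Lambda> Y (\<xi> i) (mat 1)) = 0"
      using sas[OF i] one X Y unfolding sasakian_def killing_field_def by blast
    then show "met Q (structure_end \<Lambda> e i X) Y = - met Q X (structure_end \<Lambda> e i Y)"
      by (simp add: cov[OF one i] X Y structure_end_def minus \<Lambda>_mem mem[OF i])
  next
    fix i X Y assume i: "i \<in> reeb_idx" and X: "X \<in> tng Q" and Y: "Y \<in> tng Q"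
    let ?F = "reeb_end Q \<Lambda> (\<xi> i)"
    have 0: "lderiv Q X (\<lambda>b. ?F b Y) (mat 1) = 0"
      by (rule lderiv_const[OF G one end_eq[OF _ i Y]]) (use t X in auto)
    have "cov_end Q \<Lambda> X ?F (mat 1) Y = met Q X Y *\<^sub>R \<xi> i (mat 1) - reeb_form Q (\<xi> i) (mat 1) Y *\<^sub>R X"
      using sas[OF i] one X Y unfolding sasakian_def by blast
    then show "\<Lambda> X (structure_end \<Lambda> e i Y) - structure_end \<Lambda> e i (\<Lambda> X Y)
        = met Q X Y *\<^sub>R e i - met Q (e i) Y *\<^sub>R X"
      by (simp add: cov_end_def 0 end_eq[OF one i] Y \<Lambda>_mem X \<xi>[OF one i] reeb_form_def)
  next
    fix i j k :: nat assume c: "(i, j, k) \<in> {(1,2,3), (2,3,1), (3,1,2)}"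
    have ijk: "i \<in> reeb_idx" "j \<in> reeb_idx" "k \<in> reeb_idx" using cyclic_reeb_idx[OF c] by auto
    have "vf_bracket Q (\<xi> i) (\<xi> j) (mat 1) = 2 *\<^sub>R \<xi> k (mat 1)"
      using TS c one unfolding three_sasakian_def by blast
    then have "\<Lambda> (e i) (e j) - \<Lambda> (e j) (e i) = 2 *\<^sub>R e k"
      using ijk by (simp add: vf_bracket_def \<xi>[OF one] lder[OF one] mem torsion)
    then show "structure_end \<Lambda> e i (e j) - structure_end \<Lambda> e j (e i) = 2 *\<^sub>R e k"
      by (simp add: structure_end_def)
  next
    fix i p assume i: "i \<in> reeb_idx" and p: "p \<in> {1..n-1}"
    have "e (4*p) \<in> span (e ` {1..4*n-1})" by (rule span_base) (use p in auto)
    then have "e (4*p) \<in> tng Q" using basis by (simp add: adapted_basis_def)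
    moreover have "e (4*p+i) = reeb_end Q \<Lambda> (\<xi> i) (mat 1) (e (4*p))"
      using basis i p unfolding adapted_basis_def reeb_idx_def by blast
    ultimately show "e (4*p+i) = structure_end \<Lambda> e i (e (4*p))" using end_eq[OF one i] by simp
  qed
  show "a \<in> grp Q \<Longrightarrow> i \<in> reeb_idx \<Longrightarrow> \<xi> i a = e i" by (rule \<xi>)
  show "a \<in> grp Q \<Longrightarrow> i \<in> reeb_idx \<Longrightarrow> X \<in> tng Q \<Longrightarrow> reeb_end Q \<Lambda> (\<xi> i) a X = structure_end \<Lambda> e i X"
    by (rule end_eq)
qed

theorem theorem6p6:
  fixes Q :: "('n::finite) hspace"
    and act :: "real^'n^'n \<Rightarrow> 'p::t2_space \<Rightarrow> 'p"
    and M :: "'p set"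
    and p0 :: 'p
    and \<Lambda> :: "real^'n^'n \<Rightarrow> real^'n^'n \<Rightarrow> real^'n^'n"
    and \<xi> :: "nat \<Rightarrow> real^'n^'n \<Rightarrow> real^'n^'n"
    and e :: "nat \<Rightarrow> real^'n^'n"
    and \<rho> :: "real^'n^'n \<Rightarrow> spinor \<Rightarrow> spinor"
    and n i j :: nat
    and \<Psi> \<Psi>' :: "real^'n^'n \<Rightarrow> spinor"
  assumes "simply_connected_quotient Q act M p0"
    and "homogeneous_three_sasakian Q \<Lambda> \<xi>"
    and "adapted_basis Q \<Lambda> \<xi> n e"
    and "spin_lift Q n e \<rho>"
    and "i \<in> {1, 2, 3}" and "j \<in> {0, 1}"
    and \<Psi>_def: "\<Psi> = (\<lambda>a. Psi n i j)"
    and \<Psi>'_def: "\<Psi>' = (\<lambda>a S. - cliff Q n e (\<xi> i a) (Psi n i j) S)"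
  shows "killing_spinor Q \<Lambda> n e \<rho> \<Psi> \<and> killing_spinor Q \<Lambda> n e \<rho> \<Psi>' \<and>
     (\<exists>l>0. \<forall>a\<in>grp Q.
        tnorm Q (assoc_field Q n e \<Psi> \<Psi>' a) = l \<and>
        \<xi> i a = (1 / l) *\<^sub>R assoc_field Q n e \<Psi> \<Psi>' a \<and>
        (\<forall>X\<in>tng Q. reeb_form Q (\<xi> i) a X = (1 / l) * assoc_form Q n e \<Psi> \<Psi>' a X) \<and>
        (\<forall>X\<in>tng Q. reeb_end Q \<Lambda> (\<xi> i) a X = (1 / l) *\<^sub>R assoc_end Q n e \<Psi> \<Psi>' a X))"
proof -
  interpret three_sasakian_frame Q n e \<Lambda>
    by (rule homogeneous_three_sasakian_frame(1)[OF assms(2,3)])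
  note \<xi> = homogeneous_three_sasakian_frame(2)[OF assms(2,3)]
  note reeb_end = homogeneous_three_sasakian_frame(3)[OF assms(2,3)]
  have i: "i \<in> reeb_idx" using assms(5) by (simp add: reeb_idx_def)
  have R: "riemannian_hspace Q" and LC: "levi_civita Q \<Lambda>" and TS: "three_sasakian Q \<Lambda> \<xi>"
    using assms(2) by (auto simp: homogeneous_three_sasakian_def)
  have G: "compact_matrix_group (grp Q)" and H: "compact_matrix_group (stab Q)"
    and sub: "stab Q \<subseteq> grp Q" and t: "tng Q \<subseteq> lie_algebra (grp Q)"
    using R by (auto simp: riemannian_hspace_def)
  have conn: "connected (stab Q)" using assms(1) unfolding simply_connected_quotient_def by blast
  have Ad_mem: "Ad h X \<in> tng Q" if "h \<in> stab Q" "X \<in> tng Q" for h X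
    using R that by (simp add: riemannian_hspace_def)
  have Ad_met: "g (Ad h X) (Ad h Y) = g X Y" if "h \<in> stab Q" "X \<in> tng Q" "Y \<in> tng Q" for h X Y
    using R that by (simp add: riemannian_hspace_def)
  have inv: "matrix_inv h \<in> stab Q" "invertible h" if "h \<in> stab Q" for h
    using matrix_group_closed(3,4)[OF H that] by auto
  have Ad_reeb: "Ad h (e i) = e i" if h: "h \<in> stab Q" and i: "i \<in> reeb_idx" for h i
  proof -
    have "vector_field Q (\<xi> i)"
      using TS i by (auto simp: three_sasakian_def reeb_idx_def sasakian_def killing_field_def)
    then have "\<xi> i (mat 1 ** h) = Ad (matrix_inv h) (\<xi> i (mat 1))"
      using matrix_group_closed(1)[OF G] h unfolding vector_field_def by blast
    then have "e i = Ad (matrix_inv h) (e i)"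
      using \<xi>[OF _ i] h sub matrix_group_closed(1)[OF G] by auto
    then show ?thesis using Ad_inv(1)[OF inv(2)[OF h], of "e i"] by simp
  qed
  have torsion: "\<Lambda> X Y - \<Lambda> Y X = proj_tng Q (lie_bracket X Y)" if "X \<in> tng Q" "Y \<in> tng Q" for X Y
    using LC that by (simp add: levi_civita_def)
  have proj_mem: "proj_tng Q (lie_bracket X Y) \<in> tng Q" if "X \<in> tng Q" "Y \<in> tng Q" for X Y
    using torsion[OF that] that by (metis connection_mem tng_diff)
  \<comment> \<open>this is \<open>- d\<eta>\<^sub>i(X, Y)\<close>; it also expresses \<open>\<phi>\<^sub>i\<close> by data that the isotropy group preserves\<close>
  have eta_bracket: "g (e i) (proj_tng Q (lie_bracket X Y)) = 2 * g (\<phi> i X) Y"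
    if i: "i \<in> reeb_idx" and X: "X \<in> tng Q" and Y: "Y \<in> tng Q" for i X Y
  proof -
    note m = reeb_mem[OF i] connection_mem phi_mem[OF i] X Y
    have "g (e i) (\<Lambda> X Y) = g (\<phi> i X) Y" if "X \<in> tng Q" "Y \<in> tng Q" for X Y
      using connection_skew[OF that(1) reeb_mem[OF i] that(2)] that
      by (simp add: structure_end_def met_minus_left connection_mem reeb_mem i)
    then have "g (e i) (\<Lambda> X Y - \<Lambda> Y X) = g (\<phi> i X) Y - g (\<phi> i Y) X"
      using m by (simp add: met_commute[of "e i"] tng_diff met_diff_left)
    also have "g (\<phi> i Y) X = - g (\<phi> i X) Y"
      using reeb_killing[OF i Y X] met_commute[OF Y phi_mem[OF i X]] by simp
    finally show ?thesis using torsion[OF X Y] by simp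
  qed
  have Ad_phi: "Ad h (\<phi> i X) = \<phi> i (Ad h X)" if h: "h \<in> stab Q" and i: "i \<in> reeb_idx" and X: "X \<in> tng Q" for h i X
  proof (rule met_eqI)
    fix Z assume Z: "Z \<in> tng Q"
    define W where "W = Ad (matrix_inv h) Z"
    have W: "W \<in> tng Q" "Z = Ad h W"
      using Ad_mem[OF inv(1)[OF h] Z] Ad_inv(1)[OF inv(2)[OF h], of Z] by (simp_all add: W_def)
    have "2 * g (\<phi> i (Ad h X)) (Ad h W) = g (e i) (Ad h (proj_tng Q (lie_bracket X W)))"
      using eta_bracket[OF i Ad_mem[OF h X] Ad_mem[OF h W(1)]] proj_bracket_Ad[OF R h X W(1)] by simp
    also have "\<dots> = g (e i) (proj_tng Q (lie_bracket X W))"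
      using Ad_met[OF h reeb_mem[OF i] proj_mem[OF X W(1)]] Ad_reeb[OF h i] by simp
    also have "\<dots> = 2 * g (Ad h (\<phi> i X)) (Ad h W)"
      using eta_bracket[OF i X W(1)] Ad_met[OF h phi_mem[OF i X] W(1)] by simp
    finally show "g (Ad h (\<phi> i X)) Z = g (\<phi> i (Ad h X)) Z" using W(2) by simp
  qed (use phi_mem[OF i] Ad_mem[OF h] X in auto)
  have killing: "killing_spinor Q \<Lambda> n e \<rho> \<theta>"
    if \<theta>: "\<And>a. a \<in> grp Q \<Longrightarrow> \<theta> a = \<psi>" and E: "\<psi> \<in> sasaki_spinors i" for \<theta> \<psi>
  proof -
    note \<psi> = sasaki_spinorsD[OF E]
    have "\<rho> h (\<theta> (a ** h)) = \<theta> a" if "a \<in> grp Q" "h \<in> stab Q" for a h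
    proof -
      have "a ** h \<in> grp Q" using that sub matrix_group_closed(2)[OF G] by blast
      then show ?thesis
        using \<theta> that spin_lift_invariant[OF assms(4) H conn Ad_mem Ad_met Ad_reeb Ad_phi i E] by simp
    qed
    moreover have "differentiable_fun Q (\<lambda>a. \<theta> a S)" for S
      unfolding differentiable_fun_def
      using has_lderiv_const[OF G, of _ "\<lambda>a. \<theta> a S" "\<psi> S"] \<theta> by metis
    ultimately have "spinor_field Q n \<rho> \<theta>" using \<theta> \<psi> by (simp add: spinor_field_def)
    moreover have "cov_spinor Q \<Lambda> n e X \<theta> a S = of_real (1/2) * cl X (\<theta> a) S"
      if a: "a \<in> grp Q" and X: "X \<in> tng Q" for a X S
    proof -
      have "lderiv Q X (\<lambda>b. \<theta> b S) a = 0"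
        using lderiv_const[OF G a, of "\<lambda>b. \<theta> b S" "\<psi> S" X] \<theta> X t by auto
      moreover have "spin_rep Q n e (\<Lambda> X) \<psi> S = 1/2 * cl X \<psi> S"
        using fun_cong[OF killing_defect_sasaki_eq_0[OF X i E], of S]
        by (simp add: killing_defect_def pointwise)
      ultimately show ?thesis by (simp add: cov_spinor_def \<theta>[OF a])
    qed
    ultimately show ?thesis unfolding killing_spinor_def by blast
  qed
  define \<psi> where "\<psi> = Psi n i j"
  have E: "\<psi> \<in> sasaki_spinors i" and nz: "\<psi> \<noteq> 0"
    unfolding \<psi>_def by (rule Psi_sasaki[OF i assms(6)])+
  note \<psi> = sasaki_spinorsD[OF E]
  define \<psi>' where "\<psi>' = - cl (e i) \<psi>"
  have E': "\<psi>' \<in> sasaki_spinors i"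
    unfolding \<psi>'_def minus_smul by (intro sasaki_smul sasaki_reeb i E)
  have \<Psi>: "\<Psi> a = \<psi>" for a by (simp add: \<Psi>_def \<psi>_def)
  have \<Psi>': "\<Psi>' a = \<psi>'" if "a \<in> grp Q" for a
    unfolding \<Psi>'_def \<psi>'_def \<xi>[OF that i] \<psi>_def by (simp add: fun_eq_iff pointwise)
  define l where "l = Re (hermitian n \<psi> \<psi>)"
  have l: "l > 0"
  proof -
    obtain S where "\<psi> S \<noteq> 0" using nz by (auto simp: fun_eq_iff zero_fun_def)
    then show ?thesis unfolding l_def using hermitian_self_pos spinors_eq_0[OF \<psi>] by blast
  qed
  \<comment> \<open>\<open>X \<cdot> \<xi>\<^sub>i\<close> has adjoint \<open>\<xi>\<^sub>i \<cdot> X = - X \<cdot> \<xi>\<^sub>i - 2 \<eta>\<^sub>i(X)\<close>, which determines the real part\<close>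
  have form: "assoc_form Q n e \<Psi> \<Psi>' a X = l * g (e i) X" if a: "a \<in> grp Q" and X: "X \<in> tng Q" for a X
  proof -
    define w where "w = hermitian n \<psi> (cl X (cl (e i) \<psi>))"
    have "cnj w = hermitian n \<psi> (cl (e i) (cl X \<psi>))"
      unfolding w_def hermitian_cnj by (simp add: cl_skew \<psi> cl_spinors)
    also have "cl (e i) (cl X \<psi>) = smul (-1) (cl X (cl (e i) \<psi>)) + smul (- of_real (2 * g (e i) X)) \<psi>"
      using cl_anticommute[OF \<psi> reeb_mem[OF i] X] by (simp add: fun_eq_iff pointwise)
    also have "hermitian n \<psi> \<dots> = - w - of_real (2 * g (e i) X) * hermitian n \<psi> \<psi>"
      by (simp add: hermitian_add_right hermitian_smul_right w_def)
    finally have "Re (cnj w) = Re (- w - of_real (2 * g (e i) X) * hermitian n \<psi> \<psi>)"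
      by (rule arg_cong)
    then have "Re w = - Re w - 2 * g (e i) X * l"
      by (simp only: minus_complex.simps uminus_complex.simps times_complex.simps cnj.simps l_def
          Re_complex_of_real Im_complex_of_real mult_zero_left diff_zero)
    then have "Re w = - (l * g (e i) X)" by (simp only: mult.assoc mult.commute[of l])
    moreover have "hermitian n \<psi> (cl X \<psi>') = - w"
      by (simp add: \<psi>'_def minus_smul cl_smul hermitian_smul_right w_def)
    ultimately show ?thesis by (simp add: assoc_form_def \<Psi> \<Psi>'[OF a])
  qed
  have field: "assoc_field Q n e \<Psi> \<Psi>' a = l *\<^sub>R e i" if a: "a \<in> grp Q" for a
    unfolding assoc_field_def
    by (rule sharp_eqI) (simp_all add: form[OF a] tng_scale reeb_mem i met_scale_left)
  have end_eq: "assoc_end Q n e \<Psi> \<Psi>' a X = l *\<^sub>R \<phi> i X" if a: "a \<in> grp Q" and X: "X \<in> tng Q" for a X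
  proof -
    let ?\<alpha> = "assoc_form Q n e \<Psi> \<Psi>'"
    have "ext_deriv Q ?\<alpha> a X Y = - 2 * l * g (\<phi> i X) Y" if Y: "Y \<in> tng Q" for Y
    proof -
      have "lderiv Q Z (\<lambda>b. ?\<alpha> b W) a = 0" if "Z \<in> tng Q" "W \<in> tng Q" for Z W
        using that t by (intro lderiv_const[OF G a form[OF _ that(2)]]) auto
      then show ?thesis
        using X Y by (simp add: ext_deriv_def form[OF a] proj_mem eta_bracket i)
    qed
    then have "sharp Q (ext_deriv Q ?\<alpha> a X) = (- 2 * l) *\<^sub>R \<phi> i X"
      by (intro sharp_eqI) (simp_all add: tng_scale phi_mem i X met_scale_left del: scaleR_minus_left)
    then show ?thesis by (simp add: assoc_end_def)
  qed
  have "tnorm Q (assoc_field Q n e \<Psi> \<Psi>' a) = l \<and>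
        \<xi> i a = (1 / l) *\<^sub>R assoc_field Q n e \<Psi> \<Psi>' a \<and>
        (\<forall>X\<in>tng Q. reeb_form Q (\<xi> i) a X = (1 / l) * assoc_form Q n e \<Psi> \<Psi>' a X) \<and>
        (\<forall>X\<in>tng Q. reeb_end Q \<Lambda> (\<xi> i) a X = (1 / l) *\<^sub>R assoc_end Q n e \<Psi> \<Psi>' a X)"
    if a: "a \<in> grp Q" for a
  proof (intro conjI ballI)
    have "g (l *\<^sub>R e i) (l *\<^sub>R e i) = l * l"
      using met_commute[OF reeb_mem[OF i] tng_scale[OF reeb_mem[OF i]], of l]
      by (simp add: met_scale_left tng_scale reeb_mem i reeb_orthonormal)
    then show "tnorm Q (assoc_field Q n e \<Psi> \<Psi>' a) = l"
      using l by (simp add: field[OF a] tnorm_def)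
    show "\<xi> i a = (1 / l) *\<^sub>R assoc_field Q n e \<Psi> \<Psi>' a"
      using l by (simp add: field[OF a] \<xi>[OF a i])
    fix X assume X: "X \<in> tng Q"
    show "reeb_form Q (\<xi> i) a X = (1 / l) * assoc_form Q n e \<Psi> \<Psi>' a X"
      using l by (simp add: form[OF a X] reeb_form_def \<xi>[OF a i])
    show "reeb_end Q \<Lambda> (\<xi> i) a X = (1 / l) *\<^sub>R assoc_end Q n e \<Psi> \<Psi>' a X"
      using l by (simp add: end_eq[OF a X] reeb_end[OF a i X])
  qed
  moreover have "killing_spinor Q \<Lambda> n e \<rho> \<Psi>" by (rule killing[OF \<Psi> E])
  moreover have "killing_spinor Q \<Lambda> n e \<rho> \<Psi>'" by (rule killing[OF \<Psi>' E'])
  ultimately show ?thesis using l by blast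
qed

end
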